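(* Let $L/K$ be a separable (not necessarily finite) field extension, and let $R=(L/K,\beta)$ be an object crossed product defined by $L/K$ and $\beta$. Then $R$ is separable over $R_0$ if and only if $\mathrm{Aut}_K(L)$ is finite. In particular, if $L/K$ is Galois, then $R$ is separable over $R_0=L$ if and only if $L/K$ is finite.
   Context: Construction of $(L/K,\beta)$. Let $L/K$ be a separable (in particular algebraic) field extension of possibly infinite degree and let $\overline{K}$ be a fixed algebraic closure of $K$ containing $L$. Let $N/K$ be a normal closure of $L/K$ in $\overline{K}$, let $G$ be the Galois group of $N/K$, and let $\{L_i\}_{i\in I}$ be the different conjugate fields of $L$ under the action of $G$. For $i,j\in I$ put $G_{ij}=\{g|_{L_j}\mid g\in G,\ g(L_j)=L_i\}$. Then $\mathcal{G}=\biguplus_{i,j\in I}G_{ij}$ is a groupoid under composition; for $\sigma\in G_{ij}$ one has $d(\sigma)=j$, $r(\sigma)=i$ (identifying the identity $\mathrm{id}_{L_i}$ with $i$), so $\mathcal{G}_0$ is identified with $I$. The set of composable pairs is $\mathcal{G}_2=\{(\sigma,\tau)\mid d(\sigma)=r(\tau)\}$, and $\mathcal{G}_3$ is the set of composable triples. Let $\beta$ assign to each $(\sigma,\tau)\in\mathcal{G}_2$ an element $\beta_{\sigma,\tau}\in L_{r(\sigma)}\setminus\{0\}$ such that $\beta_{\sigma,d(\sigma)}=\beta_{r(\sigma),\sigma}=1$ for all $\sigma\in\mathcal{G}$ and $\beta_{\sigma,\tau}\beta_{\sigma\tau,\rho}=\sigma(\beta_{\tau,\rho})\beta_{\sigma,\tau\rho}$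 for all $(\sigma,\tau,\rho)\in\mathcal{G}_3$. The ring $R=(L/K,\beta)$ is the additive group of formal sums $\sum_{\sigma\in\mathcal{G}}a_\sigma u_\sigma$ with $a_\sigma\in L_{r(\sigma)}$, almost all zero, with multiplication the additive extension of $xu_\sigma\cdot yu_\tau=x\sigma(y)\beta_{\sigma,\tau}u_{\sigma\tau}$ if $(\sigma,\tau)\in\mathcal{G}_2$, and $0$ otherwise. It is $\mathcal{G}$-graded by $R_\sigma=L_{r(\sigma)}u_\sigma$, and $R_0=\bigoplus_{i\in I}L_iu_{\mathrm{id}_{L_i}}$. If $L/K$ is Galois, then $I$ is a singleton and $R_0=Lu_{\mathrm{id}_L}$ is identified with $L$. Rings are associative, not necessarily unital. For a subring $T\subseteq S$, $S$ is separable over $T$ if the multiplication map $\mu:S\otimes_TS\to S$ has an $S$-bimodule section. $\mathrm{Aut}_K(L)$ is the group of field automorphisms of $L$ fixing $K$ pointwise. *)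

theory Defs
  imports "HOL-Algebra.Algebraic_Closure" "HOL-Algebra.Free_Abelian_Groups"
begin

section \<open>Separability of a ring over a subring\<close>

text \<open>
  Rings are not assumed to be unital, so nothing in this section refers to the unit of the
  record \<open>S\<close>. The tensor product of \<open>S\<close> with itself over \<open>T\<close> is the free abelian group on pairs
  modulo biadditivity and \<open>T\<close>-balancedness; its elements are cosets.
\<close>

definition tensor_relators :: "('s, 'm) ring_scheme \<Rightarrow> 's set \<Rightarrow> ('s \<times> 's \<Rightarrow>\<^sub>0 int) set" where
  "tensor_relators S T =
     {frag_of (x \<oplus>\<^bsub>S\<^esub> x', y) - frag_of (x, y) - frag_of (x', y) | x x' y.
        x \<in> carrier S \<and> x' \<in> carrier S \<and> y \<in> carrier S}
   \<union> {frag_of (x, y \<oplus>\<^bsub>S\<^esub> y') - frag_of (x, y) - frag_of (x, y') | x y y'.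
        x \<in> carrier S \<and> y \<in> carrier S \<and> y' \<in> carrier S}
   \<union> {frag_of (x \<otimes>\<^bsub>S\<^esub> t, y) - frag_of (x, t \<otimes>\<^bsub>S\<^esub> y) | x t y.
        x \<in> carrier S \<and> t \<in> T \<and> y \<in> carrier S}"

abbreviation free_pairs :: "('s, 'm) ring_scheme \<Rightarrow> ('s \<times> 's \<Rightarrow>\<^sub>0 int) monoid" where
  "free_pairs S \<equiv> free_Abelian_group (carrier S \<times> carrier S)"

definition tensor_kernel :: "('s, 'm) ring_scheme \<Rightarrow> 's set \<Rightarrow> ('s \<times> 's \<Rightarrow>\<^sub>0 int) set" where
  "tensor_kernel S T = generate (free_pairs S) (tensor_relators S T)"

definition tensor_square :: "('s, 'm) ring_scheme \<Rightarrow> 's set \<Rightarrow> ('s \<times> 's \<Rightarrow>\<^sub>0 int) set monoid" where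
  "tensor_square S T = free_pairs S Mod tensor_kernel S T"

text \<open>
  The bimodule structure and the multiplication map are induced by \<open>s(x \<otimes> y) = sx \<otimes> y\<close>,
  \<open>(x \<otimes> y)s = x \<otimes> ys\<close> and \<open>x \<otimes> y \<mapsto> xy\<close>. Adding the kernel to the image of a coset
  completes that image to a full coset.
\<close>

definition tensor_lact ::
  "('s, 'm) ring_scheme \<Rightarrow> 's set \<Rightarrow> 's \<Rightarrow> ('s \<times> 's \<Rightarrow>\<^sub>0 int) set \<Rightarrow> ('s \<times> 's \<Rightarrow>\<^sub>0 int) set" where
  "tensor_lact S T s C =
     set_mult (free_pairs S) (tensor_kernel S T) (frag_extend (\<lambda>(x, y). frag_of (s \<otimes>\<^bsub>S\<^esub> x, y)) ` C)"

definition tensor_ract ::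
  "('s, 'm) ring_scheme \<Rightarrow> 's set \<Rightarrow> ('s \<times> 's \<Rightarrow>\<^sub>0 int) set \<Rightarrow> 's \<Rightarrow> ('s \<times> 's \<Rightarrow>\<^sub>0 int) set" where
  "tensor_ract S T C s =
     set_mult (free_pairs S) (tensor_kernel S T) (frag_extend (\<lambda>(x, y). frag_of (x, y \<otimes>\<^bsub>S\<^esub> s)) ` C)"

definition frag_mult :: "('s, 'm) ring_scheme \<Rightarrow> ('s \<times> 's \<Rightarrow>\<^sub>0 int) \<Rightarrow> 's" where
  "frag_mult S z =
     (\<Oplus>\<^bsub>S\<^esub>p \<in> Poly_Mapping.keys z. add_pow S (Poly_Mapping.lookup z p) (fst p \<otimes>\<^bsub>S\<^esub> snd p))"

definition tensor_mult :: "('s, 'm) ring_scheme \<Rightarrow> ('s \<times> 's \<Rightarrow>\<^sub>0 int) set \<Rightarrow> 's" where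
  "tensor_mult S C = the_elem (frag_mult S ` C)"

definition separable_over :: "('s, 'm) ring_scheme \<Rightarrow> 's set \<Rightarrow> bool" where
  "separable_over S T \<longleftrightarrow>
     (\<exists>\<delta> \<in> hom (add_monoid S) (tensor_square S T).
        (\<forall>s \<in> carrier S. \<forall>x \<in> carrier S.
           \<delta> (s \<otimes>\<^bsub>S\<^esub> x) = tensor_lact S T s (\<delta> x) \<and>
           \<delta> (x \<otimes>\<^bsub>S\<^esub> s) = tensor_ract S T (\<delta> x) s) \<and>
        (\<forall>x \<in> carrier S. tensor_mult S (\<delta> x) = x))"


section \<open>Field extensions inside a fixed algebraic closure\<close>

text \<open>
  Throughout, \<open>A\<close> is an algebraic closure of its subfield \<open>K\<close>. In particular, having only simple
  roots in \<open>A\<close> is the usual separability of a polynomial over \<open>K\<close>.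
\<close>

definition separable_extension :: "('a, 'm) ring_scheme \<Rightarrow> 'a set \<Rightarrow> 'a set \<Rightarrow> bool" where
  "separable_extension A K E \<longleftrightarrow>
     subfield K A \<and> subfield E A \<and> K \<subseteq> E \<and>
     (\<forall>x \<in> E. ring.algebraic A K x \<and>
        (\<forall>y \<in> carrier A. ring.alg_mult A (ring.Irr A K x) y \<le> 1))"

definition normal_extension :: "('a, 'm) ring_scheme \<Rightarrow> 'a set \<Rightarrow> 'a set \<Rightarrow> bool" where
  "normal_extension A K E \<longleftrightarrow>
     subfield K A \<and> subfield E A \<and> K \<subseteq> E \<and>
     (\<forall>x \<in> E. ring.algebraic A K x) \<and>
     (\<forall>p \<in> carrier (K[X]\<^bsub>A\<^esub>).
        pirreducible\<^bsub>A\<^esub> K p \<and> (\<exists>x \<in> E. ring.eval A p x = \<zero>\<^bsub>A\<^esub>) \<longrightarrow>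
        ring.splitted (A\<lparr>carrier := E\<rparr>) p)"

definition galois_extension :: "('a, 'm) ring_scheme \<Rightarrow> 'a set \<Rightarrow> 'a set \<Rightarrow> bool" where
  "galois_extension A K E \<longleftrightarrow> normal_extension A K E \<and> separable_extension A K E"

definition normal_closure :: "('a, 'm) ring_scheme \<Rightarrow> 'a set \<Rightarrow> 'a set \<Rightarrow> 'a set" where
  "normal_closure A K L = \<Inter>{E. normal_extension A K E \<and> L \<subseteq> E}"

text \<open>
  Automorphisms are made extensional, so that each one is represented by exactly one HOL function
  and finiteness of the set is finiteness of the automorphism group.
\<close>

definition field_auts :: "('a, 'm) ring_scheme \<Rightarrow> 'a set \<Rightarrow> 'a set \<Rightarrow> ('a \<Rightarrow> 'a) set" where
  "field_auts A K E =
     {g \<in> ring_iso (A\<lparr>carrier := E\<rparr>) (A\<lparr>carrier := E\<rparr>) \<inter> extensional E. \<forall>x \<in> K. g x = x}"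


section \<open>The groupoid of conjugates\<close>

text \<open>
  The index set is the set of conjugate fields itself: an index \<open>i\<close> is the field \<open>L\<^sub>i\<close>. An arrow
  carries its target and source along with the underlying map, which makes the union of the
  \<open>G\<^sub>i\<^sub>j\<close> disjoint.
\<close>

datatype 'a arrow = Arrow (tgt: "'a set") (act: "'a \<Rightarrow> 'a") (src: "'a set")

definition conjugates :: "('a, 'm) ring_scheme \<Rightarrow> 'a set \<Rightarrow> 'a set \<Rightarrow> 'a set set" where
  "conjugates A K L = (\<lambda>g. g ` L) ` field_auts A K (normal_closure A K L)"

definition arrows :: "('a, 'm) ring_scheme \<Rightarrow> 'a set \<Rightarrow> 'a set \<Rightarrow> 'a arrow set" where
  "arrows A K L =
     {Arrow i (restrict g j) j | i j g.
        i \<in> conjugates A K L \<and> j \<in> conjugates A K L \<and>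
        g \<in> field_auts A K (normal_closure A K L) \<and> g ` j = i}"

definition id_arrow :: "'a set \<Rightarrow> 'a arrow" where
  "id_arrow i = Arrow i (restrict id i) i"

definition arrow_comp :: "'a arrow \<Rightarrow> 'a arrow \<Rightarrow> 'a arrow" where
  "arrow_comp \<sigma> \<tau> = Arrow (tgt \<sigma>) (compose (src \<tau>) (act \<sigma>) (act \<tau>)) (src \<tau>)"

definition composable :: "('a, 'm) ring_scheme \<Rightarrow> 'a set \<Rightarrow> 'a set \<Rightarrow> ('a arrow \<times> 'a arrow) set" where
  "composable A K L =
     {(\<sigma>, \<tau>). \<sigma> \<in> arrows A K L \<and> \<tau> \<in> arrows A K L \<and> src \<sigma> = tgt \<tau>}"


section \<open>Object crossed products\<close>

definition crossed_cocycle ::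
  "('a, 'm) ring_scheme \<Rightarrow> 'a set \<Rightarrow> 'a set \<Rightarrow> ('a arrow \<Rightarrow> 'a arrow \<Rightarrow> 'a) \<Rightarrow> bool" where
  "crossed_cocycle A K L \<beta> \<longleftrightarrow>
     (\<forall>(\<sigma>, \<tau>) \<in> composable A K L. \<beta> \<sigma> \<tau> \<in> tgt \<sigma> - {\<zero>\<^bsub>A\<^esub>}) \<and>
     (\<forall>\<sigma> \<in> arrows A K L.
        \<beta> \<sigma> (id_arrow (src \<sigma>)) = \<one>\<^bsub>A\<^esub> \<and> \<beta> (id_arrow (tgt \<sigma>)) \<sigma> = \<one>\<^bsub>A\<^esub>) \<and>
     (\<forall>\<sigma> \<tau> \<rho>. (\<sigma>, \<tau>) \<in> composable A K L \<and> (\<tau>, \<rho>) \<in> composable A K L \<longrightarrow>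
        \<beta> \<sigma> \<tau> \<otimes>\<^bsub>A\<^esub> \<beta> (arrow_comp \<sigma> \<tau>) \<rho> =
        act \<sigma> (\<beta> \<tau> \<rho>) \<otimes>\<^bsub>A\<^esub> \<beta> \<sigma> (arrow_comp \<tau> \<rho>))"

text \<open>
  A formal sum is the function sending \<open>\<sigma>\<close> to its coefficient at \<open>u\<^sub>\<sigma>\<close>. The \<open>one\<close> field is the sum
  of all \<open>u\<^sub>e\<close> over identity arrows \<open>e\<close>; it is an element of the ring, and then its identity,
  exactly when \<open>L\<close> has finitely many conjugates.
\<close>

definition crossed_product ::
  "('a, 'm) ring_scheme \<Rightarrow> 'a set \<Rightarrow> 'a set \<Rightarrow> ('a arrow \<Rightarrow> 'a arrow \<Rightarrow> 'a) \<Rightarrow> ('a arrow \<Rightarrow> 'a) ring"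
  where
  "crossed_product A K L \<beta> =
     \<lparr>carrier = {a. (\<forall>\<sigma> \<in> arrows A K L. a \<sigma> \<in> tgt \<sigma>) \<and>
                    (\<forall>\<sigma>. \<sigma> \<notin> arrows A K L \<longrightarrow> a \<sigma> = \<zero>\<^bsub>A\<^esub>) \<and>
                    finite {\<sigma>. a \<sigma> \<noteq> \<zero>\<^bsub>A\<^esub>}},
      monoid.mult = (\<lambda>a b \<rho>. finsum A (\<lambda>(\<sigma>, \<tau>). a \<sigma> \<otimes>\<^bsub>A\<^esub> act \<sigma> (b \<tau>) \<otimes>\<^bsub>A\<^esub> \<beta> \<sigma> \<tau>)
                {(\<sigma>, \<tau>) \<in> composable A K L.
                   a \<sigma> \<noteq> \<zero>\<^bsub>A\<^esub> \<and> b \<tau> \<noteq> \<zero>\<^bsub>A\<^esub> \<and> arrow_comp \<sigma> \<tau> = \<rho>}),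
      one = (\<lambda>\<sigma>. if \<sigma> \<in> id_arrow ` conjugates A K L then \<one>\<^bsub>A\<^esub> else \<zero>\<^bsub>A\<^esub>),
      ring.zero = (\<lambda>_. \<zero>\<^bsub>A\<^esub>),
      add = (\<lambda>a b \<sigma>. a \<sigma> \<oplus>\<^bsub>A\<^esub> b \<sigma>)\<rparr>"

definition crossed_product_0 ::
  "('a, 'm) ring_scheme \<Rightarrow> 'a set \<Rightarrow> 'a set \<Rightarrow> ('a arrow \<Rightarrow> 'a arrow \<Rightarrow> 'a) \<Rightarrow> ('a arrow \<Rightarrow> 'a) set"
  where
  "crossed_product_0 A K L \<beta> =
     {a \<in> carrier (crossed_product A K L \<beta>).
        \<forall>\<sigma>. a \<sigma> \<noteq> \<zero>\<^bsub>A\<^esub> \<longrightarrow> \<sigma> \<in> id_arrow ` conjugates A K L}"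

text \<open>The element \<open>x u\<^sub>\<sigma>\<close>.\<close>

definition crossed_monom :: "('a, 'm) ring_scheme \<Rightarrow> 'a \<Rightarrow> 'a arrow \<Rightarrow> 'a arrow \<Rightarrow> 'a" where
  "crossed_monom A x \<sigma> = (\<lambda>\<tau>. if \<tau> = \<sigma> then x else \<zero>\<^bsub>A\<^esub>)"

end

theory Submission
  imports Defs
begin

text \<open>
  If \<open>R\<close> is separable over \<open>R\<^sub>0\<close>, let \<open>z\<close> be the image of the idempotent \<open>u\<close> of the object \<open>L\<close>
  under a bimodule section. The tensor square of \<open>R\<close> over \<open>R\<^sub>0\<close> has one coordinate for each
  composable pair of arrows, and since \<open>z\<close> multiplies to \<open>u\<close>, its coordinate at some pair
  \<open>(s, s\<^sup>-\<^sup>1)\<close> is nonzero. As \<open>z\<close> commutes with \<open>u\<^sub>r\<close> for every loop \<open>r\<close> at \<open>L\<close>, the coordinate at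
  \<open>(rs, (rs)\<^sup>-\<^sup>1)\<close> is nonzero as well; but \<open>z\<close> has finite support, so there are finitely many \<open>r\<close>.
  Loops at \<open>L\<close> are the automorphisms of \<open>L\<close> over \<open>K\<close>, because these extend to the algebraic closure.

  Conversely, if \<open>L\<close> has finitely many automorphisms over \<open>K\<close>, some \<open>b\<close> in \<open>L\<close> has trace one over
  the fixed field. The elements \<open>c\<^sub>i = \<Sum> s(b) u\<^sub>s \<otimes> u\<^sub>s\<^sup>-\<^sup>1\<close>, summed over the arrows \<open>s\<close> from \<open>L\<close> to
  \<open>i\<close>, satisfy \<open>x c\<^sub>j = c\<^sub>i x\<close> for \<open>x\<close> homogeneous from \<open>j\<close> to \<open>i\<close> and multiply to the idempotent of
  the object \<open>i\<close>. They define the section \<open>x \<mapsto> \<Sum>\<^sub>i c\<^sub>i x\<close>.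
\<close>

section \<open>Tensor squares of non-unital rings\<close>

text \<open>When \<open>L\<close> has infinitely many conjugates, \<open>R\<close> has no identity,
  even if \<open>L\<close> has few automorphisms. No single separability element is then available.
  The idempotents of the objects act as local identities, so the argument works object by object,
  and the sum of all \<open>c_i x\<close> is cut down to the finitely many targets of arrows in the
  support of \<open>x\<close>; the omitted terms vanish in the tensor square.

  The coordinate of a tensor \<open>a \<otimes> b\<close> at \<open>(s, t)\<close> is
  \<open>a_s s(b_t)\<close>, taken in \<open>A\<close>. The twist by \<open>s\<close> makes it
  balanced over \<open>R0\<close>: an element of \<open>R0\<close> between the factors contributes
  its entry at the object joining \<open>s\<close> and \<open>t\<close>, acted on by
  \<open>s\<close>, from either side.

  All arrows in \<open>c_i\<close> start at \<open>L\<close>, so a single \<open>b\<close> serves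
  every object. Trace one is reached without dividing by the number of automorphisms, which may be
  zero in \<open>A\<close>: a product formula writes the indicator function of the identity
  automorphism as a combination of functions \<open>h \<mapsto> y h(x)\<close>. The same combination
  yields finite degree in the Galois case.\<close>

locale nonunital_ring = abelian_group S for S (structure) +
  assumes mult_closed [simp, intro]: "\<lbrakk>x \<in> carrier S; y \<in> carrier S\<rbrakk> \<Longrightarrow> x \<otimes> y \<in> carrier S"
    and mult_assoc: "\<lbrakk>x \<in> carrier S; y \<in> carrier S; z \<in> carrier S\<rbrakk> \<Longrightarrow> (x \<otimes> y) \<otimes> z = x \<otimes> (y \<otimes> z)"
    and distr_left: "\<lbrakk>x \<in> carrier S; y \<in> carrier S; z \<in> carrier S\<rbrakk> \<Longrightarrow> (x \<oplus> y) \<otimes> z = x \<otimes> z \<oplus> y \<otimes> z"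
    and distr_right: "\<lbrakk>x \<in> carrier S; y \<in> carrier S; z \<in> carrier S\<rbrakk> \<Longrightarrow> z \<otimes> (x \<oplus> y) = z \<otimes> x \<oplus> z \<otimes> y"

lemma keys_diff_subset:
  "\<lbrakk>Poly_Mapping.keys a \<subseteq> C; Poly_Mapping.keys b \<subseteq> C\<rbrakk> \<Longrightarrow> Poly_Mapping.keys (a - b) \<subseteq> C"
  using keys_diff[of a b] by blast

text \<open>The hypothesis on \<open>Y\<close> lets the group inverse of a generator be read as
  \<open>-\<close>, so that later calculations use the additive structure of the ambient
  type.\<close>

lemma generate_free_Abelian_group_induct:
  assumes "z \<in> generate (free_Abelian_group B) Y" and "Y \<subseteq> carrier (free_Abelian_group B)"
    and "P 0" and "\<And>x. x \<in> Y \<Longrightarrow> P x" and "\<And>x. x \<in> Y \<Longrightarrow> P (- x)"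
    and "\<And>x y. \<lbrakk>P x; P y\<rbrakk> \<Longrightarrow> P (x + y)"
  shows "P z"
  using assms(1)
proof induction
  case (inv h)
  then show ?case using assms(2,5) by (auto simp: subset_iff)
qed (use assms in auto)

locale nonunital_ring_over = nonunital_ring +
  fixes T
  assumes T: "T \<subseteq> carrier S"
begin

section \<open>Congruence modulo the tensor kernel\<close>

abbreviation "supported z \<equiv> Poly_Mapping.keys z \<subseteq> carrier S \<times> carrier S"

lemma tensor_relators_closed: "tensor_relators S T \<subseteq> carrier (free_pairs S)"
  unfolding tensor_relators_def
  by (intro subsetI; elim UnE CollectE exE conjE; clarify;
      simp only: carrier_free_Abelian_group_iff; intro keys_diff_subset; simp add: subsetD[OF T])

lemma tensor_kernel_subgroup: "subgroup (tensor_kernel S T) (free_pairs S)"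
  unfolding tensor_kernel_def
  by (intro group.generate_is_subgroup tensor_relators_closed) simp

lemma tensor_kernel_zero [simp, intro]: "0 \<in> tensor_kernel S T"
  using subgroup.one_closed[OF tensor_kernel_subgroup] by simp

lemma tensor_kernel_keys: "z \<in> tensor_kernel S T \<Longrightarrow> supported z"
  using subgroup.mem_carrier[OF tensor_kernel_subgroup] by fastforce

lemma tensor_kernel_add [intro]:
  "\<lbrakk>z \<in> tensor_kernel S T; w \<in> tensor_kernel S T\<rbrakk> \<Longrightarrow> z + w \<in> tensor_kernel S T"
  using subgroup.m_closed[OF tensor_kernel_subgroup, of z w] by simp

lemma tensor_kernel_uminus [intro]: "z \<in> tensor_kernel S T \<Longrightarrow> - z \<in> tensor_kernel S T"
  using subgroup.m_inv_closed[OF tensor_kernel_subgroup, of z] tensor_kernel_keys[of z] by simp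

lemma tensor_kernel_diff [intro]:
  "\<lbrakk>z \<in> tensor_kernel S T; w \<in> tensor_kernel S T\<rbrakk> \<Longrightarrow> z - w \<in> tensor_kernel S T"
  using tensor_kernel_add[of z "- w"] tensor_kernel_uminus[of w] by simp

lemma tensor_kernel_sum [intro]:
  "(\<And>i. i \<in> I \<Longrightarrow> f i \<in> tensor_kernel S T) \<Longrightarrow> sum f I \<in> tensor_kernel S T"
  by (induction I rule: infinite_finite_induct) auto

lemma tensor_kernel_trans:
  "\<lbrakk>z - w \<in> tensor_kernel S T; w - v \<in> tensor_kernel S T\<rbrakk> \<Longrightarrow> z - v \<in> tensor_kernel S T"
  using tensor_kernel_add[of "z - w" "w - v"] by simp

lemma tensor_kernel_sym: "z - w \<in> tensor_kernel S T \<Longrightarrow> w - z \<in> tensor_kernel S T"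
  using tensor_kernel_uminus[of "z - w"] by simp

text \<open>The summation step in an additive induction showing that two maps agree modulo the
  kernel: \<open>x\<close> and \<open>y\<close> are their values at a sum, each known only up to the
  kernel.\<close>

lemma tensor_kernel_combine:
  assumes "x - (a + b) \<in> tensor_kernel S T" "y - (c + d) \<in> tensor_kernel S T"
    and "a - c \<in> tensor_kernel S T" "b - d \<in> tensor_kernel S T"
  shows "x - y \<in> tensor_kernel S T"
proof -
  have "x - y = (x - (a + b)) - (y - (c + d)) + ((a - c) + (b - d))" by simp
  then show ?thesis
    using tensor_kernel_add[OF tensor_kernel_diff[OF assms(1,2)] tensor_kernel_add[OF assms(3,4)]] by metis
qed

lemma tensor_relator_kernel: "r \<in> tensor_relators S T \<Longrightarrow> r \<in> tensor_kernel S T"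
  unfolding tensor_kernel_def by (rule generate.incl)

lemma tensor_add_left:
  "\<lbrakk>x \<in> carrier S; x' \<in> carrier S; y \<in> carrier S\<rbrakk> \<Longrightarrow>
   frag_of (x \<oplus> x', y) - frag_of (x, y) - frag_of (x', y) \<in> tensor_kernel S T"
  by (rule tensor_relator_kernel) (auto simp: tensor_relators_def)

lemma tensor_add_right:
  "\<lbrakk>x \<in> carrier S; y \<in> carrier S; y' \<in> carrier S\<rbrakk> \<Longrightarrow>
   frag_of (x, y \<oplus> y') - frag_of (x, y) - frag_of (x, y') \<in> tensor_kernel S T"
  by (rule tensor_relator_kernel) (auto simp: tensor_relators_def)

lemma tensor_balanced:
  "\<lbrakk>x \<in> carrier S; t \<in> T; y \<in> carrier S\<rbrakk> \<Longrightarrow>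
   frag_of (x \<otimes> t, y) - frag_of (x, t \<otimes> y) \<in> tensor_kernel S T"
  by (rule tensor_relator_kernel) (auto simp: tensor_relators_def)

lemma tensor_zero_left: "y \<in> carrier S \<Longrightarrow> frag_of (\<zero>, y) \<in> tensor_kernel S T"
  using tensor_kernel_uminus[OF tensor_add_left[of \<zero> \<zero> y]] by simp

lemma tensor_zero_right: "x \<in> carrier S \<Longrightarrow> frag_of (x, \<zero>) \<in> tensor_kernel S T"
  using tensor_kernel_uminus[OF tensor_add_right[of x \<zero> \<zero>]] by simp

lemma tensor_kernel_induct [consumes 1, case_names zero add uminus left right bal]:
  assumes "z \<in> tensor_kernel S T" and "P 0"
    and "\<And>x y. \<lbrakk>P x; P y\<rbrakk> \<Longrightarrow> P (x + y)" and "\<And>x. P x \<Longrightarrow> P (- x)"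
    and "\<And>x x' y. \<lbrakk>x \<in> carrier S; x' \<in> carrier S; y \<in> carrier S\<rbrakk> \<Longrightarrow>
           P (frag_of (x \<oplus> x', y) - frag_of (x, y) - frag_of (x', y))"
    and "\<And>x y y'. \<lbrakk>x \<in> carrier S; y \<in> carrier S; y' \<in> carrier S\<rbrakk> \<Longrightarrow>
           P (frag_of (x, y \<oplus> y') - frag_of (x, y) - frag_of (x, y'))"
    and "\<And>x t y. \<lbrakk>x \<in> carrier S; t \<in> T; y \<in> carrier S\<rbrakk> \<Longrightarrow>
           P (frag_of (x \<otimes> t, y) - frag_of (x, t \<otimes> y))"
  shows "P z"
proof -
  have P: "P x" if "x \<in> tensor_relators S T" for x
    using that unfolding tensor_relators_def
    by (elim UnE CollectE exE conjE; clarify; intro assms(5-7))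
  show ?thesis
    using assms(1) unfolding tensor_kernel_def
    by (rule generate_free_Abelian_group_induct[OF _ tensor_relators_closed])
      (fact assms(2) | erule P | erule (1) assms(3) | rule assms(4), erule P)+
qed

text \<open>The well-definedness half of the universal property of the tensor product, with an
  arbitrary abelian group as target. It serves both the multiplication map and the coordinate
  functions on the crossed product.\<close>

lemma hom_tensor_kernel:
  fixes H
  assumes H: "abelian_group H" and h: "h \<in> hom (free_pairs S) (add_monoid H)"
    and left: "\<And>x x' y. \<lbrakk>x \<in> carrier S; x' \<in> carrier S; y \<in> carrier S\<rbrakk> \<Longrightarrow>
      h (frag_of (x \<oplus>\<^bsub>S\<^esub> x', y)) = h (frag_of (x, y)) \<oplus>\<^bsub>H\<^esub> h (frag_of (x', y))"
    and right: "\<And>x y y'. \<lbrakk>x \<in> carrier S; y \<in> carrier S; y' \<in> carrier S\<rbrakk> \<Longrightarrow>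
      h (frag_of (x, y \<oplus>\<^bsub>S\<^esub> y')) = h (frag_of (x, y)) \<oplus>\<^bsub>H\<^esub> h (frag_of (x, y'))"
    and bal: "\<And>x t y. \<lbrakk>x \<in> carrier S; t \<in> T; y \<in> carrier S\<rbrakk> \<Longrightarrow>
      h (frag_of (x \<otimes>\<^bsub>S\<^esub> t, y)) = h (frag_of (x, t \<otimes>\<^bsub>S\<^esub> y))"
    and z: "z \<in> tensor_kernel S T"
  shows "h z = \<zero>\<^bsub>H\<^esub>"
proof -
  interpret H: abelian_group H by (rule H)
  interpret h: group_hom "free_pairs S" "add_monoid H" h
    using h H.a_group by (simp add: group_hom_def group_hom_axioms_def)
  have closed: "h w \<in> carrier H" if "supported w" for w
    using h.hom_closed[of w] that by simp
  have sum: "h (v + w) = h v \<oplus>\<^bsub>H\<^esub> h w" if "supported v"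
    "supported w" for v w
    using h.hom_mult[of v w] that by simp
  have minus: "h (- w) = \<ominus>\<^bsub>H\<^esub> h w" if "supported w" for w
    using h.hom_inv[of w] that by (simp add: a_inv_def)
  have diff: "h (v - w) = h v \<ominus>\<^bsub>H\<^esub> h w" if "supported v"
    "supported w" for v w
    using sum[of v "- w"] minus[of w] that by (simp add: a_minus_def)
  have aux: "a \<oplus>\<^bsub>H\<^esub> b \<ominus>\<^bsub>H\<^esub> a \<ominus>\<^bsub>H\<^esub> b = \<zero>\<^bsub>H\<^esub>"
    if "a \<in> carrier H" "b \<in> carrier H" for a b
  proof -
    have "a \<oplus>\<^bsub>H\<^esub> b \<oplus>\<^bsub>H\<^esub> \<ominus>\<^bsub>H\<^esub> a = b"
      using that H.a_comm[of a b] H.a_assoc[of b a "\<ominus>\<^bsub>H\<^esub> a"] H.r_neg by simp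
    then show ?thesis using that by (simp add: a_minus_def H.r_neg)
  qed
  have T': "t \<in> carrier S" if "t \<in> T" for t using T that by auto
  \<comment> \<open>The support is carried through the induction because \<open>h\<close> is
    additive only on the carrier.\<close>
  have "supported z \<and> h z = \<zero>\<^bsub>H\<^esub>"
    using z
  proof (induction rule: tensor_kernel_induct)
    case (add x y)
    then have k: "supported x" "supported y"
      and h0: "h x = \<zero>\<^bsub>H\<^esub>" "h y = \<zero>\<^bsub>H\<^esub>"
      by - (erule conjunct1 conjunct2)+
    have "supported (x + y)"
      by (rule order.trans[OF keys_add Un_least[OF k]])
    moreover have "h (x + y) = \<zero>\<^bsub>H\<^esub>"
      unfolding sum[OF k] h0 by (rule H.r_zero[OF H.zero_closed])
    ultimately show ?case ..
  next
    case zero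
    then show ?case using h.hom_one by simp
  next
    case (uminus x)
    then show ?case by (simp add: minus)
  next
    case (left x x' y)
    have "h (frag_of (x, y)) \<in> carrier H" "h (frag_of (x', y)) \<in> carrier H"
      by (rule closed; use left in simp)+
    then show ?case
      using left by (simp add: diff keys_diff_subset assms(3) aux)
  next
    case (right x y y')
    have "h (frag_of (x, y)) \<in> carrier H" "h (frag_of (x, y')) \<in> carrier H"
      by (rule closed; use right in simp)+
    then show ?case
      using right by (simp add: diff keys_diff_subset assms(4) aux)
  next
    case (bal x t y)
    have "h (frag_of (x, t \<otimes>\<^bsub>S\<^esub> y)) \<in> carrier H" 
      by (rule closed; use bal T' in simp)
    then show ?case
      using bal T' by (simp add: diff keys_diff_subset assms(5) a_minus_def H.r_neg)
  qed
  then show ?thesis ..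
qed

section \<open>The two actions on representatives in the free group\<close>

abbreviation "lmap s \<equiv> frag_extend (\<lambda>(x, y). frag_of (s \<otimes> x, y))"
abbreviation "rmap s \<equiv> frag_extend (\<lambda>(x, y). frag_of (x, y \<otimes> s))"

lemmas frag_simps = frag_extend_add frag_extend_diff frag_extend_minus

lemma lmap_keys:
  assumes "s \<in> carrier S" "supported z"
  shows "supported (lmap s z)"
  by (rule order.trans[OF keys_frag_extend]) (use assms in auto)

lemma rmap_keys:
  assumes "s \<in> carrier S" "supported z"
  shows "supported (rmap s z)"
  by (rule order.trans[OF keys_frag_extend]) (use assms in auto)

lemma lmap_kernel:
  assumes s: "s \<in> carrier S" and z: "z \<in> tensor_kernel S T"
  shows "lmap s z \<in> tensor_kernel S T"
  using z
proof (induction rule: tensor_kernel_induct)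
  case (left x x' y)
  then show ?case
    using s tensor_add_left[of "s \<otimes> x" "s \<otimes> x'" y] by (simp add: frag_simps distr_right)
next
  case (right x y y')
  then show ?case
    using s tensor_add_right[of "s \<otimes> x" y y'] by (simp add: frag_simps)
next
  case (bal x t y)
  then show ?case
    using s tensor_balanced[of "s \<otimes> x" t y] T by (simp add: frag_simps mult_assoc subset_iff)
qed (auto simp: frag_simps)

lemma rmap_kernel:
  assumes s: "s \<in> carrier S" and z: "z \<in> tensor_kernel S T"
  shows "rmap s z \<in> tensor_kernel S T"
  using z
proof (induction rule: tensor_kernel_induct)
  case (left x x' y)
  then show ?case
    using s tensor_add_left[of x x' "y \<otimes> s"] by (simp add: frag_simps)
next
  case (right x y y')
  then show ?case
    using s tensor_add_right[of x "y \<otimes> s" "y' \<otimes> s"] by (simp add: frag_simps distr_left)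
next
  case (bal x t y)
  then show ?case
    using s tensor_balanced[of x t "y \<otimes> s"] T by (simp add: frag_simps mult_assoc subset_iff)
qed (auto simp: frag_simps)

lemma lmap_rmap:
  assumes "s \<in> carrier S" "r \<in> carrier S" "supported z"
  shows "lmap s (rmap r z) = rmap r (lmap s z)"
  using assms(3) by (induction z rule: frag_induction) (auto simp: frag_simps)

lemma rmap_rmap:
  assumes "s \<in> carrier S" "r \<in> carrier S" "supported z"
  shows "rmap s (rmap r z) = rmap (r \<otimes> s) z"
  using assms(3,1,2) by (induction z rule: frag_induction) (auto simp: frag_simps mult_assoc)

text \<open>On representatives the action is exactly additive in \<open>z\<close>, but in the ring
  element only up to the biadditivity relators; hence a congruence instead of an equation.\<close>

lemma rmap_add:
  assumes "s \<in> carrier S" "r \<in> carrier S" "supported z"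
  shows "rmap (s \<oplus> r) z - (rmap s z + rmap r z) \<in> tensor_kernel S T"
  using assms(3)
proof (induction z rule: frag_induction)
  case (one p)
  then show ?case
    using assms tensor_add_right[of "fst p" "snd p \<otimes> s" "snd p \<otimes> r"]
    by (auto simp: distr_right algebra_simps)
next
  case (diff a b)
  then show ?case
    using tensor_kernel_diff[OF diff] by (simp add: frag_simps algebra_simps)
qed auto

lemma lmap_add:
  assumes "s \<in> carrier S" "r \<in> carrier S" "supported z"
  shows "lmap (s \<oplus> r) z - (lmap s z + lmap r z) \<in> tensor_kernel S T"
  using assms(3)
proof (induction z rule: frag_induction)
  case (one p)
  then show ?case
    using assms tensor_add_left[of "s \<otimes> fst p" "r \<otimes> fst p" "snd p"]
    by (auto simp: distr_left algebra_simps)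
next
  case (diff a b)
  then show ?case
    using tensor_kernel_diff[OF diff] by (simp add: frag_simps algebra_simps)
qed auto

section \<open>The multiplication map on representatives\<close>

text \<open>Any finite set containing the keys may index the sum, so the values at \<open>z\<close>,
  \<open>w\<close> and \<open>z + w\<close> can be compared over one set.\<close>

lemma frag_mult_eq_finsum:
  assumes "Poly_Mapping.keys z \<subseteq> F" "finite F" "F \<subseteq> carrier S \<times> carrier S"
  shows "frag_mult S z = (\<Oplus>p\<in>F. [Poly_Mapping.lookup z p] \<cdot> (fst p \<otimes> snd p))"
  unfolding frag_mult_def
proof (rule add.finprod_mono_neutral_cong_left)
  show "[Poly_Mapping.lookup z i] \<cdot> (fst i \<otimes> snd i) = \<zero>" if "i \<in> F - Poly_Mapping.keys z" for i
    using that by (simp add: in_keys_iff add_pow_def int_pow_def nat_pow_def)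
qed (use assms in \<open>auto simp: subset_iff add.int_pow_closed\<close>)

lemma frag_mult_hom: "frag_mult S \<in> hom (free_pairs S) (add_monoid S)"
proof (rule homI)
  fix z w assume zw: "z \<in> carrier (free_pairs S)" "w \<in> carrier (free_pairs S)"
  let ?F = "Poly_Mapping.keys z \<union> Poly_Mapping.keys w"
  have F: "finite ?F" "?F \<subseteq> carrier S \<times> carrier S" "Poly_Mapping.keys (z + w) \<subseteq> ?F"
    using zw keys_add[of z w] by auto
  have cl: "fst p \<otimes> snd p \<in> carrier S" if "p \<in> ?F" for p
    using that F(2) by auto
  have "frag_mult S (z + w) =
      (\<Oplus>p\<in>?F. [Poly_Mapping.lookup z p] \<cdot> (fst p \<otimes> snd p) \<oplus> [Poly_Mapping.lookup w p] \<cdot> (fst p \<otimes> snd p))"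
    unfolding frag_mult_eq_finsum[OF F(3,1,2)]
    by (rule finsum_cong') (auto simp: lookup_add add.int_pow_mult cl add.int_pow_closed)
  also have "\<dots> = frag_mult S z \<oplus> frag_mult S w"
    using F frag_mult_eq_finsum[of z ?F] frag_mult_eq_finsum[of w ?F]
    by (subst finsum_addf) (auto simp: cl add.int_pow_closed)
  finally show "frag_mult S (z \<otimes>\<^bsub>free_pairs S\<^esub> w) = frag_mult S z \<otimes>\<^bsub>add_monoid S\<^esub> frag_mult S w"
    by simp
next
  fix z assume "z \<in> carrier (free_pairs S)"
  then show "frag_mult S z \<in> carrier (add_monoid S)"
    unfolding frag_mult_def by (auto intro!: finsum_closed add.int_pow_closed)
qed

lemma frag_mult_add:
  assumes "supported z" "supported w"
  shows "frag_mult S (z + w) = frag_mult S z \<oplus> frag_mult S w"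
  using hom_mult[OF frag_mult_hom, of z w] assms by simp

lemma frag_mult_closed [simp, intro]:
  "supported z \<Longrightarrow> frag_mult S z \<in> carrier S"
  using hom_in_carrier[OF frag_mult_hom, of z] by simp

lemma frag_mult_zero [simp]: "frag_mult S 0 = \<zero>"
  by (simp add: frag_mult_def)

lemma frag_mult_uminus:
  assumes "supported z"
  shows "frag_mult S (- z) = \<ominus> frag_mult S z"
proof -
  have m: "supported (- z)" using assms by simp
  have "frag_mult S (- z) \<oplus> frag_mult S z = \<zero>"
    using frag_mult_add[OF m assms] by simp
  then show ?thesis
    using minus_equality[OF _ frag_mult_closed[OF assms] frag_mult_closed[OF m]] by simp
qed

lemma frag_mult_of [simp]:
  "\<lbrakk>x \<in> carrier S; y \<in> carrier S\<rbrakk> \<Longrightarrow> frag_mult S (frag_of (x, y)) = x \<otimes> y"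
  by (simp add: frag_mult_def add_pow_def int_pow_def nat_pow_def)

lemma frag_mult_sum:
  assumes "finite I" "\<And>i. i \<in> I \<Longrightarrow> supported (f i)"
  shows "frag_mult S (sum f I) = (\<Oplus>i\<in>I. frag_mult S (f i))"
  using assms
proof (induction rule: finite_induct)
  case (insert i I)
  have "supported (sum f I)"
    using sum_closed_free_Abelian_group[of I f "carrier S \<times> carrier S"] insert.prems by simp
  with insert show ?case by (simp add: frag_mult_add Pi_iff)
qed simp

lemma frag_mult_rmap:
  assumes "s \<in> carrier S" "supported z"
  shows "frag_mult S (rmap s z) = frag_mult S z \<otimes> s"
proof -
  \<comment> \<open>Annihilation by zero and the sign rule come from distributivity and additive
    cancellation alone.\<close>
  have zero: "\<zero> \<otimes> s = \<zero>"
    using distr_left[of \<zero> \<zero> s] assms(1) add.r_cancel_one' [of "\<zero> \<otimes> s" "\<zero> \<otimes> s"] by simp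
  have neg: "\<ominus> x \<otimes> s = \<ominus> (x \<otimes> s)" if "x \<in> carrier S" for x
    using distr_left[of x "\<ominus> x" s] assms(1) that zero
    by (metis a_inv_closed mult_closed minus_equality minus_minus r_neg)
  have "supported z \<and> frag_mult S (rmap s z) = frag_mult S z \<otimes> s"
    using assms(2)
  proof (induction z rule: frag_induction)
    case (diff a b)
    then have k: "supported a" "supported b"
      by auto
    have "frag_mult S (rmap s (a - b)) = frag_mult S (rmap s a) \<oplus> \<ominus> frag_mult S (rmap s b)"
      using frag_mult_add[of "rmap s a" "- rmap s b"] rmap_keys[OF assms(1)] k
      by (simp add: frag_simps frag_mult_uminus)
    moreover have "frag_mult S (a - b) = frag_mult S a \<oplus> \<ominus> frag_mult S b"
      using frag_mult_add[of a "- b"] k by (simp add: frag_mult_uminus)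
    ultimately show ?case
      using diff k assms(1) by (simp add: distr_left neg keys_diff_subset)
  qed (use assms zero in \<open>auto simp: mult_assoc\<close>)
  then show ?thesis ..
qed

lemma frag_mult_kernel:
  assumes "z \<in> tensor_kernel S T"
  shows "frag_mult S z = \<zero>"
proof (rule hom_tensor_kernel[OF abelian_group_axioms frag_mult_hom _ _ _ assms])
qed (use T in \<open>auto simp: distr_left distr_right mult_assoc subset_iff\<close>)

section \<open>Passage to cosets\<close>

text \<open>A right coset of the kernel, phrased as a congruence class: equality of cosets becomes
  membership of a difference in the kernel, with no side conditions on carriers.\<close>

definition tensor_class :: "('a \<times> 'a \<Rightarrow>\<^sub>0 int) \<Rightarrow> ('a \<times> 'a \<Rightarrow>\<^sub>0 int) set" where
  "tensor_class z = {w. w - z \<in> tensor_kernel S T}"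

lemma tensor_class_eq_iff: "tensor_class z = tensor_class w \<longleftrightarrow> z - w \<in> tensor_kernel S T"
proof
  assume eq: "tensor_class z = tensor_class w"
  have "z \<in> tensor_class z" by (simp add: tensor_class_def)
  then have "z \<in> tensor_class w" unfolding eq .
  then show "z - w \<in> tensor_kernel S T" by (simp add: tensor_class_def)
next
  assume zw: "z - w \<in> tensor_kernel S T"
  show "tensor_class z = tensor_class w"
    unfolding tensor_class_def
    by (rule Collect_cong, rule iffI)
      (erule tensor_kernel_trans[OF _ zw] tensor_kernel_trans[OF _ tensor_kernel_sym[OF zw]])+
qed

lemma r_coset_eq_tensor_class: "r_coset (free_pairs S) (tensor_kernel S T) z = tensor_class z"
proof -
  have "w = (w - z) + z" for w by simp
  then show ?thesis unfolding r_coset_def tensor_class_def by fastforce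
qed

lemma carrier_tensor_square:
  "carrier (tensor_square S T) = tensor_class ` {z. supported z}"
  unfolding tensor_square_def carrier_FactGroup r_coset_eq_tensor_class by auto

lemma set_mult_tensor_class:
  "set_mult (free_pairs S) (tensor_class z) (tensor_class w) = tensor_class (z + w)"
proof -
  have "\<exists>a b. a - z \<in> tensor_kernel S T \<and> b - w \<in> tensor_kernel S T \<and> v = a + b"
    if "v - (z + w) \<in> tensor_kernel S T" for v
    by (rule exI[of _ "v - w"], rule exI[of _ w]) (use that in \<open>simp add: algebra_simps\<close>)
  moreover have "a + b - (z + w) \<in> tensor_kernel S T"
    if "a - z \<in> tensor_kernel S T" "b - w \<in> tensor_kernel S T" for a b
    using tensor_kernel_add[OF that] by (simp add: algebra_simps)
  ultimately show ?thesis
    unfolding set_mult_def tensor_class_def by auto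
qed

lemma mult_tensor_square:
  "tensor_class z \<otimes>\<^bsub>tensor_square S T\<^esub> tensor_class w = tensor_class (z + w)"
  unfolding tensor_square_def by (simp add: set_mult_tensor_class)

text \<open>A map preserving the kernel sends a coset into a coset, but its image need not be all of
  it; adding the kernel fills it up. This covers both actions at once.\<close>

lemma set_mult_kernel_image:
  assumes "\<And>v. v \<in> tensor_kernel S T \<Longrightarrow> frag_extend f v \<in> tensor_kernel S T"
  shows "set_mult (free_pairs S) (tensor_kernel S T) (frag_extend f ` tensor_class z) =
    tensor_class (frag_extend f z)"
proof -
  have "h + frag_extend f w - frag_extend f z \<in> tensor_kernel S T"
    if "h \<in> tensor_kernel S T" "w - z \<in> tensor_kernel S T" for h w
    using tensor_kernel_add[OF that(1) assms[OF that(2)]] by (simp add: frag_simps algebra_simps)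
  moreover have "\<exists>h\<in>tensor_kernel S T. \<exists>w. w - z \<in> tensor_kernel S T \<and> v = h + frag_extend f w"
    if "v - frag_extend f z \<in> tensor_kernel S T" for v
    by (rule bexI[of _ "v - frag_extend f z"], rule exI[of _ z]) (use that in simp_all)
  ultimately show ?thesis
    unfolding set_mult_def tensor_class_def by auto
qed

lemma tensor_lact_class:
  "s \<in> carrier S \<Longrightarrow> tensor_lact S T s (tensor_class z) = tensor_class (lmap s z)"
  unfolding tensor_lact_def by (intro set_mult_kernel_image lmap_kernel)

lemma tensor_ract_class:
  "s \<in> carrier S \<Longrightarrow> tensor_ract S T (tensor_class z) s = tensor_class (rmap s z)"
  unfolding tensor_ract_def by (intro set_mult_kernel_image rmap_kernel)

text \<open>Constancy of \<open>frag_mult\<close> on a coset is what gives \<open>the_elem\<close> a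
  meaning here.\<close>

lemma tensor_mult_class:
  assumes "supported z"
  shows "tensor_mult S (tensor_class z) = frag_mult S z"
proof -
  have "frag_mult S w = frag_mult S z" if "w - z \<in> tensor_kernel S T" for w
  proof -
    have "frag_mult S w = frag_mult S (w - z + z)" by simp
    also have "\<dots> = frag_mult S z"
      unfolding frag_mult_add[OF tensor_kernel_keys[OF that] assms] frag_mult_kernel[OF that]
      by (rule l_zero[OF frag_mult_closed[OF assms]])
    finally show ?thesis .
  qed
  then have "frag_mult S ` tensor_class z \<subseteq> {frag_mult S z}"
    unfolding tensor_class_def by blast
  moreover have "z \<in> tensor_class z" by (simp add: tensor_class_def)
  ultimately have "frag_mult S ` tensor_class z = {frag_mult S z}"
    by blast
  then show ?thesis unfolding tensor_mult_def by simp
qed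

text \<open>Reduces a coset-valued section to a choice of representatives, so that the construction
  of the section never has to leave the free group.\<close>

lemma separable_overI:
  assumes keys: "\<And>x. x \<in> carrier S \<Longrightarrow> supported (d x)"
    and add: "\<And>x y. \<lbrakk>x \<in> carrier S; y \<in> carrier S\<rbrakk> \<Longrightarrow> d (x \<oplus> y) - (d x + d y) \<in> tensor_kernel S T"
    and left: "\<And>s x. \<lbrakk>s \<in> carrier S; x \<in> carrier S\<rbrakk> \<Longrightarrow> d (s \<otimes> x) - lmap s (d x) \<in> tensor_kernel S T"
    and right: "\<And>s x. \<lbrakk>s \<in> carrier S; x \<in> carrier S\<rbrakk> \<Longrightarrow> d (x \<otimes> s) - rmap s (d x) \<in> tensor_kernel S T"
    and mult: "\<And>x. x \<in> carrier S \<Longrightarrow> frag_mult S (d x) = x"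
  shows "separable_over S T"
  unfolding separable_over_def
proof (intro bexI conjI ballI)
  show "(\<lambda>x. tensor_class (d x)) \<in> hom (add_monoid S) (tensor_square S T)"
    by (rule homI)
      (simp_all add: carrier_tensor_square imageI keys mult_tensor_square tensor_class_eq_iff add)
qed (auto simp: tensor_lact_class tensor_ract_class tensor_class_eq_iff left right tensor_mult_class keys mult)

text \<open>For \<open>s\<close> commuting with \<open>e\<close>, bilinearity gives \<open>s
  \<delta>(e) = \<delta>(s e) = \<delta>(e s) = \<delta>(e) s\<close>. With \<open>e\<close> a local
  idempotent, \<open>z\<close> takes over the role of the separability element of a unital
  ring.\<close>

lemma separable_overE:
  assumes "separable_over S T" and e: "e \<in> carrier S"
  obtains z where "supported z" "frag_mult S z = e"
    "\<And>s. \<lbrakk>s \<in> carrier S; s \<otimes> e = e \<otimes> s\<rbrakk> \<Longrightarrow> lmap s z - rmap s z \<in> tensor_kernel S T"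
proof -
  obtain \<delta> where \<delta>: "\<delta> \<in> hom (add_monoid S) (tensor_square S T)"
    and act: "\<And>s x. \<lbrakk>s \<in> carrier S; x \<in> carrier S\<rbrakk> \<Longrightarrow>
      \<delta> (s \<otimes> x) = tensor_lact S T s (\<delta> x) \<and> \<delta> (x \<otimes> s) = tensor_ract S T (\<delta> x) s"
    and mult: "\<And>x. x \<in> carrier S \<Longrightarrow> tensor_mult S (\<delta> x) = x"
    using assms(1) unfolding separable_over_def by blast
  have "\<delta> e \<in> carrier (tensor_square S T)"
    using hom_in_carrier[OF \<delta>] e by simp
  then obtain z where z: "supported z" "\<delta> e = tensor_class z"
    unfolding carrier_tensor_square by auto
  show thesis
  proof (rule that)
    show "frag_mult S z = e" using mult[OF e] z by (simp add: tensor_mult_class)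
    show "lmap s z - rmap s z \<in> tensor_kernel S T" if "s \<in> carrier S" "s \<otimes> e = e \<otimes> s" for s
    proof -
      have "tensor_class (lmap s z) = tensor_class (rmap s z)"
        using act[OF that(1) e] unfolding z(2) tensor_lact_class[OF that(1)]
          tensor_ract_class[OF that(1)] that(2) by (elim conjE) (rule trans[OF sym])
      then show ?thesis by (simp add: tensor_class_eq_iff)
    qed
  qed (rule z)
qed

end

section \<open>Extending embeddings to the algebraic closure\<close>

locale algebraic_closure_of = algebraic_closure A K for A (structure) and K
begin

lemma subfield_K: "subfield K A" by unfold_locales

text \<open>Embeddings of intermediate fields are handled as graphs: each condition below survives
  unions of chains.\<close>

definition partial_embedding :: "('a \<times> 'a) set \<Rightarrow> bool" where
  "partial_embedding \<Gamma> \<longleftrightarrow> \<Gamma> \<subseteq> carrier A \<times> carrier A \<and> single_valued \<Gamma> \<and> Id_on K \<subseteq> \<Gamma> \<and>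
     (\<forall>x x' y y'. (x, x') \<in> \<Gamma> \<longrightarrow> (y, y') \<in> \<Gamma> \<longrightarrow> (x \<oplus> y, x' \<oplus> y') \<in> \<Gamma> \<and> (x \<otimes> y, x' \<otimes> y') \<in> \<Gamma>) \<and>
     (\<forall>x x'. (x, x') \<in> \<Gamma> \<longrightarrow> (\<ominus> x, \<ominus> x') \<in> \<Gamma> \<and> (x \<noteq> \<zero> \<longrightarrow> (inv x, inv x') \<in> \<Gamma>))"

lemma partial_embeddingD:
  assumes "partial_embedding \<Gamma>"
  shows "(x, x') \<in> \<Gamma> \<Longrightarrow> x \<in> carrier A" "(x, x') \<in> \<Gamma> \<Longrightarrow> x' \<in> carrier A"
    "\<lbrakk>(x, x') \<in> \<Gamma>; (x, x'') \<in> \<Gamma>\<rbrakk> \<Longrightarrow> x' = x''" "k \<in> K \<Longrightarrow> (k, k) \<in> \<Gamma>"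
    "\<lbrakk>(x, x') \<in> \<Gamma>; (y, y') \<in> \<Gamma>\<rbrakk> \<Longrightarrow> (x \<oplus> y, x' \<oplus> y') \<in> \<Gamma>"
    "\<lbrakk>(x, x') \<in> \<Gamma>; (y, y') \<in> \<Gamma>\<rbrakk> \<Longrightarrow> (x \<otimes> y, x' \<otimes> y') \<in> \<Gamma>"
    "(x, x') \<in> \<Gamma> \<Longrightarrow> (\<ominus> x, \<ominus> x') \<in> \<Gamma>"
    "\<lbrakk>(x, x') \<in> \<Gamma>; x \<noteq> \<zero>\<rbrakk> \<Longrightarrow> (inv x, inv x') \<in> \<Gamma>"
  using assms unfolding partial_embedding_def by (auto dest: single_valuedD)

definition apply_graph :: "('a \<times> 'a) set \<Rightarrow> 'a \<Rightarrow> 'a" where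
  "apply_graph \<Gamma> x = (THE y. (x, y) \<in> \<Gamma>)"

lemma apply_graph_eq: "\<lbrakk>partial_embedding \<Gamma>; (x, y) \<in> \<Gamma>\<rbrakk> \<Longrightarrow> apply_graph \<Gamma> x = y"
  unfolding apply_graph_def by (rule the_equality) (auto dest: partial_embeddingD(3))

lemma one_mem_K: "\<one> \<in> K"
  using subringE(3)[OF subfieldE(1)[OF subfield_K]] .

lemma partial_embedding_Domain:
  assumes "partial_embedding \<Gamma>"
  shows "subfield (Domain \<Gamma>) A" "K \<subseteq> Domain \<Gamma>"
    "apply_graph \<Gamma> \<in> ring_hom (A\<lparr>carrier := Domain \<Gamma>\<rparr>) A"
proof -
  note D = partial_embeddingD[OF assms]
  have 1: "(\<one>, \<one>) \<in> \<Gamma>" using D(4) one_mem_K by blast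
  have "subring (Domain \<Gamma>) A"
  proof (rule subringI)
    show "Domain \<Gamma> \<subseteq> carrier A" using D(1) by blast
    show "\<one> \<in> Domain \<Gamma>" using 1 by blast
    show "\<ominus> h \<in> Domain \<Gamma>" if "h \<in> Domain \<Gamma>" for h using that D(7) by blast
    show "h1 \<otimes> h2 \<in> Domain \<Gamma>" if "h1 \<in> Domain \<Gamma>" "h2 \<in> Domain \<Gamma>" for h1 h2
      using that D(6) by blast
    show "h1 \<oplus> h2 \<in> Domain \<Gamma>" if "h1 \<in> Domain \<Gamma>" "h2 \<in> Domain \<Gamma>" for h1 h2
      using that D(5) by blast
  qed
  then show "subfield (Domain \<Gamma>) A"
    by (rule subfieldI') (use D(8) in blast)
  show "K \<subseteq> Domain \<Gamma>" using D(4) by blast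
  show "apply_graph \<Gamma> \<in> ring_hom (A\<lparr>carrier := Domain \<Gamma>\<rparr>) A"
    by (rule ring_hom_memI)
      (auto simp: apply_graph_eq[OF assms] D(2) intro!: apply_graph_eq[OF assms] D(5,6) 1)
qed

text \<open>With \<open>F\<close> the domain of \<open>\<Gamma>\<close>, evaluating \<open>p\<close>
  at \<open>x\<close> and evaluating \<open>map f p\<close> at \<open>y\<close> are two
  homomorphisms on \<open>F[X]\<close>. The kernel of the former is generated by the minimal
  polynomial of \<open>x\<close>, which the latter kills by \<open>root\<close>; so the pairs of
  values form the graph of an embedding of \<open>F(x)\<close>.\<close>

lemma simple_extension_step:
  assumes G: "partial_embedding \<Gamma>" and x: "x \<in> carrier A" and y: "y \<in> carrier A"
    and root: "eval (map (apply_graph \<Gamma>) (Irr (Domain \<Gamma>) x)) y = \<zero>"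
  shows "\<exists>\<Delta>. partial_embedding \<Delta> \<and> \<Gamma> \<subseteq> \<Delta> \<and> (x, y) \<in> \<Delta>"
proof -
  define F where "F = Domain \<Gamma>"
  define f where "f = apply_graph \<Gamma>"
  note DG = partial_embeddingD[OF G]
  have F: "subfield F A" "K \<subseteq> F" and f: "f \<in> ring_hom (A\<lparr>carrier := F\<rparr>) A"
    using partial_embedding_Domain[OF G] unfolding F_def f_def by auto
  have Fr: "subring F A" and Fc: "F \<subseteq> carrier A" using subfieldE[OF F(1)] by auto
  interpret AF: field "A\<lparr>carrier := F\<rparr>" using subfield_iff(2)[OF F(1)] .
  interpret h: ring_hom_ring "A\<lparr>carrier := F\<rparr>" A f
    by (rule ring_hom_ringI2[OF AF.ring_axioms ring_axioms f])
  interpret UP: domain "F[X]" by (rule univ_poly_is_domain[OF Fr])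
  have alg: "(algebraic over F) x"
    by (rule algebraic_mono[OF F(2) algebraic_extension[OF x]])
  let ?P = "carrier (F[X])"
  define e where "e = (\<lambda>p. eval p x)"
  define e' where "e' = (\<lambda>p. eval (map f p) y)"
  have PF: "set p \<subseteq> F" if "p \<in> ?P" for p
    using that polynomial_incl univ_poly_carrier by blast
  have fcl: "f a \<in> carrier A" if "a \<in> F" for a using h.hom_closed that by simp
  have mapcl: "set (map f p) \<subseteq> carrier A" if "p \<in> ?P" for p using PF[OF that] fcl by auto
  have e: "e \<in> ring_hom (F[X]) A" unfolding e_def by (rule eval_is_hom[OF Fr x])
  have e': "e' \<in> ring_hom (F[X]) A"
  proof (rule ring_hom_memI)
    fix p q assume pq: "p \<in> ?P" "q \<in> ?P"
    note s = PF[OF pq(1)] PF[OF pq(2)]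
    \<comment> \<open>Applying \<open>f\<close> to coefficients commutes with polynomial addition
      after normalization, and evaluation does not see leading zeros.\<close>
    have "eval (normalize (map f (poly_add p q))) y = e' p \<oplus> e' q"
      using h.poly_add_hom'[of p q] s eval_poly_add[OF mapcl[OF pq(1)] mapcl[OF pq(2)] y]
      unfolding poly_add_consistent[OF Fr] e'_def by simp
    moreover have "set (map f (poly_add p q)) \<subseteq> carrier A"
      using mapcl[OF UP.a_closed[OF pq]] by (simp add: univ_poly_add)
    ultimately show "e' (p \<oplus>\<^bsub>F[X]\<^esub> q) = e' p \<oplus> e' q"
      using eval_normalize[OF _ y] by (simp add: univ_poly_add e'_def)
    have "eval (normalize (map f (poly_mult p q))) y = e' p \<otimes> e' q"
      using h.poly_mult_hom'[of p q] s eval_poly_mult[OF mapcl[OF pq(1)] mapcl[OF pq(2)] y]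
      unfolding poly_mult_consistent[OF Fr] e'_def by simp
    moreover have "set (map f (poly_mult p q)) \<subseteq> carrier A"
      using mapcl[OF UP.m_closed[OF pq]] by (simp add: univ_poly_mult)
    ultimately show "e' (p \<otimes>\<^bsub>F[X]\<^esub> q) = e' p \<otimes> e' q"
      using eval_normalize[OF _ y] by (simp add: univ_poly_mult e'_def)
  next
    show "e' \<one>\<^bsub>F[X]\<^esub> = \<one>" using h.hom_one y by (simp add: univ_poly_one e'_def)
  qed (use eval_in_carrier[OF mapcl y] in \<open>simp add: e'_def\<close>)
  interpret e: ring_hom_ring "F[X]" A e by (rule ring_hom_ringI2[OF UP.ring_axioms ring_axioms e])
  interpret e': ring_hom_ring "F[X]" A e' by (rule ring_hom_ringI2[OF UP.ring_axioms ring_axioms e'])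
  have zero: "e' d = \<zero>" if d: "d \<in> ?P" "e d = \<zero>" for d
  proof -
    have "d \<in> PIdl\<^bsub>F[X]\<^esub> (Irr F x)"
      using d Irr_generates_ker[OF F(1) x alg] unfolding a_kernel_def' e_def by auto
    then obtain r where r: "r \<in> ?P" "d = r \<otimes>\<^bsub>F[X]\<^esub> Irr F x"
      unfolding cgenideal_def by auto
    moreover have "e' (Irr F x) = \<zero>" using root unfolding e'_def F_def f_def .
    ultimately show ?thesis
      using IrrE(1)[OF F(1) x alg] by simp
  qed
  have wd: "e' p = e' q" if pq: "p \<in> ?P" "q \<in> ?P" "e p = e q" for p q
  proof -
    have "e (p \<ominus>\<^bsub>F[X]\<^esub> q) = \<zero>" using pq by (simp add: a_minus_def r_neg)
    then have "e' (p \<ominus>\<^bsub>F[X]\<^esub> q) = \<zero>" using pq zero by simp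
    then show ?thesis using pq by (simp add: a_minus_def) (metis e'.hom_closed minus_equality minus_minus a_inv_closed)
  qed
  define \<Delta> where "\<Delta> = (\<lambda>p. (e p, e' p)) ` ?P"
  have const: "poly_of_const a \<in> ?P" "e (poly_of_const a) = a" "e' (poly_of_const a) = f a"
    if a: "a \<in> F" for a
  proof -
    have ac: "a \<in> carrier A" using a Fc by auto
    show "poly_of_const a \<in> ?P"
      using a Fr unfolding poly_of_const_def by (auto simp: univ_poly_def polynomial_def subringE)
    have "e' [a] = f a" "e [a] = a"
      using fcl[OF a] ac y x unfolding e'_def e_def by auto
    then show "e (poly_of_const a) = a" "e' (poly_of_const a) = f a"
      using h.hom_zero unfolding poly_of_const_def e_def e'_def by auto
  qed
  have "\<Gamma> \<subseteq> \<Delta>"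
  proof (rule subrelI)
    fix a b assume ab: "(a, b) \<in> \<Gamma>"
    then have "a \<in> F" "f a = b" unfolding F_def f_def using apply_graph_eq[OF G] by auto
    then show "(a, b) \<in> \<Delta>"
      unfolding \<Delta>_def using const[of a] by (metis (no_types, lifting) image_eqI)
  qed
  moreover have "(x, y) \<in> \<Delta>"
  proof -
    have X: "[\<one>, \<zero>] \<in> ?P" using var_closed(1)[OF Fr] unfolding var_def .
    moreover have "e [\<one>, \<zero>] = x" unfolding e_def using x by simp
    moreover have "e' [\<one>, \<zero>] = y" unfolding e'_def using y h.hom_one h.hom_zero by simp
    ultimately show ?thesis unfolding \<Delta>_def by (metis (no_types, lifting) image_eqI)
  qed
  moreover have "partial_embedding \<Delta>"
    unfolding partial_embedding_def
  proof (intro conjI allI impI)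
    show "\<Delta> \<subseteq> carrier A \<times> carrier A" unfolding \<Delta>_def by auto
    show "single_valued \<Delta>" unfolding \<Delta>_def by (rule single_valuedI) (auto dest: wd)
    show "Id_on K \<subseteq> \<Delta>" using \<open>\<Gamma> \<subseteq> \<Delta>\<close> DG(4) by auto
    fix a a' b b' assume "(a, a') \<in> \<Delta>" "(b, b') \<in> \<Delta>"
    then obtain p q where pq: "p \<in> ?P" "q \<in> ?P" "a = e p" "a' = e' p" "b = e q" "b' = e' q"
      unfolding \<Delta>_def by auto
    then have "a \<oplus> b = e (p \<oplus>\<^bsub>F[X]\<^esub> q)" "a' \<oplus> b' = e' (p \<oplus>\<^bsub>F[X]\<^esub> q)"
      "a \<otimes> b = e (p \<otimes>\<^bsub>F[X]\<^esub> q)" "a' \<otimes> b' = e' (p \<otimes>\<^bsub>F[X]\<^esub> q)" by auto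
    then show "(a \<oplus> b, a' \<oplus> b') \<in> \<Delta>" "(a \<otimes> b, a' \<otimes> b') \<in> \<Delta>"
      unfolding \<Delta>_def using UP.a_closed[OF pq(1,2)] UP.m_closed[OF pq(1,2)] by auto
  next
    fix a a' assume "(a, a') \<in> \<Delta>"
    then obtain p where p: "p \<in> ?P" "a = e p" "a' = e' p"
      unfolding \<Delta>_def by auto
    then have "\<ominus> a = e (\<ominus>\<^bsub>F[X]\<^esub> p)" "\<ominus> a' = e' (\<ominus>\<^bsub>F[X]\<^esub> p)" by auto
    then show "(\<ominus> a, \<ominus> a') \<in> \<Delta>" unfolding \<Delta>_def using UP.a_inv_closed[OF p(1)] by auto
    assume nz: "a \<noteq> \<zero>"
    \<comment> \<open>As \<open>x\<close> is algebraic over \<open>F\<close>, the values of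
      polynomials at \<open>x\<close> already form a field, so the inverse of \<open>a\<close> is
      again the value of some \<open>q\<close>.\<close>
    have SE: "simple_extension F x = e ` ?P"
      unfolding e_def by (rule simple_extension_as_eval_img[OF Fc x])
    have sf: "subfield (simple_extension F x) A"
      using simple_extension_is_subfield[OF F(1) x] alg by simp
    have "inv a \<in> e ` ?P"
      using subfield_m_inv(1)[OF sf, of a] nz p unfolding SE by auto
    then obtain q where q: "q \<in> ?P" "inv a = e q" by auto
    have "e (p \<otimes>\<^bsub>F[X]\<^esub> q) = e \<one>\<^bsub>F[X]\<^esub>"
      using p q nz subfield_m_inv(2)[OF sf, of a] unfolding SE by auto
    then have "e' (p \<otimes>\<^bsub>F[X]\<^esub> q) = e' \<one>\<^bsub>F[X]\<^esub>"
      by (rule wd[OF UP.m_closed[OF p(1) q(1)] UP.one_closed])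
    then have "a' \<otimes> e' q = \<one>" using p q by simp
    then have "inv a' = e' q" using comm_inv_char[of a' "e' q"] p q by simp
    then show "(inv a, inv a') \<in> \<Delta>" unfolding \<Delta>_def using q by auto
  qed
  ultimately show ?thesis by blast
qed

lemma partial_embedding_Union:
  assumes "C \<noteq> {}" and chain: "\<And>\<Gamma> \<Delta>. \<lbrakk>\<Gamma> \<in> C; \<Delta> \<in> C\<rbrakk> \<Longrightarrow> \<Gamma> \<subseteq> \<Delta> \<or> \<Delta> \<subseteq> \<Gamma>"
    and C: "\<And>\<Gamma>. \<Gamma> \<in> C \<Longrightarrow> partial_embedding \<Gamma>"
  shows "partial_embedding (\<Union>C)"
proof -
  note D = partial_embeddingD[OF C]
  have two: "\<exists>\<Gamma>\<in>C. p \<in> \<Gamma> \<and> q \<in> \<Gamma>" if "p \<in> \<Union>C" "q \<in> \<Union>C" for p q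
    using that chain by blast
  show ?thesis
    unfolding partial_embedding_def
  proof (intro conjI allI impI)
    show "\<Union>C \<subseteq> carrier A \<times> carrier A" using D(1,2) by auto
    show "single_valued (\<Union>C)"
    proof (rule single_valuedI)
      fix x y z assume "(x, y) \<in> \<Union>C" "(x, z) \<in> \<Union>C"
      then show "y = z" using two D(3) by metis
    qed
    show "Id_on K \<subseteq> \<Union>C" using D(4) assms(1) by blast
    fix x x' y y' assume "(x, x') \<in> \<Union>C" "(y, y') \<in> \<Union>C"
    then obtain \<Gamma> where "\<Gamma> \<in> C" "(x, x') \<in> \<Gamma>" "(y, y') \<in> \<Gamma>" using two by blast
    then show "(x \<oplus> y, x' \<oplus> y') \<in> \<Union>C" "(x \<otimes> y, x' \<otimes> y') \<in> \<Union>C"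
      using D(5,6) by blast+
  next
    fix x x' assume "(x, x') \<in> \<Union>C"
    then show "(\<ominus> x, \<ominus> x') \<in> \<Union>C" using D(7) by blast
  next
    fix x x' assume "(x, x') \<in> \<Union>C" "x \<noteq> \<zero>"
    then show "(inv x, inv x') \<in> \<Union>C" using D(8) by blast
  qed
qed

section \<open>Automorphisms of the algebraic closure\<close>

text \<open>Its members may agree on the carrier and differ outside it, so this is not literally the
  automorphism group. Counting is done only with restrictions to subfields.\<close>

definition closure_auts :: "('a \<Rightarrow> 'a) set" where
  "closure_auts = {g \<in> ring_iso A A. \<forall>x\<in>K. g x = x}"

lemma closure_autsD:
  assumes "g \<in> closure_auts"
  shows "ring_hom_ring A A g" "bij_betw g (carrier A) (carrier A)" "x \<in> K \<Longrightarrow> g x = x"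
  using assms ring_hom_ringI2[OF ring_axioms ring_axioms]
  unfolding closure_auts_def ring_iso_def by auto

lemma eval_hom_fixed:
  assumes g: "g \<in> ring_hom A A" "\<And>x. x \<in> K \<Longrightarrow> g x = x"
    and p: "p \<in> carrier (K[X])" and x: "x \<in> carrier A"
  shows "eval p (g x) = g (eval p x)"
proof -
  interpret g: ring_hom_ring A A g
    by (rule ring_hom_ringI2[OF ring_axioms ring_axioms g(1)])
  have "map g p = p"
    using p polynomial_incl univ_poly_carrier g(2) by (metis map_idI subsetD)
  then show ?thesis using g.eval_hom[OF subfieldE(1)[OF subfield_K] x p] by simp
qed

lemma finite_roots:
  assumes p: "p \<in> carrier (K[X])" "p \<noteq> []"
  shows "finite {x \<in> carrier A. eval p x = \<zero>}"
proof -
  have "{x \<in> carrier A. eval p x = \<zero>} = {x. is_root p x}"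
    using p(2) by (auto simp: is_root_def)
  then show ?thesis
    using finite_number_of_roots[OF carrier_polynomial_shell[OF subfieldE(1)[OF subfield_K] p(1)]]
    by simp
qed

lemma Irr_K:
  assumes "x \<in> carrier A"
  shows "Irr K x \<in> carrier (K[X])" "Irr K x \<noteq> []" "eval (Irr K x) x = \<zero>"
    "pirreducible K (Irr K x)" "lead_coeff (Irr K x) = \<one>"
proof -
  note I = IrrE[OF subfield_K assms algebraic_extension[OF assms]]
  show "Irr K x \<in> carrier (K[X])" "eval (Irr K x) x = \<zero>" "pirreducible K (Irr K x)"
    "lead_coeff (Irr K x) = \<one>"
    using I by auto
  show "Irr K x \<noteq> []"
    using pirreducible_degree[OF subfield_K I(1,2)] by auto
qed

text \<open>An endomorphism over \<open>K\<close> permutes the finite set of roots of each polynomial over \<open>K\<close>,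
  hence is onto.\<close>

lemma endomorphism_mem_closure_auts:
  assumes g: "g \<in> ring_hom A A" and fixed: "\<And>x. x \<in> K \<Longrightarrow> g x = x"
  shows "g \<in> closure_auts"
proof -
  have inj: "inj_on g (carrier A)"
    by (rule non_trivial_field_hom_is_inj[OF g field_axioms field_axioms])
  have cl: "g x \<in> carrier A" if "x \<in> carrier A" for x by (rule ring_hom_closed[OF g that])
  have "z \<in> g ` carrier A" if z: "z \<in> carrier A" for z
  proof -
    define Z where "Z = {x \<in> carrier A. eval (Irr K z) x = \<zero>}"
    have fin: "finite Z" unfolding Z_def by (rule finite_roots[OF Irr_K(1,2)[OF z]])
    have "g ` Z \<subseteq> Z"
    proof (rule image_subsetI)
      fix x assume "x \<in> Z"
      then show "g x \<in> Z"
        using eval_hom_fixed[OF g fixed Irr_K(1)[OF z], of x] ring_hom_zero[OF g ring_axioms ring_axioms] cl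
        unfolding Z_def by simp
    qed
    moreover have "inj_on g Z" using inj unfolding Z_def by (rule inj_on_subset) auto
    ultimately have "g ` Z = Z" using endo_inj_surj[OF fin] by blast
    moreover have "z \<in> Z" using z Irr_K(3)[OF z] unfolding Z_def by simp
    ultimately show ?thesis unfolding Z_def by blast
  qed
  then have "g ` carrier A = carrier A" using cl by auto
  then show ?thesis
    using g inj fixed unfolding closure_auts_def ring_iso_def bij_betw_def by simp
qed

text \<open>A maximal extension is defined everywhere: for any \<open>x\<close>, the image of its
  minimal polynomial over the domain has a root \<open>y\<close> in \<open>A\<close>, and adjoining
  \<open>x \<mapsto> y\<close> gives an extension, which by maximality is nothing new.\<close>

lemma extend_partial_embedding:
  assumes G: "partial_embedding \<Gamma>"
  shows "\<exists>g\<in>closure_auts. \<forall>x y. (x, y) \<in> \<Gamma> \<longrightarrow> g x = y"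
proof -
  define \<C> where "\<C> = {\<Delta>. partial_embedding \<Delta> \<and> \<Gamma> \<subseteq> \<Delta>}"
  have Z: "\<exists>M\<in>\<C>. \<forall>\<Delta>\<in>\<C>. M \<subseteq> \<Delta> \<longrightarrow> \<Delta> = M"
  proof (rule subset_Zorn_nonempty)
    show "\<C> \<noteq> {}" using G unfolding \<C>_def by auto
    fix C assume C: "C \<noteq> {}" "subset.chain \<C> C"
    have sub: "C \<subseteq> \<C>" using C(2) by (simp add: subset.chain_def)
    have "partial_embedding (\<Union>C)"
    proof (rule partial_embedding_Union[OF C(1)])
      show "\<Delta> \<subseteq> \<Delta>' \<or> \<Delta>' \<subseteq> \<Delta>" if "\<Delta> \<in> C" "\<Delta>' \<in> C" for \<Delta> \<Delta>'
        using C(2) that by (auto simp: subset_chain_def)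
    qed (use sub in \<open>auto simp: \<C>_def\<close>)
    moreover have "\<Gamma> \<subseteq> \<Union>C" using C(1) sub unfolding \<C>_def by blast
    ultimately show "\<Union>C \<in> \<C>" unfolding \<C>_def by simp
  qed
  obtain M where "M \<in> \<C>" and max': "\<forall>\<Delta>\<in>\<C>. M \<subseteq> \<Delta> \<longrightarrow> \<Delta> = M"
    using Z by (elim bexE)
  then have M: "partial_embedding M" "\<Gamma> \<subseteq> M" unfolding \<C>_def by simp_all
  have max: "\<Delta> = M" if "partial_embedding \<Delta>" "M \<subseteq> \<Delta>" for \<Delta>
    using max'[rule_format, of \<Delta>] that M(2) unfolding \<C>_def by simp
  define F where "F = Domain M"
  define f where "f = apply_graph M"
  have F: "subfield F A" "K \<subseteq> F" and f: "f \<in> ring_hom (A\<lparr>carrier := F\<rparr>) A"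
    using partial_embedding_Domain[OF M(1)] unfolding F_def f_def by auto
  have "carrier A \<subseteq> F"
  proof
    fix x assume x: "x \<in> carrier A"
    have alg: "(algebraic over F) x" by (rule algebraic_mono[OF F(2) algebraic_extension[OF x]])
    note I = IrrE[OF F(1) x alg]
    have Fr: "field (A\<lparr>carrier := F\<rparr>)" using subfield_iff(2)[OF F(1)] .
    have "Irr F x \<in> carrier (poly_ring (A\<lparr>carrier := F\<rparr>))"
      using I(1) univ_poly_consistent[OF subfieldE(1)[OF F(1)]] by simp
    then have p: "map f (Irr F x) \<in> carrier (poly_ring A)"
      by (rule polynomial_hom[OF f Fr field_axioms])
    have "degree (map f (Irr F x)) \<ge> 1"
      using pirreducible_degree[OF F(1) I(1,2)] by simp
    then have "roots (map f (Irr F x)) \<noteq> {#}"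
      using roots_over_carrier[OF p] unfolding splitted_def by auto
    then obtain y where "y \<in># roots (map f (Irr F x))" by blast
    then have y: "y \<in> carrier A" "eval (map f (Irr F x)) y = \<zero>"
      using roots_mem_iff_is_root[OF p] unfolding is_root_def by auto
    obtain \<Delta> where "partial_embedding \<Delta>" "M \<subseteq> \<Delta>" "(x, y) \<in> \<Delta>"
      using simple_extension_step[OF M(1) x y(1)] y(2) unfolding F_def f_def by blast
    then show "x \<in> F" using max unfolding F_def by blast
  qed
  then have "F = carrier A" using subfieldE(3)[OF F(1)] by auto
  then have "f \<in> ring_hom A A" using f by simp
  moreover have "f x = x" if "x \<in> K" for x
    unfolding f_def by (rule apply_graph_eq[OF M(1) partial_embeddingD(4)[OF M(1) that]])
  ultimately have "f \<in> closure_auts" by (rule endomorphism_mem_closure_auts)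
  moreover have "f x = y" if "(x, y) \<in> \<Gamma>" for x y
    unfolding f_def using apply_graph_eq[OF M(1)] M(2) that by blast
  ultimately show ?thesis by blast
qed

lemma Id_on_partial_embedding: "partial_embedding (Id_on K)"
proof -
  note S = subringE[OF subfieldE(1)[OF subfield_K]]
  show ?thesis
    unfolding partial_embedding_def
  proof (intro conjI allI impI)
    show "Id_on K \<subseteq> carrier A \<times> carrier A" "single_valued (Id_on K)" "Id_on K \<subseteq> Id_on K"
      using S(1) by (auto intro!: single_valuedI)
  qed (use S(5-7) subfield_m_inv(1)[OF subfield_K] in auto)
qed

text \<open>The identity of \<open>K\<close> fixes the coefficients of the minimal polynomial, so it
  extends to \<open>x \<mapsto> y\<close>, and from there to all of \<open>A\<close>.\<close>

lemma conjugate_roots: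
  assumes x: "x \<in> carrier A" and y: "y \<in> carrier A" and root: "eval (Irr K x) y = \<zero>"
  shows "\<exists>g\<in>closure_auts. g x = y"
proof -
  have "map (apply_graph (Id_on K)) (Irr K x) = Irr K x"
  proof (rule map_idI)
    fix a assume "a \<in> set (Irr K x)"
    then have "a \<in> K" using Irr_K(1)[OF x] polynomial_incl univ_poly_carrier by blast
    then show "apply_graph (Id_on K) a = a"
      by (rule apply_graph_eq[OF Id_on_partial_embedding Id_onI])
  qed
  then obtain \<Delta> where "partial_embedding \<Delta>" "(x, y) \<in> \<Delta>"
    using simple_extension_step[OF Id_on_partial_embedding x y] root by (auto simp: Domain_Id_on)
  then show ?thesis using extend_partial_embedding by blast
qed

text \<open>Its graph makes \<open>f\<close> a partial embedding. The purpose is to replace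
  automorphisms of intermediate fields by automorphisms of \<open>A\<close>, which can be composed,
  inverted and restricted to any conjugate field.\<close>

lemma extend_field_aut:
  assumes E: "subfield E A" "K \<subseteq> E" and f: "f \<in> field_auts A K E"
  shows "\<exists>g\<in>closure_auts. restrict g E = f"
proof -
  let ?E = "A\<lparr>carrier := E\<rparr>"
  interpret E: field ?E using subfield_iff(2)[OF E(1)] .
  have f': "f \<in> ring_hom ?E ?E" "bij_betw f E E" "f \<in> extensional E" "\<And>x. x \<in> K \<Longrightarrow> f x = x"
    using f unfolding field_auts_def ring_iso_def by auto
  interpret f: ring_hom_ring ?E ?E f
    by (rule ring_hom_ringI2[OF E.ring_axioms E.ring_axioms f'(1)])
  note S = subringE[OF subfieldE(1)[OF E(1)]]
  have fcl: "f x \<in> E" if "x \<in> E" for x using f.hom_closed that by simp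
  have ac: "x \<in> carrier A" if "x \<in> E" for x using S(1) that by auto
  define \<Gamma> where "\<Gamma> = (\<lambda>x. (x, f x)) ` E"
  have "partial_embedding \<Gamma>"
    unfolding partial_embedding_def
  proof (intro conjI allI impI)
    show "\<Gamma> \<subseteq> carrier A \<times> carrier A" "single_valued \<Gamma>" "Id_on K \<subseteq> \<Gamma>"
      using ac fcl E(2) f'(4) unfolding \<Gamma>_def by (auto intro!: single_valuedI image_eqI)
  next
    fix x x' y y' assume "(x, x') \<in> \<Gamma>" "(y, y') \<in> \<Gamma>"
    then have xy: "x \<in> E" "y \<in> E" "x' = f x" "y' = f y" unfolding \<Gamma>_def by auto
    then show "(x \<oplus> y, x' \<oplus> y') \<in> \<Gamma>" "(x \<otimes> y, x' \<otimes> y') \<in> \<Gamma>"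
      using f.hom_add[of x y] f.hom_mult[of x y] S(6,7) unfolding \<Gamma>_def by (auto intro!: image_eqI)
  next
    fix x x' assume "(x, x') \<in> \<Gamma>"
    then have x: "x \<in> E" "x' = f x" unfolding \<Gamma>_def by auto
    have "f (\<ominus> x) \<oplus> f x = f \<zero>"
      using f.hom_add[of "\<ominus> x" x] x S(5) ac by (simp add: l_neg)
    then have "f (\<ominus> x) \<oplus> f x = \<zero>" using f.hom_zero by simp
    then have "f (\<ominus> x) = \<ominus> f x"
      using minus_equality[of "f (\<ominus> x)" "f x"] fcl S(5) ac x by simp
    then show "(\<ominus> x, \<ominus> x') \<in> \<Gamma>" using x S(5) unfolding \<Gamma>_def by (auto intro!: image_eqI)
    assume nz: "x \<noteq> \<zero>"
    have i: "inv x \<in> E" "x \<otimes> inv x = \<one>" using subfield_m_inv[OF E(1), of x] x nz by auto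
    have "f x \<otimes> f (inv x) = \<one>"
      using f.hom_mult[of x "inv x"] i x f.hom_one by simp
    then have "inv (f x) = f (inv x)"
      using comm_inv_char[of "f x" "f (inv x)"] i x ac fcl by simp
    then show "(inv x, inv x') \<in> \<Gamma>" using x i unfolding \<Gamma>_def by (auto intro!: image_eqI)
  qed
  then obtain g where "g \<in> closure_auts" "\<And>x y. (x, y) \<in> \<Gamma> \<Longrightarrow> g x = y"
    using extend_partial_embedding by blast
  then have "restrict g E = f"
    using f'(3) unfolding \<Gamma>_def by (intro extensionalityI[of _ E]) auto
  with \<open>g \<in> closure_auts\<close> show ?thesis by blast
qed

lemma restrict_field_aut:
  assumes E: "subfield E A" "K \<subseteq> E" and g: "g \<in> closure_auts" "g ` E = E"
  shows "restrict g E \<in> field_auts A K E"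
proof -
  interpret g: ring_hom_ring A A g by (rule closure_autsD[OF g(1)])
  note S = subringE[OF subfieldE(1)[OF E(1)]]
  have ac: "x \<in> carrier A" if "x \<in> E" for x using S(1) that by auto
  have gE: "g x \<in> E" if "x \<in> E" for x using g(2) that by auto
  have "inj_on g E" using closure_autsD(2)[OF g(1)] S(1) inj_on_subset unfolding bij_betw_def by blast
  then have "bij_betw (restrict g E) E E"
    using g(2) unfolding bij_betw_def by (auto simp: inj_on_restrict_eq)
  moreover have "restrict g E \<in> ring_hom (A\<lparr>carrier := E\<rparr>) (A\<lparr>carrier := E\<rparr>)"
    by (rule ring_hom_memI) (use gE ac S in \<open>auto\<close>)
  moreover have "\<forall>x\<in>K. restrict g E x = x" using closure_autsD(3)[OF g(1)] E(2) by auto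
  ultimately show ?thesis unfolding field_auts_def ring_iso_def by simp
qed

lemma field_auts_eq:
  assumes "subfield E A" "K \<subseteq> E"
  shows "field_auts A K E = (\<lambda>g. restrict g E) ` {g \<in> closure_auts. g ` E = E}"
proof (intro subset_antisym subsetI)
  fix f assume f: "f \<in> field_auts A K E"
  then obtain g where "g \<in> closure_auts" "restrict g E = f"
    using extend_field_aut[OF assms] by blast
  moreover from this have "g ` E = E"
    using f unfolding field_auts_def ring_iso_def bij_betw_def by force
  ultimately show "f \<in> (\<lambda>g. restrict g E) ` {g \<in> closure_auts. g ` E = E}" by blast
qed (use restrict_field_aut[OF assms] in auto)

lemma closure_auts_comp: "\<lbrakk>g \<in> closure_auts; h \<in> closure_auts\<rbrakk> \<Longrightarrow> g \<circ> h \<in> closure_auts"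
  unfolding closure_auts_def using ring_iso_set_trans[of h A A g A] by auto

lemma closure_auts_inv:
  assumes g: "g \<in> closure_auts"
  shows "\<exists>h\<in>closure_auts. \<forall>x\<in>carrier A. h (g x) = x \<and> g (h x) = x"
proof -
  define h where "h = inv_into (carrier A) g"
  have "h \<in> ring_iso A A"
    unfolding h_def by (rule ring_iso_set_sym) (use g ring_axioms in \<open>simp_all add: closure_auts_def\<close>)
  moreover have hg: "h (g x) = x" "g (h x) = x" if "x \<in> carrier A" for x
    using closure_autsD(2)[OF g] that unfolding h_def
    by (auto simp: bij_betw_def f_inv_into_f)
  moreover have "h x = x" if "x \<in> K" for x
    using hg(1)[of x] closure_autsD(3)[OF g that] subfieldE(3)[OF subfield_K] that by auto
  ultimately show ?thesis unfolding closure_auts_def by blast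
qed

lemma id_closure_auts: "id \<in> closure_auts"
  unfolding closure_auts_def ring_iso_def by (auto intro: ring_hom_memI)

section \<open>Normal extensions and the normal closure\<close>

text \<open>\<open>g x\<close> is a root of the minimal polynomial of \<open>x\<close> over
  \<open>K\<close>, which splits over \<open>E\<close> because it has the root \<open>x\<close>
  there. The minimal polynomial of \<open>g x\<close> over \<open>E\<close> divides this split
  polynomial and is therefore linear.\<close>

lemma normal_extension_stable:
  assumes E: "normal_extension A K E" and g: "g \<in> closure_auts" and x: "x \<in> E"
  shows "g x \<in> E"
proof -
  have sE: "subfield E A" and KE: "K \<subseteq> E"
    and split: "\<And>p. \<lbrakk>p \<in> carrier (K[X]); pirreducible K p; \<exists>x\<in>E. eval p x = \<zero>\<rbrakk> \<Longrightarrow>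
      ring.splitted (A\<lparr>carrier := E\<rparr>) p"
    using E unfolding normal_extension_def by auto
  have xA: "x \<in> carrier A" using subfieldE(3)[OF sE] x by auto
  interpret g: ring_hom_ring A A g by (rule closure_autsD[OF g])
  interpret AE: field "A\<lparr>carrier := E\<rparr>" using subfield_iff(2)[OF sE] .
  define y where "y = g x"
  have y: "y \<in> carrier A" unfolding y_def using xA by simp
  define p where "p = Irr K x"
  note I = Irr_K[OF xA, folded p_def]
  have yp: "eval p y = \<zero>"
    unfolding y_def using eval_hom_fixed[OF g.homh closure_autsD(3)[OF g] I(1) xA] I(3) by simp
  have alg: "(algebraic over E) y" by (rule algebraic_mono[OF KE algebraic_extension[OF y]])
  note J = IrrE[OF sE y alg]
  have pE: "p \<in> carrier (E[X])"
    using I(1) KE unfolding sym[OF univ_poly_carrier] polynomial_def by auto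
  have "Irr E y divides\<^bsub>E[X]\<^esub> p"
    using Irr_minimal[OF sE y alg pE yp] pdivides_iff_shell[OF sE J(1) pE] by simp
  then have "Irr E y pdivides\<^bsub>A\<lparr>carrier := E\<rparr>\<^esub> p"
    unfolding pdivides_def using univ_poly_consistent[OF subfieldE(1)[OF sE]] by simp
  then have "degree (Irr E y) = 1"
    using AE.splitted_imp_trivial_factors[OF _ I(2) split[OF I(1,4)], of "Irr E y"] pE J(1,2) I(3) x
      univ_poly_consistent[OF subfieldE(1)[OF sE]] by auto
  then obtain a where a: "Irr E y = [\<one>, a]"
    using J(3) by (cases "Irr E y"; cases "tl (Irr E y)") auto
  have aE: "a \<in> E" using J(1) unfolding a sym[OF univ_poly_carrier] polynomial_def by auto
  then have aA: "a \<in> carrier A" using subfieldE(3)[OF sE] by auto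
  have "y \<oplus> a = \<zero>" using J(4) y aA unfolding a by simp
  then have "y = \<ominus> a" using minus_equality[OF _ aA y] by simp
  then show ?thesis using aE subringE(5)[OF subfieldE(1)[OF sE]] unfolding y_def by simp
qed

text \<open>If \<open>x\<close> were the only root, multiplicity at most one would leave room for a
  single linear factor. As the polynomial splits in \<open>A\<close>, it would have degree one, and
  \<open>x\<close> would lie in \<open>K\<close>.\<close>

lemma separable_other_root:
  assumes x: "x \<in> carrier A" "x \<notin> K"
    and sep: "\<And>y. y \<in> carrier A \<Longrightarrow> alg_mult (Irr K x) y \<le> 1"
  shows "\<exists>y\<in>carrier A. y \<noteq> x \<and> eval (Irr K x) y = \<zero>"
proof (rule ccontr)
  assume no: "\<not> ?thesis"
  define p where "p = Irr K x"
  note I = Irr_K[OF x(1), folded p_def]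
  have p: "p \<in> carrier (poly_ring A)"
    by (rule carrier_polynomial_shell[OF subfieldE(1)[OF subfield_K] I(1)])
  have "count (roots p) y \<le> count {#x#} y" for y
  proof (cases "y \<in># roots p")
    case True
    then have "y = x" "y \<in> carrier A"
      using roots_mem_iff_is_root[OF p] no unfolding is_root_def p_def by auto
    then show ?thesis
      using sep[of y] alg_mult_eq_count_roots[OF p] unfolding p_def by simp
  qed (simp add: not_in_iff)
  then have "roots p \<subseteq># {#x#}" by (rule mset_subset_eqI)
  then have "size (roots p) \<le> 1" using size_mset_mono by fastforce
  moreover have "degree p \<ge> 1" by (rule pirreducible_degree[OF subfield_K I(1,4)])
  ultimately have "degree p = 1"
    using roots_over_carrier[OF p] unfolding splitted_def by linarith
  then obtain a where a: "p = [\<one>, a]"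
    using I(5) by (cases p; cases "tl p") auto
  have aK: "a \<in> K" using I(1) unfolding a sym[OF univ_poly_carrier] polynomial_def by auto
  then have aA: "a \<in> carrier A" using subfieldE(3)[OF subfield_K] by auto
  have "x \<oplus> a = \<zero>" using I(3) x aA unfolding a by simp
  then have "x = \<ominus> a" using minus_equality[OF _ aA x(1)] by simp
  then show False using aK subringE(5)[OF subfieldE(1)[OF subfield_K]] x(2) by simp
qed

text \<open>Stability under the inverse automorphism gives the other inclusion.\<close>

lemma closure_auts_image_eq:
  assumes "E \<subseteq> carrier A" and stable: "\<And>g. g \<in> closure_auts \<Longrightarrow> g ` E \<subseteq> E" and g: "g \<in> closure_auts"
  shows "g ` E = E"
proof (intro subset_antisym stable g subsetI)
  fix x assume x: "x \<in> E"
  obtain h where h: "h \<in> closure_auts" "\<And>x. x \<in> carrier A \<Longrightarrow> g (h x) = x"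
    using closure_auts_inv[OF g] by blast
  have "h x \<in> E" using stable[OF h(1)] x by auto
  moreover have "x = g (h x)" using h(2) x assms(1) by auto
  ultimately show "x \<in> g ` E" by blast
qed

lemma normal_extension_image_eq:
  assumes E: "normal_extension A K E" and g: "g \<in> closure_auts"
  shows "g ` E = E"
proof (rule closure_auts_image_eq[OF _ _ g])
  show "E \<subseteq> carrier A" using E subfieldE(3) unfolding normal_extension_def by blast
qed (use normal_extension_stable[OF E] in auto)

text \<open>Exhibits a member of the family that \<open>normal_closure\<close> intersects; an empty
  family would give the whole type instead of a subfield.\<close>

lemma normal_extension_carrier: "normal_extension A K (carrier A)"
proof -
  have "splitted p" if "p \<in> carrier (K[X])" for p
    using that roots_over_subfield by simp
  then show ?thesis
    using subfield_K subfieldE(3)[OF subfield_K] carrier_is_subfield algebraic_extension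
    unfolding normal_extension_def over_def by auto
qed

context
  fixes E assumes E: "subfield E A" "K \<subseteq> E"
begin

lemma normal_closure_subfield: "subfield (normal_closure A K E) A"
proof -
  let ?\<E> = "{F. normal_extension A K F \<and> E \<subseteq> F}"
  have sf: "subfield F A" if "F \<in> ?\<E>" for F using that unfolding normal_extension_def by blast
  note S = subringE[OF subfieldE(1)[OF sf]]
  have ne: "carrier A \<in> ?\<E>" using normal_extension_carrier subfieldE(3)[OF E(1)] by blast
  have "subring (\<Inter>?\<E>) A"
  proof (rule subringI)
    show "\<Inter>?\<E> \<subseteq> carrier A" using ne by blast
    show "\<one> \<in> \<Inter>?\<E>" using S(3) by blast
    show "\<ominus> h \<in> \<Inter>?\<E>" if "h \<in> \<Inter>?\<E>" for h using S(5) that by blast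
    show "h1 \<otimes> h2 \<in> \<Inter>?\<E>" if "h1 \<in> \<Inter>?\<E>" "h2 \<in> \<Inter>?\<E>" for h1 h2 using S(6) that by blast
    show "h1 \<oplus> h2 \<in> \<Inter>?\<E>" if "h1 \<in> \<Inter>?\<E>" "h2 \<in> \<Inter>?\<E>" for h1 h2 using S(7) that by blast
  qed
  then show ?thesis
    unfolding normal_closure_def
    by (rule subfieldI') (use subfield_m_inv(1)[OF sf] in blast)
qed

lemma normal_closure_incl: "E \<subseteq> normal_closure A K E"
  unfolding normal_closure_def by blast

lemma normal_closure_K: "K \<subseteq> normal_closure A K E"
  using normal_closure_incl E(2) by blast

lemma normal_closure_image_eq:
  assumes "g \<in> closure_auts"
  shows "g ` normal_closure A K E = normal_closure A K E"
proof (rule closure_auts_image_eq[OF subfieldE(3)[OF normal_closure_subfield] _ assms])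
  show "g ` normal_closure A K E \<subseteq> normal_closure A K E" if "g \<in> closure_auts" for g
    unfolding normal_closure_def using normal_extension_stable that by blast
qed

lemma normal_closure_auts:
  "field_auts A K (normal_closure A K E) = (\<lambda>g. restrict g (normal_closure A K E)) ` closure_auts"
  using field_auts_eq[OF normal_closure_subfield normal_closure_K] normal_closure_image_eq by auto

lemma conjugates_eq: "conjugates A K E = (\<lambda>g. g ` E) ` closure_auts"
proof -
  have "restrict g (normal_closure A K E) ` E = g ` E" for g :: "'a \<Rightarrow> 'a"
    using normal_closure_incl by (intro image_cong) auto
  then show ?thesis unfolding conjugates_def normal_closure_auts image_image by simp
qed

lemma conjugates_subset: "j \<in> conjugates A K E \<Longrightarrow> j \<subseteq> normal_closure A K E"
  unfolding conjugates_eq using normal_closure_incl normal_closure_image_eq by blast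

text \<open>The normal closure drops out of the description: its automorphisms are exactly the
  restrictions of those of \<open>A\<close>, so arrows are restrictions of elements of
  \<open>closure_auts\<close> to conjugate fields.\<close>

lemma arrows_eq:
  "arrows A K E = {Arrow (g ` j) (restrict g j) j | g j. g \<in> closure_auts \<and> j \<in> conjugates A K E}"
    (is "?l = ?r")
proof -
  have r: "restrict (restrict g (normal_closure A K E)) j = restrict g j"
    "restrict g (normal_closure A K E) ` j = g ` j"
    if "j \<in> conjugates A K E" for g :: "'a \<Rightarrow> 'a" and j
    using conjugates_subset[OF that] by (simp_all add: Int_absorb1 subset_iff cong: image_cong)
  show ?thesis
  proof (intro subset_antisym subsetI)
    fix s assume "s \<in> ?l"
    then obtain i j g where "s = Arrow i (restrict (restrict g (normal_closure A K E)) j) j"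
      "g \<in> closure_auts" "j \<in> conjugates A K E" "restrict g (normal_closure A K E) ` j = i"
      unfolding arrows_def normal_closure_auts by auto
    then show "s \<in> ?r" using r[of j g] by auto
  next
    fix s assume "s \<in> ?r"
    then obtain g j where gj: "s = Arrow (g ` j) (restrict g j) j" "g \<in> closure_auts" "j \<in> conjugates A K E"
      by blast
    obtain h where h: "h \<in> closure_auts" "j = h ` E"
      using gj(3) unfolding conjugates_eq by blast
    have "g ` j = (g \<circ> h) ` E" unfolding h(2) by (simp add: image_comp)
    then have gjc: "g ` j \<in> conjugates A K E"
      using closure_auts_comp[OF gj(2) h(1)] unfolding conjugates_eq by blast
    show "s \<in> ?l"
      unfolding arrows_def normal_closure_auts mem_Collect_eq
      by (rule exI[of _ "g ` j"], rule exI[of _ j], rule exI[of _ "restrict g (normal_closure A K E)"])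
        (simp only: r[OF gj(3)] gj(1,3) gjc simp_thms, rule imageI, rule gj(2))
  qed
qed

end

end

section \<open>The groupoid of conjugates and its crossed product\<close>

lemma finsum_single:
  assumes "abelian_monoid G" "finite B" "i \<in> B" "f i \<in> carrier G" "\<And>j. j \<in> B \<Longrightarrow> j \<noteq> i \<Longrightarrow> f j = \<zero>\<^bsub>G\<^esub>"
  shows "finsum G f B = f i"
proof -
  interpret abelian_monoid G by (rule assms)
  have "finsum G f B = finsum G f {i}"
    by (rule add.finprod_mono_neutral_cong_right) (use assms in \<open>auto, metis zero_closed\<close>)
  then show ?thesis using assms(4) by simp
qed

locale object_crossed_product = algebraic_closure_of A K for A (structure) and K +
  fixes L and \<beta>
  assumes subfield_L: "subfield L A" and K_L: "K \<subseteq> L" and cocycle: "crossed_cocycle A K L \<beta>"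
begin

abbreviation "\<G> \<equiv> arrows A K L"
abbreviation "\<I> \<equiv> conjugates A K L"

lemma L_conjugate: "L \<in> \<I>"
  unfolding conjugates_eq[OF subfield_L K_L] using id_closure_auts by (metis image_eqI image_id id_apply)

lemma conjugate_subfield: "i \<in> \<I> \<Longrightarrow> subfield i A"
  unfolding conjugates_eq[OF subfield_L K_L]
  using ring_hom_ring.img_is_subfield(2)[OF closure_autsD(1) subfield_L one_not_zero] by auto

lemma conjugate_carrier: "\<lbrakk>i \<in> \<I>; x \<in> i\<rbrakk> \<Longrightarrow> x \<in> carrier A"
  using subfieldE(3)[OF conjugate_subfield] by blast

section \<open>Groupoid laws for arrows\<close>

lemma arrowE:
  assumes "s \<in> \<G>"
  obtains g j where "s = Arrow (g ` j) (restrict g j) j" "g \<in> closure_auts" "j \<in> \<I>"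
  using assms unfolding arrows_eq[OF subfield_L K_L] by blast

lemma arrowI: "\<lbrakk>g \<in> closure_auts; j \<in> \<I>\<rbrakk> \<Longrightarrow> Arrow (g ` j) (restrict g j) j \<in> \<G>"
  unfolding arrows_eq[OF subfield_L K_L] by blast

lemma src_conjugate [simp, intro]: "s \<in> \<G> \<Longrightarrow> src s \<in> \<I>"
  by (erule arrowE) simp

lemma tgt_conjugate [simp, intro]: "s \<in> \<G> \<Longrightarrow> tgt s \<in> \<I>"
  unfolding arrows_def by auto

lemma act_closed: "\<lbrakk>s \<in> \<G>; x \<in> src s\<rbrakk> \<Longrightarrow> act s x \<in> tgt s"
  by (erule arrowE) auto

lemma act_carrier: "\<lbrakk>s \<in> \<G>; x \<in> src s\<rbrakk> \<Longrightarrow> act s x \<in> carrier A"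
  using act_closed conjugate_carrier tgt_conjugate by blast

lemma conjugate_props:
  assumes "i \<in> \<I>"
  shows "\<zero> \<in> i" "\<one> \<in> i" "x \<in> i \<Longrightarrow> \<ominus> x \<in> i" "\<lbrakk>x \<in> i; y \<in> i\<rbrakk> \<Longrightarrow> x \<otimes> y \<in> i"
    "\<lbrakk>x \<in> i; y \<in> i\<rbrakk> \<Longrightarrow> x \<oplus> y \<in> i" "\<lbrakk>x \<in> i; x \<noteq> \<zero>\<rbrakk> \<Longrightarrow> inv x \<in> i"
  using subringE(2,3,5-7)[OF subfieldE(1)[OF conjugate_subfield[OF assms]]]
    subfield_m_inv(1)[OF conjugate_subfield[OF assms], of x] by simp_all

lemma act_hom:
  assumes "s \<in> \<G>"
  shows "\<lbrakk>x \<in> src s; y \<in> src s\<rbrakk> \<Longrightarrow> act s (x \<oplus> y) = act s x \<oplus> act s y"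
    "\<lbrakk>x \<in> src s; y \<in> src s\<rbrakk> \<Longrightarrow> act s (x \<otimes> y) = act s x \<otimes> act s y"
    "act s \<one> = \<one>" "act s \<zero> = \<zero>" "\<lbrakk>x \<in> src s; act s x = \<zero>\<rbrakk> \<Longrightarrow> x = \<zero>"
proof -
  obtain g j where s: "s = Arrow (g ` j) (restrict g j) j" "g \<in> closure_auts" "j \<in> \<I>"
    using assms by (rule arrowE)
  interpret g: ring_hom_ring A A g by (rule closure_autsD[OF s(2)])
  note P = conjugate_props[OF s(3)] conjugate_carrier[OF s(3)]
  show "\<lbrakk>x \<in> src s; y \<in> src s\<rbrakk> \<Longrightarrow> act s (x \<oplus> y) = act s x \<oplus> act s y"
    "\<lbrakk>x \<in> src s; y \<in> src s\<rbrakk> \<Longrightarrow> act s (x \<otimes> y) = act s x \<otimes> act s y"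
    "act s \<one> = \<one>" "act s \<zero> = \<zero>"
    using P unfolding s(1) by auto
  assume "x \<in> src s" "act s x = \<zero>"
  then have "g x = g \<zero>" "x \<in> carrier A" using P unfolding s(1) by auto
  then show "x = \<zero>"
    using closure_autsD(2)[OF s(2)] unfolding bij_betw_def by (metis inj_onD zero_closed)
qed

lemma arrow_eqI:
  assumes "s \<in> \<G>" "t \<in> \<G>" "src s = src t" "tgt s = tgt t" "\<And>x. x \<in> src s \<Longrightarrow> act s x = act t x"
  shows "s = t"
proof -
  have "act s \<in> extensional (src s)" "act t \<in> extensional (src t)"
    using assms(1,2) by (auto elim!: arrowE)
  then have "act s = act t" using assms(3,5) by (metis extensionalityI)
  then show ?thesis using assms(3,4) by (simp add: arrow.expand)
qed

lemma id_arrow_sel [simp]: "src (id_arrow i) = i" "tgt (id_arrow i) = i"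
  by (simp_all add: id_arrow_def)

lemma act_id_arrow [simp]: "x \<in> i \<Longrightarrow> act (id_arrow i) x = x"
  by (simp add: id_arrow_def)

lemma id_arrow_mem [simp, intro]: "i \<in> \<I> \<Longrightarrow> id_arrow i \<in> \<G>"
  using arrowI[OF id_closure_auts, of i] by (simp add: id_arrow_def)

lemma arrow_comp_sel [simp]: "src (arrow_comp s t) = src t" "tgt (arrow_comp s t) = tgt s"
  by (simp_all add: arrow_comp_def)

lemma act_arrow_comp [simp]: "x \<in> src t \<Longrightarrow> act (arrow_comp s t) x = act s (act t x)"
  by (simp add: arrow_comp_def compose_eq)

lemma arrow_comp_mem [simp, intro]:
  assumes "s \<in> \<G>" "t \<in> \<G>" "src s = tgt t"
  shows "arrow_comp s t \<in> \<G>"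
proof -
  obtain g i where s: "s = Arrow (g ` i) (restrict g i) i" "g \<in> closure_auts" "i \<in> \<I>"
    using assms(1) by (rule arrowE)
  obtain h j where t: "t = Arrow (h ` j) (restrict h j) j" "h \<in> closure_auts" "j \<in> \<I>"
    using assms(2) by (rule arrowE)
  have "arrow_comp s t = Arrow ((g \<circ> h) ` j) (restrict (g \<circ> h) j) j"
    using assms(3) unfolding s t arrow_comp_def by (auto simp: compose_def restrict_def fun_eq_iff image_comp)
  then show ?thesis using arrowI[OF closure_auts_comp[OF s(2) t(2)] t(3)] by simp
qed

lemma arrow_comp_assoc:
  assumes "r \<in> \<G>" "s \<in> \<G>" "t \<in> \<G>" "src r = tgt s" "src s = tgt t"
  shows "arrow_comp (arrow_comp r s) t = arrow_comp r (arrow_comp s t)"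
  by (rule arrow_eqI) (use assms act_closed in auto)

lemma arrow_comp_id [simp]:
  assumes "s \<in> \<G>"
  shows "arrow_comp s (id_arrow (src s)) = s" "arrow_comp (id_arrow (tgt s)) s = s"
  by (rule arrow_eqI; use assms act_closed in auto)+

lemma ex_inverse_arrow:
  assumes "s \<in> \<G>"
  shows "\<exists>t\<in>\<G>. src t = tgt s \<and> tgt t = src s \<and>
    arrow_comp s t = id_arrow (tgt s) \<and> arrow_comp t s = id_arrow (src s)"
proof -
  obtain g j where s: "s = Arrow (g ` j) (restrict g j) j" "g \<in> closure_auts" "j \<in> \<I>"
    using assms by (rule arrowE)
  obtain h where h: "h \<in> closure_auts" "\<And>x. x \<in> carrier A \<Longrightarrow> h (g x) = x"
    using closure_auts_inv[OF s(2)] by blast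
  have hg: "h (g x) = x" if "x \<in> j" for x using h(2) conjugate_carrier[OF s(3) that] by blast
  then have hgj: "h ` g ` j = j" by force
  define t where "t = Arrow (h ` g ` j) (restrict h (g ` j)) (g ` j)"
  have gj: "g ` j \<in> \<I>" using tgt_conjugate[OF assms] unfolding s(1) by simp
  then have t: "t \<in> \<G>" unfolding t_def using arrowI[OF h(1) gj] by blast
  have e: "arrow_comp s t = id_arrow (tgt s)" "arrow_comp t s = id_arrow (src s)"
    by (rule arrow_eqI; use t assms hg hgj gj s(3) in \<open>auto simp: t_def s(1)\<close>)+
  show ?thesis
    by (rule bexI[OF _ t]) (use e hgj in \<open>simp add: t_def s(1)\<close>)
qed

definition inv_arrow :: "'a arrow \<Rightarrow> 'a arrow" where
  "inv_arrow s = (SOME t. t \<in> \<G> \<and> src t = tgt s \<and> tgt t = src s \<and>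
    arrow_comp s t = id_arrow (tgt s) \<and> arrow_comp t s = id_arrow (src s))"

lemma inv_arrow [simp]:
  assumes "s \<in> \<G>"
  shows "inv_arrow s \<in> \<G>" "src (inv_arrow s) = tgt s" "tgt (inv_arrow s) = src s"
    "arrow_comp s (inv_arrow s) = id_arrow (tgt s)" "arrow_comp (inv_arrow s) s = id_arrow (src s)"
proof -
  have "\<exists>t. t \<in> \<G> \<and> src t = tgt s \<and> tgt t = src s \<and>
      arrow_comp s t = id_arrow (tgt s) \<and> arrow_comp t s = id_arrow (src s)"
    using ex_inverse_arrow[OF assms] by blast
  from someI_ex[OF this, folded inv_arrow_def]
  show "inv_arrow s \<in> \<G>" "src (inv_arrow s) = tgt s" "tgt (inv_arrow s) = src s"
    "arrow_comp s (inv_arrow s) = id_arrow (tgt s)" "arrow_comp (inv_arrow s) s = id_arrow (src s)"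
    by auto
qed

lemma arrow_cancel:
  assumes "s \<in> \<G>" "t \<in> \<G>"
  shows "src s = tgt t \<Longrightarrow> arrow_comp (inv_arrow s) (arrow_comp s t) = t"
    "tgt s = tgt t \<Longrightarrow> arrow_comp s (arrow_comp (inv_arrow s) t) = t"
    "src t = tgt s \<Longrightarrow> arrow_comp (arrow_comp t s) (inv_arrow s) = t"
    "src t = src s \<Longrightarrow> arrow_comp (arrow_comp t (inv_arrow s)) s = t"
  using arrow_comp_assoc[of "inv_arrow s" s t] arrow_comp_assoc[of s "inv_arrow s" t]
    arrow_comp_assoc[of t s "inv_arrow s"] arrow_comp_assoc[of t "inv_arrow s" s] assms
  by (metis inv_arrow arrow_comp_id)+

lemma beta_mem:
  assumes "s \<in> \<G>" "t \<in> \<G>" "src s = tgt t"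
  shows "\<beta> s t \<in> tgt s" "\<beta> s t \<noteq> \<zero>" "\<beta> s t \<in> carrier A"
proof -
  have "(s, t) \<in> composable A K L" using assms by (simp add: composable_def)
  then show "\<beta> s t \<in> tgt s" "\<beta> s t \<noteq> \<zero>" using cocycle unfolding crossed_cocycle_def by auto
  then show "\<beta> s t \<in> carrier A" using conjugate_carrier assms(1) by blast
qed

lemma beta_id [simp]: "s \<in> \<G> \<Longrightarrow> \<beta> s (id_arrow (src s)) = \<one>" "s \<in> \<G> \<Longrightarrow> \<beta> (id_arrow (tgt s)) s = \<one>"
  using cocycle unfolding crossed_cocycle_def by auto

lemma beta_cocycle:
  assumes "r \<in> \<G>" "s \<in> \<G>" "t \<in> \<G>" "src r = tgt s" "src s = tgt t"
  shows "\<beta> r s \<otimes> \<beta> (arrow_comp r s) t = act r (\<beta> s t) \<otimes> \<beta> r (arrow_comp s t)"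
  using cocycle assms unfolding crossed_cocycle_def composable_def by auto

section \<open>The crossed product as a possibly non-unital ring\<close>

abbreviation "R \<equiv> crossed_product A K L \<beta>"
abbreviation "umon \<equiv> crossed_monom A"

lemma R_sel [simp]:
  "\<zero>\<^bsub>R\<^esub> = (\<lambda>_. \<zero>)" "a \<oplus>\<^bsub>R\<^esub> b = (\<lambda>s. a s \<oplus> b s)"
  "\<one>\<^bsub>R\<^esub> = (\<lambda>s. if s \<in> id_arrow ` \<I> then \<one> else \<zero>)"
  by (simp_all add: crossed_product_def)

lemma R_mult: "(a \<otimes>\<^bsub>R\<^esub> b) k = finsum A (\<lambda>(s, t). a s \<otimes> act s (b t) \<otimes> \<beta> s t)
    {(s, t) \<in> composable A K L. a s \<noteq> \<zero> \<and> b t \<noteq> \<zero> \<and> arrow_comp s t = k}"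
  by (simp only: crossed_product_def monoid.select_convs)

lemma R_carrier:
  "a \<in> carrier R \<longleftrightarrow> (\<forall>s\<in>\<G>. a s \<in> tgt s) \<and> (\<forall>s. s \<notin> \<G> \<longrightarrow> a s = \<zero>) \<and> finite {s. a s \<noteq> \<zero>}"
  by (simp add: crossed_product_def)

lemma coeff_mem: "\<lbrakk>a \<in> carrier R; s \<in> \<G>\<rbrakk> \<Longrightarrow> a s \<in> tgt s"
  by (simp add: R_carrier)

lemma coeff_carrier [simp]: "a \<in> carrier R \<Longrightarrow> a s \<in> carrier A"
  unfolding R_carrier using conjugate_carrier tgt_conjugate by (cases "s \<in> \<G>") auto

lemma support_finite [simp]: "a \<in> carrier R \<Longrightarrow> finite {s. a s \<noteq> \<zero>}"
  by (simp add: R_carrier)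

lemma support_arrows: "a \<in> carrier R \<Longrightarrow> {s. a s \<noteq> \<zero>} \<subseteq> \<G>"
  unfolding R_carrier by blast

lemma conjugate_finsum:
  assumes "i \<in> \<I>" "\<And>s. s \<in> F \<Longrightarrow> f s \<in> i"
  shows "finsum A f F \<in> i"
  using assms(2)
proof (induction F rule: infinite_finite_induct)
  case (insert s F)
  then have "f \<in> F \<rightarrow> carrier A" "f s \<in> carrier A"
    using conjugate_carrier[OF assms(1)] by blast+
  with insert show ?case by (simp add: conjugate_props[OF assms(1)])
qed (use conjugate_props[OF assms(1)] in \<open>auto simp: finsum_infinite\<close>)

text \<open>The contribution of \<open>s\<close> to the coefficient at \<open>k\<close>. Once the
  left arrow is \<open>s\<close>, the right one must be \<open>s\<^sup>-\<^sup>1 k\<close>, so the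
  sum over composable pairs becomes a sum over single arrows.\<close>

definition mult_term :: "('a arrow \<Rightarrow> 'a) \<Rightarrow> ('a arrow \<Rightarrow> 'a) \<Rightarrow> 'a arrow \<Rightarrow> 'a arrow \<Rightarrow> 'a" where
  "mult_term a b k s =
    a s \<otimes> act s (b (arrow_comp (inv_arrow s) k)) \<otimes> \<beta> s (arrow_comp (inv_arrow s) k)"

lemma mult_term_mem:
  assumes "a \<in> carrier R" "b \<in> carrier R" "k \<in> \<G>" "s \<in> \<G>" "tgt s = tgt k"
  shows "mult_term a b k s \<in> tgt k"
  unfolding mult_term_def assms(5)[symmetric]
  by (intro conjugate_props coeff_mem act_closed beta_mem tgt_conjugate)
    (use assms coeff_mem[OF assms(2), of "arrow_comp (inv_arrow s) k"] in auto)

text \<open>Arrows of \<open>F\<close> outside the support of \<open>a\<close> contribute zero. The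
  freedom in \<open>F\<close> allows products with different left factors to be expanded over one
  index set, as distributivity requires.\<close>

lemma mult_coeff:
  assumes a: "a \<in> carrier R" and b: "b \<in> carrier R"
    and F: "finite F" "{s. a s \<noteq> \<zero>} \<subseteq> F" "F \<subseteq> \<G>" and k: "k \<in> \<G>"
  shows "(a \<otimes>\<^bsub>R\<^esub> b) k = (\<Oplus>s\<in>{s \<in> F. tgt s = tgt k}. mult_term a b k s)"
proof -
  define Q where "Q = {(s, t) \<in> composable A K L. a s \<noteq> \<zero> \<and> b t \<noteq> \<zero> \<and> arrow_comp s t = k}"
  define P where "P = {s \<in> F. tgt s = tgt k \<and> a s \<noteq> \<zero> \<and> b (arrow_comp (inv_arrow s) k) \<noteq> \<zero>}"
  define q where "q = (\<lambda>s. (s, arrow_comp (inv_arrow s) k))"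
  have Q: "Q = q ` P"
  proof (intro subset_antisym subsetI)
    fix p assume "p \<in> Q"
    then obtain s t where p: "p = (s, t)" "s \<in> \<G>" "t \<in> \<G>" "src s = tgt t" "a s \<noteq> \<zero>" "b t \<noteq> \<zero>"
      "arrow_comp s t = k" unfolding Q_def composable_def by auto
    then have "arrow_comp (inv_arrow s) k = t" "tgt s = tgt k" using arrow_cancel(1)[of s t] by auto
    then show "p \<in> q ` P" using p F(2) unfolding q_def P_def by auto
  next
    fix p assume "p \<in> q ` P"
    then show "p \<in> Q"
      using F(3) k arrow_cancel(2) unfolding q_def P_def Q_def composable_def by auto
  qed
  have mem: "mult_term a b k s \<in> carrier A" if "s \<in> F" "tgt s = tgt k" for s
    using mult_term_mem[OF a b k, of s] that F(3) conjugate_carrier k by blast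
  have "(a \<otimes>\<^bsub>R\<^esub> b) k = finsum A (\<lambda>(s, t). a s \<otimes> act s (b t) \<otimes> \<beta> s t) (q ` P)"
    unfolding Q[symmetric] Q_def by (rule R_mult)
  also have "\<dots> = finsum A (mult_term a b k) P"
  proof (subst add.finprod_reindex)
    show "inj_on q P" by (auto simp: inj_on_def q_def)
    show "finsum A (\<lambda>x. case q x of (s, t) \<Rightarrow> a s \<otimes> act s (b t) \<otimes> \<beta> s t) P = finsum A (mult_term a b k) P"
      unfolding q_def mult_term_def by simp
    show "(\<lambda>(s, t). a s \<otimes> act s (b t) \<otimes> \<beta> s t) \<in> q ` P \<rightarrow> carrier A"
      using mem unfolding q_def mult_term_def P_def by auto
  qed
  also have "\<dots> = finsum A (mult_term a b k) {s \<in> F. tgt s = tgt k}"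
  proof (rule add.finprod_mono_neutral_cong_left)
    fix s assume "s \<in> {s \<in> F. tgt s = tgt k} - P"
    then have s: "s \<in> \<G>" "tgt s = tgt k" "a s = \<zero> \<or> b (arrow_comp (inv_arrow s) k) = \<zero>"
      using F(3) unfolding P_def by auto
    have "act s (b (arrow_comp (inv_arrow s) k)) \<in> carrier A"
      using act_carrier[OF s(1)] coeff_mem[OF b, of "arrow_comp (inv_arrow s) k"] s k by simp
    then show "mult_term a b k s = \<zero>"
      using s a k beta_mem(3)[OF s(1), of "arrow_comp (inv_arrow s) k"] act_hom(4)[OF s(1)]
      unfolding mult_term_def by auto
  qed (use F mem in \<open>auto simp: P_def\<close>)
  finally show ?thesis .
qed

lemma mult_coeff_outside:
  assumes "k \<notin> \<G>" shows "(a \<otimes>\<^bsub>R\<^esub> b) k = \<zero>"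
proof -
  have "{(s, t) \<in> composable A K L. a s \<noteq> \<zero> \<and> b t \<noteq> \<zero> \<and> arrow_comp s t = k} = {}"
    using assms unfolding composable_def by auto
  then show ?thesis by (simp only: R_mult add.finprod_empty)
qed

lemma R_mult_closed:
  assumes "a \<in> carrier R" "b \<in> carrier R"
  shows "a \<otimes>\<^bsub>R\<^esub> b \<in> carrier R"
  unfolding R_carrier
proof (intro conjI allI impI ballI mult_coeff_outside)
  note F = support_finite[OF assms(1)] subset_refl support_arrows[OF assms(1)]
  show "(a \<otimes>\<^bsub>R\<^esub> b) k \<in> tgt k" if "k \<in> \<G>" for k
    unfolding mult_coeff[OF assms F that]
    by (rule conjugate_finsum) (use that mult_term_mem[OF assms that] F(3) in auto)
  have "{k. (a \<otimes>\<^bsub>R\<^esub> b) k \<noteq> \<zero>} \<subseteq> (\<lambda>(s, t). arrow_comp s t) ` ({s. a s \<noteq> \<zero>} \<times> {s. b s \<noteq> \<zero>})"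
  proof
    fix k assume "k \<in> {k. (a \<otimes>\<^bsub>R\<^esub> b) k \<noteq> \<zero>}"
    then have "{(s, t) \<in> composable A K L. a s \<noteq> \<zero> \<and> b t \<noteq> \<zero> \<and> arrow_comp s t = k} \<noteq> {}"
      unfolding mem_Collect_eq R_mult by (metis finsum_empty)
    then show "k \<in> (\<lambda>(s, t). arrow_comp s t) ` ({s. a s \<noteq> \<zero>} \<times> {s. b s \<noteq> \<zero>})" by auto
  qed
  then show "finite {k. (a \<otimes>\<^bsub>R\<^esub> b) k \<noteq> \<zero>}"
    by (rule finite_subset) (use assms in auto)
qed

lemma R_add_closed:
  assumes "a \<in> carrier R" "b \<in> carrier R"
  shows "(\<lambda>s. a s \<oplus> b s) \<in> carrier R"
proof -
  have "{s. a s \<oplus> b s \<noteq> \<zero>} \<subseteq> {s. a s \<noteq> \<zero>} \<union> {s. b s \<noteq> \<zero>}" by auto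
  then have "finite {s. a s \<oplus> b s \<noteq> \<zero>}" by (rule finite_subset) (use assms in simp)
  then show ?thesis using assms conjugate_props(5) by (simp add: R_carrier)
qed

lemma R_abelian_group: "abelian_group R"
proof (rule abelian_groupI)
  fix a assume a: "a \<in> carrier R"
  show "\<exists>b\<in>carrier R. b \<oplus>\<^bsub>R\<^esub> a = \<zero>\<^bsub>R\<^esub>"
  proof
    have "{s. \<ominus> a s \<noteq> \<zero>} \<subseteq> {s. a s \<noteq> \<zero>}" by auto
    then have "finite {s. \<ominus> a s \<noteq> \<zero>}" by (rule finite_subset) (use a in simp)
    then show "(\<lambda>s. \<ominus> a s) \<in> carrier R"
      using a conjugate_props(3)[OF tgt_conjugate] unfolding R_carrier by simp
  qed (use a in \<open>simp add: l_neg\<close>)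
qed (use conjugate_props(1) in \<open>auto simp: R_add_closed R_carrier[of "\<lambda>_. \<zero>"] a_ac\<close>)

lemma mult_term_add:
  assumes "a \<in> carrier R" "b \<in> carrier R" "c \<in> carrier R" "k \<in> \<G>" "s \<in> \<G>" "tgt s = tgt k"
  shows "mult_term (\<lambda>s. a s \<oplus> b s) c k s = mult_term a c k s \<oplus> mult_term b c k s"
    "mult_term c (\<lambda>s. a s \<oplus> b s) k s = mult_term c a k s \<oplus> mult_term c b k s"
proof -
  let ?t = "arrow_comp (inv_arrow s) k"
  have t: "?t \<in> \<G>" "tgt ?t = src s" using assms by auto
  have m: "a ?t \<in> src s" "b ?t \<in> src s" "c ?t \<in> src s"
    using coeff_mem[OF _ t(1)] assms(1-3) unfolding t(2) by auto
  note cl = act_carrier[OF assms(5)] beta_mem(3)[OF assms(5) t(1) t(2)[symmetric]]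
  show "mult_term (\<lambda>s. a s \<oplus> b s) c k s = mult_term a c k s \<oplus> mult_term b c k s"
    "mult_term c (\<lambda>s. a s \<oplus> b s) k s = mult_term c a k s \<oplus> mult_term c b k s"
    using m cl assms by (simp_all add: mult_term_def act_hom l_distr r_distr)
qed

lemma R_distr:
  assumes a: "a \<in> carrier R" and b: "b \<in> carrier R" and c: "c \<in> carrier R"
  shows "(\<lambda>s. a s \<oplus> b s) \<otimes>\<^bsub>R\<^esub> c = (\<lambda>s. (a \<otimes>\<^bsub>R\<^esub> c) s \<oplus> (b \<otimes>\<^bsub>R\<^esub> c) s)"
    "c \<otimes>\<^bsub>R\<^esub> (\<lambda>s. a s \<oplus> b s) = (\<lambda>s. (c \<otimes>\<^bsub>R\<^esub> a) s \<oplus> (c \<otimes>\<^bsub>R\<^esub> b) s)"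
proof -
  define F where "F = {s. a s \<noteq> \<zero>} \<union> {s. b s \<noteq> \<zero>} \<union> {s. c s \<noteq> \<zero>}"
  have F: "finite F" "F \<subseteq> \<G>" "{s. a s \<noteq> \<zero>} \<subseteq> F" "{s. b s \<noteq> \<zero>} \<subseteq> F" "{s. c s \<noteq> \<zero>} \<subseteq> F"
    "{s. a s \<oplus> b s \<noteq> \<zero>} \<subseteq> F"
    using a b c support_arrows unfolding F_def by auto
  have mem: "mult_term x y k s \<in> carrier A"
    if "x \<in> carrier R" "y \<in> carrier R" "k \<in> \<G>" "s \<in> {s \<in> F. tgt s = tgt k}" for x y k s
    using mult_term_mem[OF that(1-3), of s] that F(2) conjugate_carrier by blast
  note ab = R_add_closed[OF a b]
  show "(\<lambda>s. a s \<oplus> b s) \<otimes>\<^bsub>R\<^esub> c = (\<lambda>s. (a \<otimes>\<^bsub>R\<^esub> c) s \<oplus> (b \<otimes>\<^bsub>R\<^esub> c) s)"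
  proof
    fix k
    show "((\<lambda>s. a s \<oplus> b s) \<otimes>\<^bsub>R\<^esub> c) k = (a \<otimes>\<^bsub>R\<^esub> c) k \<oplus> (b \<otimes>\<^bsub>R\<^esub> c) k"
    proof (cases "k \<in> \<G>")
      case True
      have "((\<lambda>s. a s \<oplus> b s) \<otimes>\<^bsub>R\<^esub> c) k =
          (\<Oplus>s\<in>{s \<in> F. tgt s = tgt k}. mult_term a c k s \<oplus> mult_term b c k s)"
        unfolding mult_coeff[OF ab c F(1,6,2) True]
        by (rule finsum_cong') (use mult_term_add(1)[OF a b c True] F(2) mem[OF a c True] mem[OF b c True] in auto)
      also have "\<dots> = (a \<otimes>\<^bsub>R\<^esub> c) k \<oplus> (b \<otimes>\<^bsub>R\<^esub> c) k"
        unfolding mult_coeff[OF a c F(1,3,2) True] mult_coeff[OF b c F(1,4,2) True]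
        by (rule finsum_addf) (use mem a b c True in auto)
      finally show ?thesis .
    qed (simp add: mult_coeff_outside)
  qed
  show "c \<otimes>\<^bsub>R\<^esub> (\<lambda>s. a s \<oplus> b s) = (\<lambda>s. (c \<otimes>\<^bsub>R\<^esub> a) s \<oplus> (c \<otimes>\<^bsub>R\<^esub> b) s)"
  proof
    fix k
    show "(c \<otimes>\<^bsub>R\<^esub> (\<lambda>s. a s \<oplus> b s)) k = (c \<otimes>\<^bsub>R\<^esub> a) k \<oplus> (c \<otimes>\<^bsub>R\<^esub> b) k"
    proof (cases "k \<in> \<G>")
      case True
      have "(c \<otimes>\<^bsub>R\<^esub> (\<lambda>s. a s \<oplus> b s)) k =
          (\<Oplus>s\<in>{s \<in> F. tgt s = tgt k}. mult_term c a k s \<oplus> mult_term c b k s)"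
        unfolding mult_coeff[OF c ab F(1,5,2) True]
        by (rule finsum_cong') (use mult_term_add(2)[OF a b c True] F(2) mem[OF c a True] mem[OF c b True] in auto)
      also have "\<dots> = (c \<otimes>\<^bsub>R\<^esub> a) k \<oplus> (c \<otimes>\<^bsub>R\<^esub> b) k"
        unfolding mult_coeff[OF c a F(1,5,2) True] mult_coeff[OF c b F(1,5,2) True]
        by (rule finsum_addf) (use mem a b c True in auto)
      finally show ?thesis .
    qed (simp add: mult_coeff_outside)
  qed
qed

lemma mon_mem [simp, intro]: "\<lbrakk>s \<in> \<G>; x \<in> tgt s\<rbrakk> \<Longrightarrow> umon x s \<in> carrier R"
  using conjugate_props(1) unfolding R_carrier crossed_monom_def by auto

lemma mon_add:
  "\<lbrakk>x \<in> carrier A; y \<in> carrier A\<rbrakk> \<Longrightarrow> umon (x \<oplus> y) s = (\<lambda>r. umon x s r \<oplus> umon y s r)"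
  by (auto simp: crossed_monom_def)

lemma mon_mult:
  assumes "s \<in> \<G>" "t \<in> \<G>" "x \<in> tgt s" "y \<in> tgt t"
  shows "src s = tgt t \<Longrightarrow> umon x s \<otimes>\<^bsub>R\<^esub> umon y t = umon (x \<otimes> act s y \<otimes> \<beta> s t) (arrow_comp s t)"
    "src s \<noteq> tgt t \<Longrightarrow> umon x s \<otimes>\<^bsub>R\<^esub> umon y t = (\<lambda>_. \<zero>)"
proof -
  note m = mon_mem[OF assms(1,3)] mon_mem[OF assms(2,4)]
  have F: "finite {s}" "{r. umon x s r \<noteq> \<zero>} \<subseteq> {s}" "{s} \<subseteq> \<G>"
    using assms(1) by (auto simp: crossed_monom_def)
  have xc: "x \<in> carrier A" using conjugate_carrier[OF tgt_conjugate] assms(1,3) by blast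
  have coeff: "(umon x s \<otimes>\<^bsub>R\<^esub> umon y t) k = (if tgt s = tgt k \<and> arrow_comp (inv_arrow s) k = t
      then x \<otimes> act s y \<otimes> \<beta> s t else \<zero>)" if k: "k \<in> \<G>" for k
  proof (cases "tgt s = tgt k")
    case True
    then have t': "arrow_comp (inv_arrow s) k \<in> \<G>" "src s = tgt (arrow_comp (inv_arrow s) k)"
      using assms(1) k by auto
    have "mult_term (umon x s) (umon y t) k s \<in> carrier A"
      using mult_term_mem[OF m k assms(1) True] conjugate_carrier k by blast
    moreover have "{r \<in> {s}. tgt r = tgt k} = {s}" using True by auto
    ultimately have "(umon x s \<otimes>\<^bsub>R\<^esub> umon y t) k = mult_term (umon x s) (umon y t) k s"
      using mult_coeff[OF m F k] by simp
    also have "\<dots> = (if arrow_comp (inv_arrow s) k = t then x \<otimes> act s y \<otimes> \<beta> s t else \<zero>)"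
      using act_hom(4)[OF assms(1)] beta_mem(3)[OF assms(1) t'] xc
      unfolding mult_term_def crossed_monom_def by auto
    finally show ?thesis using True by simp
  next
    case False
    then have e: "{r \<in> {s}. tgt r = tgt k} = {}" by auto
    show ?thesis unfolding mult_coeff[OF m F k] e using False by simp
  qed
  show "umon x s \<otimes>\<^bsub>R\<^esub> umon y t = umon (x \<otimes> act s y \<otimes> \<beta> s t) (arrow_comp s t)" if st: "src s = tgt t"
  proof
    fix k
    show "(umon x s \<otimes>\<^bsub>R\<^esub> umon y t) k = umon (x \<otimes> act s y \<otimes> \<beta> s t) (arrow_comp s t) k"
    proof (cases "k \<in> \<G>")
      case True
      have "tgt s = tgt k \<and> arrow_comp (inv_arrow s) k = t \<longleftrightarrow> k = arrow_comp s t"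
        using arrow_cancel[OF assms(1)] assms(2) True st by (metis arrow_comp_sel(2))
      then show ?thesis unfolding coeff[OF True] by (simp add: crossed_monom_def)
    next
      case False
      then show ?thesis
        using assms(1,2) st unfolding mult_coeff_outside[OF False] crossed_monom_def by auto
    qed
  qed
  show "umon x s \<otimes>\<^bsub>R\<^esub> umon y t = (\<lambda>_. \<zero>)" if st: "src s \<noteq> tgt t"
  proof
    fix k
    show "(umon x s \<otimes>\<^bsub>R\<^esub> umon y t) k = \<zero>"
    proof (cases "k \<in> \<G>")
      case True
      then show ?thesis unfolding coeff[OF True] using st assms(1) by auto
    qed (rule mult_coeff_outside)
  qed
qed

text \<open>Removes one arrow from the support at a time. Additive statements about \<open>R\<close>
  are thereby reduced to monomials, where the cocycle laws apply directly.\<close>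

lemma R_induct [consumes 1, case_names zero mon add]:
  assumes a: "a \<in> carrier R" and zero: "P (\<lambda>_. \<zero>)"
    and mon: "\<And>s x. \<lbrakk>s \<in> \<G>; x \<in> tgt s\<rbrakk> \<Longrightarrow> P (umon x s)"
    and add: "\<And>a b. \<lbrakk>a \<in> carrier R; b \<in> carrier R; P a; P b\<rbrakk> \<Longrightarrow> P (\<lambda>s. a s \<oplus> b s)"
  shows "P a"
proof -
  have "P a" if "finite F" "a \<in> carrier R" "{s. a s \<noteq> \<zero>} = F" for F a
    using that
  proof (induction F arbitrary: a rule: finite_induct)
    case empty
    then have "a = (\<lambda>_. \<zero>)" by auto
    then show ?case using zero by simp
  next
    case (insert s F)
    define b where "b = a(s := \<zero>)"
    have b: "{r. b r \<noteq> \<zero>} = F" using insert unfolding b_def by auto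
    have s: "s \<in> \<G>" using insert.prems support_arrows by blast
    have "b \<in> carrier R"
      using insert.prems(1) insert.hyps(1) b conjugate_props(1) unfolding R_carrier b
      by (auto simp: b_def)
    moreover from this have "P b" using insert.IH b by blast
    moreover have "umon (a s) s \<in> carrier R" "P (umon (a s) s)"
      using s mon coeff_mem insert.prems(1) by auto
    moreover have "a = (\<lambda>r. umon (a s) s r \<oplus> b r)"
      using insert.prems(1) unfolding b_def crossed_monom_def by (auto simp: fun_eq_iff)
    ultimately show ?case using add by metis
  qed
  then show ?thesis using a support_finite by blast
qed

lemma R_zero_mult: "a \<in> carrier R \<Longrightarrow> (\<lambda>_. \<zero>) \<otimes>\<^bsub>R\<^esub> a = (\<lambda>_. \<zero>)" "a \<in> carrier R \<Longrightarrow> a \<otimes>\<^bsub>R\<^esub> (\<lambda>_. \<zero>) = (\<lambda>_. \<zero>)"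
  by (simp_all add: fun_eq_iff R_mult)

text \<open>When both pairs compose, this is the cocycle identity together with multiplicativity of
  the action of \<open>r\<close>. Otherwise both bracketings vanish, since a composite keeps the
  source of its right factor and the target of its left one.\<close>

lemma mon_assoc:
  assumes "r \<in> \<G>" "s \<in> \<G>" "t \<in> \<G>" "x \<in> tgt r" "y \<in> tgt s" "z \<in> tgt t"
  shows "(umon x r \<otimes>\<^bsub>R\<^esub> umon y s) \<otimes>\<^bsub>R\<^esub> umon z t = umon x r \<otimes>\<^bsub>R\<^esub> (umon y s \<otimes>\<^bsub>R\<^esub> umon z t)"
proof -
  have xy: "x \<otimes> act r y \<otimes> \<beta> r s \<in> tgt r" if "src r = tgt s"
    using assms that beta_mem(1)[OF assms(1,2) that] conjugate_props(4)[OF tgt_conjugate] act_closed by simp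
  have yz: "y \<otimes> act s z \<otimes> \<beta> s t \<in> tgt s" if "src s = tgt t"
    using assms that beta_mem(1)[OF assms(2,3) that] conjugate_props(4)[OF tgt_conjugate] act_closed by simp
  show ?thesis
  proof (cases "src r = tgt s \<and> src s = tgt t")
    case True
    then have rs: "src r = tgt s" and st: "src s = tgt t" by auto
    have az: "act s z \<in> src r" "\<beta> s t \<in> src r" "y \<in> src r" "z \<in> src s"
      using act_closed[OF assms(2)] beta_mem(1)[OF assms(2,3) st] assms rs st by auto
    have c: "x \<in> carrier A" "act r y \<in> carrier A" "act r (act s z) \<in> carrier A" "act r (\<beta> s t) \<in> carrier A"
      "\<beta> r s \<in> carrier A" "\<beta> (arrow_comp r s) t \<in> carrier A" "\<beta> r (arrow_comp s t) \<in> carrier A"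
      using az act_carrier[OF assms(1)] conjugate_carrier[OF tgt_conjugate[OF assms(1)] assms(4)]
        beta_mem(3) rs st assms by auto
    have "x \<otimes> act r y \<otimes> \<beta> r s \<otimes> act r (act s z) \<otimes> \<beta> (arrow_comp r s) t =
        x \<otimes> act r y \<otimes> act r (act s z) \<otimes> (\<beta> r s \<otimes> \<beta> (arrow_comp r s) t)"
      using c by (simp add: m_ac)
    also have "\<dots> = x \<otimes> (act r y \<otimes> act r (act s z) \<otimes> act r (\<beta> s t)) \<otimes> \<beta> r (arrow_comp s t)"
      unfolding beta_cocycle[OF assms(1-3) rs st] using c by (simp add: m_ac)
    also have "act r y \<otimes> act r (act s z) \<otimes> act r (\<beta> s t) = act r (y \<otimes> act s z \<otimes> \<beta> s t)"
      using az conjugate_props(4)[OF src_conjugate[OF assms(1)]] by (simp add: act_hom[OF assms(1)])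
    finally have "x \<otimes> act r y \<otimes> \<beta> r s \<otimes> act r (act s z) \<otimes> \<beta> (arrow_comp r s) t =
      x \<otimes> act r (y \<otimes> act s z \<otimes> \<beta> s t) \<otimes> \<beta> r (arrow_comp s t)" .
    then show ?thesis
      using assms rs st xy[OF rs] yz[OF st] az(4) by (simp add: mon_mult arrow_comp_assoc)
  next
    case False
    note m = mon_mem[OF assms(1,4)] mon_mem[OF assms(3,6)]
    have l: "(umon x r \<otimes>\<^bsub>R\<^esub> umon y s) \<otimes>\<^bsub>R\<^esub> umon z t = (\<lambda>_. \<zero>)"
    proof (cases "src r = tgt s")
      case True
      with False have "src (arrow_comp r s) \<noteq> tgt t" by simp
      moreover have "x \<otimes> act r y \<otimes> \<beta> r s \<in> tgt (arrow_comp r s)" using xy[OF True] by simp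
      ultimately show ?thesis
        unfolding mon_mult(1)[OF assms(1,2,4,5) True]
        using mon_mult(2)[OF arrow_comp_mem[OF assms(1,2) True] assms(3)] assms(6) by blast
    next
      case False
      show ?thesis
        unfolding mon_mult(2)[OF assms(1,2,4,5) False] by (rule R_zero_mult(1)[OF m(2)])
    qed
    have r: "umon x r \<otimes>\<^bsub>R\<^esub> (umon y s \<otimes>\<^bsub>R\<^esub> umon z t) = (\<lambda>_. \<zero>)"
    proof (cases "src s = tgt t")
      case True
      with False have "src r \<noteq> tgt (arrow_comp s t)" by simp
      moreover have "y \<otimes> act s z \<otimes> \<beta> s t \<in> tgt (arrow_comp s t)" using yz[OF True] by simp
      ultimately show ?thesis
        unfolding mon_mult(1)[OF assms(2,3,5,6) True]
        using mon_mult(2)[OF assms(1) arrow_comp_mem[OF assms(2,3) True]] assms(4) by blast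
    next
      case False
      show ?thesis
        unfolding mon_mult(2)[OF assms(2,3,5,6) False] by (rule R_zero_mult(2)[OF m(1)])
    qed
    show ?thesis unfolding l r ..
  qed
qed

text \<open>The monomial case is extended by distributivity in one argument at a time, beginning
  with the last.\<close>

lemma R_assoc:
  assumes a: "a \<in> carrier R" and b: "b \<in> carrier R" and c: "c \<in> carrier R"
  shows "(a \<otimes>\<^bsub>R\<^esub> b) \<otimes>\<^bsub>R\<^esub> c = a \<otimes>\<^bsub>R\<^esub> (b \<otimes>\<^bsub>R\<^esub> c)"
proof -
  have 1: "(umon x r \<otimes>\<^bsub>R\<^esub> umon y s) \<otimes>\<^bsub>R\<^esub> c = umon x r \<otimes>\<^bsub>R\<^esub> (umon y s \<otimes>\<^bsub>R\<^esub> c)"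
    if rs: "r \<in> \<G>" "s \<in> \<G>" "x \<in> tgt r" "y \<in> tgt s" for x y r s
    using c
  proof (induction c rule: R_induct)
    case (add c d)
    then show ?case using rs by (simp add: R_distr R_mult_closed)
  qed (use rs in \<open>auto simp: mon_assoc R_zero_mult R_mult_closed\<close>)
  have 2: "(umon x r \<otimes>\<^bsub>R\<^esub> b) \<otimes>\<^bsub>R\<^esub> c = umon x r \<otimes>\<^bsub>R\<^esub> (b \<otimes>\<^bsub>R\<^esub> c)"
    if r: "r \<in> \<G>" "x \<in> tgt r" for x r
    using b
  proof (induction b rule: R_induct)
    case (add b d)
    then show ?case using r c by (simp add: R_distr R_mult_closed)
  qed (use r c in \<open>auto simp: 1 R_zero_mult R_mult_closed\<close>)
  show ?thesis
    using a
  proof (induction a rule: R_induct)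
    case (add a d)
    then show ?case using b c by (simp add: R_distr R_mult_closed)
  qed (use b c in \<open>auto simp: 2 R_zero_mult R_mult_closed\<close>)
qed

abbreviation "R0 \<equiv> crossed_product_0 A K L \<beta>"

lemma R_nonunital_ring: "nonunital_ring_over R R0"
proof -
  interpret R: abelian_group R by (rule R_abelian_group)
  show ?thesis
    by unfold_locales
      (auto simp: R_mult_closed R_assoc R_distr crossed_product_0_def)
qed

end

section \<open>Separability forces finitely many automorphisms\<close>

text \<open>\<open>B\<close> is a parameter so that \<open>z\<close> can be tested on its own keys:
  then only the pairs that occur in \<open>z\<close> have to be checked.\<close>

lemma free_Abelian_group_hom_eq:
  assumes "h \<in> hom (free_Abelian_group B) G" "h' \<in> hom (free_Abelian_group B) G" "group G"
    and "\<And>x. x \<in> B \<Longrightarrow> h (frag_of x) = h' (frag_of x)" and z: "Poly_Mapping.keys z \<subseteq> B"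
  shows "h z = h' z"
proof -
  interpret G: group G by (rule assms(3))
  interpret h: group_hom "free_Abelian_group B" G h
    using assms(1,3) by (simp add: group_hom_def group_hom_axioms_def)
  interpret h': group_hom "free_Abelian_group B" G h'
    using assms(2,3) by (simp add: group_hom_def group_hom_axioms_def)
  show ?thesis
  proof (rule free_Abelian_group_induct[OF z])
    show "h 0 = h' 0" using h.hom_one h'.hom_one by simp
  next
    fix x y :: "'a \<Rightarrow>\<^sub>0 int"
    assume k: "Poly_Mapping.keys x \<subseteq> B" "Poly_Mapping.keys y \<subseteq> B" and eq: "h x = h' x" "h y = h' y"
    have "x - y = x + - y" by simp
    then show "h (x - y) = h' (x - y)"
      using h.hom_mult[of x "- y"] h'.hom_mult[of x "- y"] h.hom_inv[of y] h'.hom_inv[of y] k eq by simp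
  qed (rule assms(4))
qed

context object_crossed_product
begin

interpretation RR: nonunital_ring_over R R0 by (rule R_nonunital_ring)

section \<open>Coefficients of products with monomials and with elements of degree zero\<close>

lemma left_mon_coeff:
  assumes "r \<in> \<G>" "x \<in> tgt r" "b \<in> carrier R" "s \<in> \<G>" "src r = tgt s"
  shows "(umon x r \<otimes>\<^bsub>R\<^esub> b) (arrow_comp r s) = x \<otimes> act r (b s) \<otimes> \<beta> r s"
proof -
  have F: "finite {r}" "{k. umon x r k \<noteq> \<zero>} \<subseteq> {r}" "{r} \<subseteq> \<G>"
    using assms(1) by (auto simp: crossed_monom_def)
  have k: "arrow_comp r s \<in> \<G>" using assms by simp
  have e: "{k \<in> {r}. tgt k = tgt (arrow_comp r s)} = {r}" by auto
  have "mult_term (umon x r) b (arrow_comp r s) r \<in> carrier A"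
    using mult_term_mem[OF mon_mem[OF assms(1,2)] assms(3) k assms(1)] conjugate_carrier k by force
  then show ?thesis
    unfolding mult_coeff[OF mon_mem[OF assms(1,2)] assms(3) F k] e
    using arrow_cancel(1)[OF assms(1,4,5)] by (simp add: mult_term_def crossed_monom_def)
qed

lemma right_mon_coeff:
  assumes "t \<in> \<G>" "y \<in> tgt t" "a \<in> carrier R" "r \<in> \<G>" "src r = tgt t"
  shows "(a \<otimes>\<^bsub>R\<^esub> umon y t) (arrow_comp r t) = a r \<otimes> act r y \<otimes> \<beta> r t"
proof -
  let ?k = "arrow_comp r t"
  define F where "F = insert r {s. a s \<noteq> \<zero>}"
  have F: "finite F" "{s. a s \<noteq> \<zero>} \<subseteq> F" "F \<subseteq> \<G>"
    using assms support_arrows unfolding F_def by auto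
  note m = mon_mem[OF assms(1,2)]
  have k: "?k \<in> \<G>" using assms by simp
  have mt: "mult_term a (umon y t) ?k s \<in> carrier A" if "s \<in> F" "tgt s = tgt ?k" for s
    using mult_term_mem[OF assms(3) m k, of s] that F(3) conjugate_carrier tgt_conjugate[OF k] by blast
  have sum: "(\<Oplus>s\<in>{s \<in> F. tgt s = tgt ?k}. mult_term a (umon y t) ?k s) = mult_term a (umon y t) ?k r"
  proof (rule finsum_single)
    fix s assume s: "s \<in> {s \<in> F. tgt s = tgt ?k}" "s \<noteq> r"
    then have sG: "s \<in> \<G>" "tgt s = tgt ?k" using F(3) by auto
    \<comment> \<open>Right cancellation in the groupoid: no arrow other than \<open>r\<close>
      composes with \<open>t\<close> to \<open>?k\<close>.\<close>
    have "arrow_comp (inv_arrow s) ?k \<noteq> t"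
    proof
      assume "arrow_comp (inv_arrow s) ?k = t"
      then have c: "arrow_comp s t = ?k" "src s = tgt t"
        using arrow_cancel(2)[OF sG(1) k sG(2)] arrow_comp_sel(2)[of "inv_arrow s" ?k]
          inv_arrow(3)[OF sG(1)] by auto
      have "s = r"
        using arrow_cancel(3)[OF assms(1) sG(1) c(2)] arrow_cancel(3)[OF assms(1,4,5)]
        unfolding c(1) by (rule trans[OF sym])
      with s(2) show False by simp
    qed
    then have "umon y t (arrow_comp (inv_arrow s) ?k) = \<zero>" by (simp add: crossed_monom_def)
    then show "mult_term a (umon y t) ?k s = \<zero>"
      using sG beta_mem(3)[OF sG(1), of "arrow_comp (inv_arrow s) ?k"] k assms(3) act_hom(4)[OF sG(1)]
      unfolding mult_term_def by simp
  qed (use F mt abelian_monoid_axioms in \<open>auto simp: F_def\<close>)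
  show ?thesis
    unfolding mult_coeff[OF assms(3) m F k] sum
    using arrow_cancel(1)[OF assms(4,1,5)] by (simp add: mult_term_def crossed_monom_def)
qed

lemma R0_D:
  assumes "e \<in> R0"
  shows "e \<in> carrier R" "e s \<noteq> \<zero> \<Longrightarrow> s \<in> id_arrow ` \<I>"
  using assms unfolding crossed_product_0_def by auto

text \<open>Left multiplication by \<open>R0\<close> scales each coefficient by the entry at its
  target. Right multiplication scales by the twisted entry at the source. The two meet in the middle
  of a composable pair, which balances the coordinates of the tensor square.\<close>

lemma left_R0_coeff:
  assumes e: "e \<in> R0" and b: "b \<in> carrier R" and t: "t \<in> \<G>"
  shows "(e \<otimes>\<^bsub>R\<^esub> b) t = e (id_arrow (tgt t)) \<otimes> b t"
proof -
  define F where "F = insert (id_arrow (tgt t)) {s. e s \<noteq> \<zero>}"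
  note eR = R0_D(1)[OF e]
  have F: "finite F" "{s. e s \<noteq> \<zero>} \<subseteq> F" "F \<subseteq> \<G>"
    using t eR support_arrows unfolding F_def by auto
  have "s = id_arrow (tgt t)" if "e s \<noteq> \<zero>" "tgt s = tgt t" for s
    using R0_D(2)[OF e that(1)] that(2) by auto
  then have "{s \<in> F. tgt s = tgt t} = {id_arrow (tgt t)}"
    unfolding F_def by auto
  moreover have "arrow_comp (inv_arrow (id_arrow (tgt t))) t = t"
    using arrow_cancel(1)[of "id_arrow (tgt t)" t] t by simp
  moreover have "b t \<in> tgt t" using coeff_mem b t by blast
  ultimately show ?thesis
    unfolding mult_coeff[OF eR b F t] using t b eR by (simp add: mult_term_def)
qed

lemma right_R0_coeff:
  assumes e: "e \<in> R0" and a: "a \<in> carrier R" and s: "s \<in> \<G>"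
  shows "(a \<otimes>\<^bsub>R\<^esub> e) s = a s \<otimes> act s (e (id_arrow (src s)))"
proof -
  define F where "F = insert s {s. a s \<noteq> \<zero>}"
  note eR = R0_D(1)[OF e]
  have F: "finite F" "{s. a s \<noteq> \<zero>} \<subseteq> F" "F \<subseteq> \<G>"
    using s a support_arrows unfolding F_def by auto
  have mt: "mult_term a e s r \<in> carrier A" if "r \<in> F" "tgt r = tgt s" for r
    using mult_term_mem[OF a eR s, of r] that F(3) conjugate_carrier tgt_conjugate[OF s] by blast
  have sum: "(\<Oplus>r\<in>{r \<in> F. tgt r = tgt s}. mult_term a e s r) = mult_term a e s s"
  proof (rule finsum_single)
    fix r assume r: "r \<in> {r \<in> F. tgt r = tgt s}" "r \<noteq> s"
    then have rG: "r \<in> \<G>" "tgt r = tgt s" using F(3) by auto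
    have "arrow_comp (inv_arrow r) s \<notin> id_arrow ` \<I>"
    proof
      assume "arrow_comp (inv_arrow r) s \<in> id_arrow ` \<I>"
      then obtain i where i: "arrow_comp (inv_arrow r) s = id_arrow i" by blast
      then have "src r = i" using arrow_comp_sel(2) inv_arrow(3)[OF rG(1)] id_arrow_sel(2) by metis
      then have "arrow_comp (inv_arrow r) s = id_arrow (src r)" using i by simp
      then have "s = r" using arrow_cancel(2)[OF rG(1) s rG(2)] arrow_comp_id(1)[OF rG(1)] by simp
      with r(2) show False by simp
    qed
    then have "e (arrow_comp (inv_arrow r) s) = \<zero>" using R0_D(2)[OF e] by blast
    then show "mult_term a e s r = \<zero>"
      using rG beta_mem(3)[OF rG(1), of "arrow_comp (inv_arrow r) s"] s a act_hom(4)[OF rG(1)]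
      unfolding mult_term_def by simp
  qed (use F mt abelian_monoid_axioms in \<open>auto simp: F_def\<close>)
  have "act s (e (id_arrow (src s))) \<in> carrier A"
    using act_carrier[OF s] coeff_mem[OF eR id_arrow_mem[OF src_conjugate[OF s]]] by simp
  then show ?thesis
    unfolding mult_coeff[OF a eR F s] sum using s a by (simp add: mult_term_def)
qed

text \<open>An identity arrow factors only as an arrow composed with its own inverse, so only these
  pairs of coefficients contribute.\<close>

lemma mult_id_coeff:
  assumes a: "a \<in> carrier R" and b: "b \<in> carrier R" and i: "i \<in> \<I>"
    and F: "finite F" "{s. a s \<noteq> \<zero>} \<subseteq> F" "F \<subseteq> \<G>"
  shows "(a \<otimes>\<^bsub>R\<^esub> b) (id_arrow i) =
    (\<Oplus>s\<in>{s \<in> F. tgt s = i}. a s \<otimes> act s (b (inv_arrow s)) \<otimes> \<beta> s (inv_arrow s))"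
proof -
  have "arrow_comp (inv_arrow s) (id_arrow i) = inv_arrow s" if "s \<in> F" "tgt s = i" for s
  proof -
    have "s \<in> \<G>" using that F(3) by blast
    then show ?thesis using arrow_comp_id(1)[of "inv_arrow s"] that(2) by simp
  qed
  moreover have "mult_term a b (id_arrow i) s \<in> carrier A" if "s \<in> F" "tgt s = i" for s
    using mult_term_mem[OF a b id_arrow_mem[OF i], of s] that F(3) conjugate_carrier[OF i] by auto
  ultimately show ?thesis
    unfolding mult_coeff[OF a b F id_arrow_mem[OF i]] id_arrow_sel
    by (intro finsum_cong') (auto simp: mult_term_def)
qed

text \<open>\<open>coefficient s t\<close> reads off the coordinate at \<open>u\<^sub>s \<otimes> u\<^sub>t\<close> of an element of the tensor square.\<close>

definition coefficient :: "'a arrow \<Rightarrow> 'a arrow \<Rightarrow> (('a arrow \<Rightarrow> 'a) \<times> ('a arrow \<Rightarrow> 'a) \<Rightarrow>\<^sub>0 int) \<Rightarrow> 'a" where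
  "coefficient s t = (SOME h. h \<in> hom (free_pairs R) (add_monoid A) \<and>
     (\<forall>a\<in>carrier R. \<forall>b\<in>carrier R. h (frag_of (a, b)) = a s \<otimes> act s (b t)))"

context
  fixes s t assumes st: "s \<in> \<G>" "t \<in> \<G>" "src s = tgt t"
begin

lemma act_coeff_carrier: "b \<in> carrier R \<Longrightarrow> act s (b t) \<in> carrier A"
  using act_carrier[OF st(1)] coeff_mem[OF _ st(2)] st(3) by simp

text \<open>The universal property of the free abelian group on pairs supplies the homomorphism that
  the definition chooses.\<close>

lemma coefficient:
  shows "coefficient s t \<in> hom (free_pairs R) (add_monoid A)"
    "\<lbrakk>a \<in> carrier R; b \<in> carrier R\<rbrakk> \<Longrightarrow> coefficient s t (frag_of (a, b)) = a s \<otimes> act s (b t)"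
proof -
  let ?f = "\<lambda>(a, b). a s \<otimes> act s (b t)"
  have "?f ` (carrier R \<times> carrier R) \<subseteq> carrier (add_monoid A)"
    using act_coeff_carrier by auto
  then obtain h where "h \<in> hom (free_pairs R) (add_monoid A)"
    "\<And>x. x \<in> carrier R \<times> carrier R \<Longrightarrow> h (frag_of x) = ?f x"
    by (rule comm_group.free_Abelian_group_universal[OF a_comm_group]) blast
  then have "\<exists>h. h \<in> hom (free_pairs R) (add_monoid A) \<and>
     (\<forall>a\<in>carrier R. \<forall>b\<in>carrier R. h (frag_of (a, b)) = a s \<otimes> act s (b t))" by auto
  from someI_ex[OF this, folded coefficient_def]
  show "coefficient s t \<in> hom (free_pairs R) (add_monoid A)"
    "\<lbrakk>a \<in> carrier R; b \<in> carrier R\<rbrakk> \<Longrightarrow> coefficient s t (frag_of (a, b)) = a s \<otimes> act s (b t)"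
    by auto
qed

text \<open>For \<open>e\<close> in \<open>R0\<close> with entry \<open>x\<close> at the object
  \<open>src s = tgt t\<close>, both sides of the balancing relation give
  \<open>a s \<otimes> act s x \<otimes> act s (b t)\<close>.\<close>

lemma coefficient_kernel:
  assumes "z \<in> tensor_kernel R R0"
  shows "coefficient s t z = \<zero>"
proof (rule RR.hom_tensor_kernel[OF abelian_group_axioms coefficient(1) _ _ _ assms])
  fix a a' b assume ab: "a \<in> carrier R" "a' \<in> carrier R" "b \<in> carrier R"
  show "coefficient s t (frag_of (a \<oplus>\<^bsub>R\<^esub> a', b)) = coefficient s t (frag_of (a, b)) \<oplus> coefficient s t (frag_of (a', b))"
    using ab RR.a_closed[OF ab(1,2)] act_coeff_carrier[OF ab(3)] by (simp add: coefficient(2) l_distr)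
next
  fix a b b' assume ab: "a \<in> carrier R" "b \<in> carrier R" "b' \<in> carrier R"
  have "b t \<in> src s" "b' t \<in> src s" using coeff_mem[OF _ st(2)] st(3) ab by auto
  then show "coefficient s t (frag_of (a, b \<oplus>\<^bsub>R\<^esub> b')) = coefficient s t (frag_of (a, b)) \<oplus> coefficient s t (frag_of (a, b'))"
    using ab RR.a_closed[OF ab(2,3)] act_coeff_carrier by (simp add: coefficient(2) act_hom[OF st(1)] r_distr)
next
  fix a e b assume ab: "a \<in> carrier R" "e \<in> R0" "b \<in> carrier R"
  note eR = R0_D(1)[OF ab(2)]
  have m: "b t \<in> src s" "e (id_arrow (src s)) \<in> src s"
    using coeff_mem[OF ab(3) st(2)] coeff_mem[OF eR id_arrow_mem[OF src_conjugate[OF st(1)]]] st(3) by auto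
  show "coefficient s t (frag_of (a \<otimes>\<^bsub>R\<^esub> e, b)) = coefficient s t (frag_of (a, e \<otimes>\<^bsub>R\<^esub> b))"
    using ab eR m act_carrier[OF st(1)] R_mult_closed[OF ab(1) eR] R_mult_closed[OF eR ab(3)]
    by (simp add: coefficient(2) right_R0_coeff[OF ab(2,1) st(1)] left_R0_coeff[OF ab(2,3) st(2)]
        st(3)[symmetric] act_hom[OF st(1)] m_assoc)
qed

lemma coefficient_add:
  "\<lbrakk>RR.supported z; RR.supported w\<rbrakk> \<Longrightarrow>
   coefficient s t (z + w) = coefficient s t z \<oplus> coefficient s t w"
  using hom_mult[OF coefficient(1), of z w] by simp

lemma coefficient_closed:
  "RR.supported z \<Longrightarrow> coefficient s t z \<in> carrier A"
  using hom_in_carrier[OF coefficient(1), of z] by simp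

lemma coefficient_hom:
  assumes "B \<subseteq> carrier R \<times> carrier R"
  shows "coefficient s t \<in> hom (free_Abelian_group B) (add_monoid A)"
  by (rule homI) (simp_all add: coefficient_add coefficient_closed order.trans[OF _ assms])

text \<open>Finiteness of supports enters here: a nonzero coordinate of \<open>z\<close> forces
  \<open>s\<close> into the support of one of the finitely many left entries of
  \<open>z\<close>.\<close>

lemma coefficient_eq_zero:
  assumes "RR.supported z" "\<And>a b. (a, b) \<in> Poly_Mapping.keys z \<Longrightarrow> a s = \<zero>"
  shows "coefficient s t z = \<zero>"
proof (rule free_Abelian_group_hom_eq[OF coefficient_hom[OF assms(1)] _ a_group _ subset_refl])
  show "(\<lambda>_. \<zero>) \<in> hom (free_Abelian_group (Poly_Mapping.keys z)) (add_monoid A)" by (rule homI) auto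
  fix p assume p: "p \<in> Poly_Mapping.keys z"
  then have "fst p \<in> carrier R" "snd p \<in> carrier R" "fst p s = \<zero>" using assms by auto
  then show "coefficient s t (frag_of p) = \<zero>"
    using coefficient(2)[of "fst p" "snd p"] act_coeff_carrier by simp
qed

end

text \<open>The coefficient at the identity of \<open>i\<close> is the sum of the coordinates at
  \<open>(s, s\<^sup>-\<^sup>1)\<close>, each weighted by its cocycle value. Both sides of this
  formula are additive, so comparing them on the pairs occurring in \<open>z\<close> is
  enough.\<close>

lemma frag_mult_coeff:
  assumes z: "RR.supported z" and i: "i \<in> \<I>"
    and zero: "\<And>s. \<lbrakk>s \<in> \<G>; tgt s = i\<rbrakk> \<Longrightarrow> coefficient s (inv_arrow s) z = \<zero>"
  shows "frag_mult R z (id_arrow i) = \<zero>"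
proof -
  \<comment> \<open>One finite set holding the supports of all left entries, so that the same sum
    applies to every pair in \<open>z\<close>.\<close>
  define F where "F = (\<Union>p\<in>Poly_Mapping.keys z. {s. fst p s \<noteq> \<zero>})"
  have zR: "fst p \<in> carrier R" "snd p \<in> carrier R" if "p \<in> Poly_Mapping.keys z" for p
    using z that by auto
  have F: "finite F" "F \<subseteq> \<G>" "\<And>p. p \<in> Poly_Mapping.keys z \<Longrightarrow> {s. fst p s \<noteq> \<zero>} \<subseteq> F"
    unfolding F_def using zR by (auto dest: subsetD[OF support_arrows])
  define \<Psi> where "\<Psi> = (\<lambda>w. \<Oplus>s\<in>{s \<in> F. tgt s = i}. coefficient s (inv_arrow s) w \<otimes> \<beta> s (inv_arrow s))"
  have cl: "coefficient s (inv_arrow s) w \<in> carrier A" "\<beta> s (inv_arrow s) \<in> carrier A"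
    if "s \<in> F" "Poly_Mapping.keys w \<subseteq> Poly_Mapping.keys z" for s w
    using coefficient_closed[of s "inv_arrow s" w] beta_mem(3)[of s "inv_arrow s"] that F(2) z by auto
  have "frag_mult R z (id_arrow i) = \<Psi> z"
  proof (rule free_Abelian_group_hom_eq[OF _ _ a_group _ subset_refl])
    show "(\<lambda>w. frag_mult R w (id_arrow i)) \<in> hom (free_Abelian_group (Poly_Mapping.keys z)) (add_monoid A)"
      by (rule homI) (simp_all add: RR.frag_mult_add RR.frag_mult_closed order.trans[OF _ z])
    show "\<Psi> \<in> hom (free_Abelian_group (Poly_Mapping.keys z)) (add_monoid A)"
    proof (rule homI)
      fix v w assume "v \<in> carrier (free_Abelian_group (Poly_Mapping.keys z))"
        "w \<in> carrier (free_Abelian_group (Poly_Mapping.keys z))"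
      then have vw: "Poly_Mapping.keys v \<subseteq> Poly_Mapping.keys z" "Poly_Mapping.keys w \<subseteq> Poly_Mapping.keys z"
        by auto
      have "\<Psi> (v + w) = (\<Oplus>s\<in>{s \<in> F. tgt s = i}. coefficient s (inv_arrow s) v \<otimes> \<beta> s (inv_arrow s)
          \<oplus> coefficient s (inv_arrow s) w \<otimes> \<beta> s (inv_arrow s))"
        unfolding \<Psi>_def
        by (rule finsum_cong')
          (use vw cl F(2) in \<open>auto simp: coefficient_add order.trans[OF _ z] l_distr subsetD[OF F(2)]\<close>)
      also have "\<dots> = \<Psi> v \<oplus> \<Psi> w"
        unfolding \<Psi>_def by (rule finsum_addf) (use vw cl in auto)
      finally show "\<Psi> (v \<otimes>\<^bsub>free_Abelian_group (Poly_Mapping.keys z)\<^esub> w) = \<Psi> v \<otimes>\<^bsub>add_monoid A\<^esub> \<Psi> w" by simp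
    qed (use cl in \<open>auto simp: \<Psi>_def\<close>)
    fix p assume p: "p \<in> Poly_Mapping.keys z"
    have "frag_mult R (frag_of p) (id_arrow i) = (fst p \<otimes>\<^bsub>R\<^esub> snd p) (id_arrow i)"
      using RR.frag_mult_of[OF zR[OF p]] by simp
    also have "\<dots> = \<Psi> (frag_of p)"
      unfolding mult_id_coeff[OF zR[OF p] i F(1) F(3)[OF p] F(2)] \<Psi>_def
      by (rule finsum_cong')
        (use F(2) p cl[of _ "frag_of p"] coefficient(2)[OF _ _ _ zR[OF p]] in \<open>auto\<close>)
    finally show "frag_mult R (frag_of p) (id_arrow i) = \<Psi> (frag_of p)" .
  qed
  also have "\<Psi> z = (\<Oplus>s\<in>{s \<in> F. tgt s = i}. \<zero>)"
    unfolding \<Psi>_def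
  proof (rule finsum_cong')
    fix s assume "s \<in> {s \<in> F. tgt s = i}"
    then have s: "s \<in> F" "s \<in> \<G>" "tgt s = i" using F(2) by auto
    show "coefficient s (inv_arrow s) z \<otimes> \<beta> s (inv_arrow s) = \<zero>"
      unfolding zero[OF s(2,3)] using cl(2)[OF s(1) subset_refl] by simp
  qed auto
  finally show ?thesis by simp
qed

text \<open>The coordinate of \<open>u_r z\<close> at \<open>(r s, t)\<close> is
  \<open>\<beta> r s\<close> times the image under \<open>r\<close> of the coordinate of
  \<open>z\<close> at \<open>(s, t)\<close>, and neither factor vanishes.\<close>

lemma coefficient_lmap:
  assumes r: "r \<in> \<G>" and st: "s \<in> \<G>" "t \<in> \<G>" "src s = tgt t" "src r = tgt s"
    and z: "RR.supported z" and nz: "coefficient s t z \<noteq> \<zero>"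
  shows "coefficient (arrow_comp r s) t (RR.lmap (umon \<one> r) z) \<noteq> \<zero>"
proof -
  \<comment> \<open>An automorphism \<open>g\<close> of \<open>A\<close> takes the place of
    \<open>act r\<close>: coordinates are so far known only to lie in \<open>A\<close>, and
    \<open>g\<close> is additive and injective on all of it.\<close>
  obtain g j where gj: "r = Arrow (g ` j) (restrict g j) j" "g \<in> closure_auts" "j \<in> \<I>"
    using r by (rule arrowE)
  interpret g: ring_hom_ring A A g by (rule closure_autsD[OF gj(2)])
  have act: "act r x = g x" if "x \<in> src r" for x using that unfolding gj(1) by simp
  have one: "\<one> \<in> tgt r" using conjugate_props(2) r by blast
  have b: "\<beta> r s \<in> carrier A" "\<beta> r s \<noteq> \<zero>" using beta_mem[OF r st(1,4)] by auto
  note u = mon_mem[OF r one]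
  note rs = arrow_comp_mem[OF r st(1,4)]
  have "coefficient (arrow_comp r s) t (RR.lmap (umon \<one> r) z) = \<beta> r s \<otimes> g (coefficient s t z)"
  proof (rule free_Abelian_group_hom_eq[OF _ _ a_group _ z])
    show "(\<lambda>z. coefficient (arrow_comp r s) t (RR.lmap (umon \<one> r) z)) \<in> hom (free_pairs R) (add_monoid A)"
      by (rule homI)
        (use coefficient_closed[OF rs st(2)] coefficient_add[OF rs st(2)] st(3) RR.lmap_keys[OF u] in
          \<open>simp_all add: frag_extend_add\<close>)
    show "(\<lambda>z. \<beta> r s \<otimes> g (coefficient s t z)) \<in> hom (free_pairs R) (add_monoid A)"
      by (rule homI)
        (use b coefficient_closed[OF st(1-3)] coefficient_add[OF st(1-3)] in \<open>simp_all add: r_distr\<close>)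
    fix p assume "p \<in> carrier R \<times> carrier R"
    then obtain a c where p: "p = (a, c)" "a \<in> carrier R" "c \<in> carrier R" by blast
    have m: "a s \<in> src r" "c t \<in> src s" "act s (c t) \<in> src r"
      using coeff_mem[OF p(2) st(1)] coeff_mem[OF p(3) st(2)] st(3,4) act_closed[OF st(1)] by auto
    have gc: "g (a s) \<in> carrier A" "g (act s (c t)) \<in> carrier A" "act s (c t) \<in> carrier A"
      using p act_coeff_carrier[OF st(1-3)] by auto
    show "coefficient (arrow_comp r s) t (RR.lmap (umon \<one> r) (frag_of p)) =
        \<beta> r s \<otimes> g (coefficient s t (frag_of p))"
      using p m gc b st(3)
      by (simp add: coefficient(2)[OF rs st(2)] coefficient(2)[OF st(1-3)] R_mult_closed u
          left_mon_coeff[OF r one p(2) st(1,4)] act m_ac)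
  qed
  moreover have "g (coefficient s t z) \<noteq> \<zero>"
  proof
    assume "g (coefficient s t z) = \<zero>"
    then have "g (coefficient s t z) = g \<zero>" by simp
    then show False
      using nz closure_autsD(2)[OF gj(2)] coefficient_closed[OF st(1-3) z]
      unfolding bij_betw_def by (metis inj_onD zero_closed)
  qed
  ultimately show ?thesis
    using b coefficient_closed[OF st(1-3) z] by (simp add: integral_iff)
qed

text \<open>A nonzero coordinate after right multiplication therefore forces a nonzero one before
  it.\<close>

lemma coefficient_rmap:
  assumes r: "r \<in> \<G>" and st: "s \<in> \<G>" "t \<in> \<G>" "src s = tgt t" "src t = tgt r"
    and z: "RR.supported z"
  shows "coefficient s (arrow_comp t r) (RR.rmap (umon \<one> r) z) = coefficient s t z \<otimes> act s (\<beta> t r)"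
proof -
  have one: "\<one> \<in> tgt r" using conjugate_props(2) r by blast
  have b: "\<beta> t r \<in> carrier A" "\<beta> t r \<in> src s" "act s (\<beta> t r) \<in> carrier A"
    using beta_mem[OF st(2) r st(4)] act_carrier[OF st(1)] st(3) by auto
  note u = mon_mem[OF r one]
  note tr = arrow_comp_mem[OF st(2) r st(4)]
  have str: "src s = tgt (arrow_comp t r)" using st(3) by simp
  show ?thesis
  proof (rule free_Abelian_group_hom_eq[OF _ _ a_group _ z])
    show "(\<lambda>z. coefficient s (arrow_comp t r) (RR.rmap (umon \<one> r) z)) \<in> hom (free_pairs R) (add_monoid A)"
      by (rule homI)
        (use coefficient_closed[OF st(1) tr str] coefficient_add[OF st(1) tr str] RR.rmap_keys[OF u] in
          \<open>simp_all add: frag_extend_add\<close>)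
    show "(\<lambda>z. coefficient s t z \<otimes> act s (\<beta> t r)) \<in> hom (free_pairs R) (add_monoid A)"
      by (rule homI)
        (use b coefficient_closed[OF st(1-3)] coefficient_add[OF st(1-3)] in \<open>simp_all add: l_distr\<close>)
    fix p assume "p \<in> carrier R \<times> carrier R"
    then obtain a c where p: "p = (a, c)" "a \<in> carrier R" "c \<in> carrier R" by blast
    have m: "c t \<in> src s" using coeff_mem[OF p(3) st(2)] st(3) by auto
    show "coefficient s (arrow_comp t r) (RR.rmap (umon \<one> r) (frag_of p)) =
        coefficient s t (frag_of p) \<otimes> act s (\<beta> t r)"
      using p m b act_coeff_carrier[OF st(1-3) p(3)]
      by (simp add: coefficient(2)[OF st(1) tr str] coefficient(2)[OF st(1-3)] R_mult_closed u
          right_mon_coeff[OF r one p(3) st(2,4)] act_hom[OF st(2)] act_hom[OF st(1)] m_assoc)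
  qed
qed

text \<open>Matches the pair \<open>(r s, s\<^sup>-\<^sup>1)\<close>, reached by left multiplication
  with \<open>u_r\<close>, with the pair \<open>(r s, (r s)\<^sup>-\<^sup>1 r)\<close>, reached by
  right multiplication.\<close>

lemma inv_arrow_comp:
  assumes "r \<in> \<G>" "s \<in> \<G>" "src r = tgt s"
  shows "arrow_comp (inv_arrow (arrow_comp r s)) r = inv_arrow s"
proof -
  let ?t = "arrow_comp (inv_arrow (arrow_comp r s)) r"
  have rs: "arrow_comp r s \<in> \<G>" using assms by simp
  have t: "?t \<in> \<G>" "src ?t = tgt s" using rs assms by auto
  have "arrow_comp ?t s = id_arrow (src s)"
    using arrow_comp_assoc[of "inv_arrow (arrow_comp r s)" r s] inv_arrow[OF rs] assms by simp
  then have "?t = arrow_comp (id_arrow (src s)) (inv_arrow s)"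
    using arrow_cancel(3)[OF assms(2) t] by simp
  then show ?thesis using arrow_comp_id(2)[of "inv_arrow s"] assms(2) by simp
qed

lemma separable_imp_finite_isotropy:
  assumes "separable_over R R0" and i: "i \<in> \<I>"
  shows "finite {r \<in> \<G>. src r = i \<and> tgt r = i}"
proof -
  define e where "e = umon \<one> (id_arrow i)"
  have one: "\<one> \<in> i" using conjugate_props(2)[OF i] .
  have "e \<in> carrier R" unfolding e_def using i one by simp
  then obtain z where z: "RR.supported z" "frag_mult R z = e"
    and central: "\<And>x. \<lbrakk>x \<in> carrier R; x \<otimes>\<^bsub>R\<^esub> e = e \<otimes>\<^bsub>R\<^esub> x\<rbrakk> \<Longrightarrow>
      RR.lmap x z - RR.rmap x z \<in> tensor_kernel R R0"
    by (rule RR.separable_overE[OF assms(1)]) blast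
  have "frag_mult R z (id_arrow i) \<noteq> \<zero>" unfolding z(2) e_def by (simp add: crossed_monom_def)
  then obtain s where s: "s \<in> \<G>" "tgt s = i" "coefficient s (inv_arrow s) z \<noteq> \<zero>"
    using frag_mult_coeff[OF z(1) i] by blast
  define F where "F = (\<Union>p\<in>Poly_Mapping.keys z. {s. fst p s \<noteq> \<zero>})"
  have F: "finite F" unfolding F_def using z(1) by auto
  have into: "arrow_comp r s \<in> F" if r: "r \<in> \<G>" "src r = i" "tgt r = i" for r
  proof -
    have oner: "\<one> \<in> tgt r" using one r by simp
    note u = mon_mem[OF r(1) oner]
    have rs: "src r = tgt s" using r s by simp
    note rsG = arrow_comp_mem[OF r(1) s(1) rs]
    let ?t = "inv_arrow (arrow_comp r s)"
    have t: "?t \<in> \<G>" "src (arrow_comp r s) = tgt ?t" "src ?t = tgt r" using inv_arrow[OF rsG] by auto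
    \<comment> \<open>Both products are \<open>u_r\<close>, as \<open>r\<close> is a loop at
      \<open>i\<close> and \<open>e\<close> is the local identity there.\<close>
    have comm: "umon \<one> r \<otimes>\<^bsub>R\<^esub> e = e \<otimes>\<^bsub>R\<^esub> umon \<one> r"
      using mon_mult(1)[OF r(1) id_arrow_mem[OF i] oner, of \<one>] one r i
        mon_mult(1)[OF id_arrow_mem[OF i] r(1) _ oner, of \<one>] arrow_comp_id[OF r(1)] beta_id[OF r(1)]
      unfolding e_def by (simp add: act_hom)
    let ?l = "RR.lmap (umon \<one> r) z" and ?r = "RR.rmap (umon \<one> r) z"
    have k: "?l - ?r \<in> tensor_kernel R R0" by (rule central[OF u comm])
    have lr: "coefficient (arrow_comp r s) (inv_arrow s) ?l = coefficient (arrow_comp r s) (inv_arrow s) ?r"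
    proof -
      have si: "inv_arrow s \<in> \<G>" "src (arrow_comp r s) = tgt (inv_arrow s)" using s by auto
      have "coefficient (arrow_comp r s) (inv_arrow s) (?l - ?r + ?r) =
          \<zero> \<oplus> coefficient (arrow_comp r s) (inv_arrow s) ?r"
        unfolding coefficient_add[OF rsG si RR.tensor_kernel_keys[OF k] RR.rmap_keys[OF u z(1)]]
          coefficient_kernel[OF rsG si k] ..
      then show ?thesis using coefficient_closed[OF rsG si RR.rmap_keys[OF u z(1)]] by simp
    qed
    have "coefficient (arrow_comp r s) (inv_arrow s) ?l \<noteq> \<zero>"
      by (rule coefficient_lmap[OF r(1) s(1) _ _ rs z(1) s(3)]) (use s in auto)
    \<comment> \<open>Commutation of \<open>z\<close> with \<open>u_r\<close> modulo the kernel
      turns the nonzero coordinate of \<open>u_r z\<close> into one of \<open>z u_r\<close>.\<close>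
    then have "coefficient (arrow_comp r s) (arrow_comp ?t r) ?r \<noteq> \<zero>"
      unfolding inv_arrow_comp[OF r(1) s(1) rs] lr .
    then have "coefficient (arrow_comp r s) ?t z \<noteq> \<zero>"
      unfolding coefficient_rmap[OF r(1) rsG t z(1)]
      using act_carrier[OF rsG] beta_mem(1)[OF t(1) r(1) t(3)] t(2) by auto
    then show ?thesis
      using coefficient_eq_zero[OF rsG t(1,2) z(1)] unfolding F_def by force
  qed
  have inj: "inj_on (\<lambda>r. arrow_comp r s) {r \<in> \<G>. src r = i \<and> tgt r = i}"
    using arrow_cancel(3)[OF s(1)] s(2) by (intro inj_on_inverseI[of _ "\<lambda>r. arrow_comp r (inv_arrow s)"]) auto
  show ?thesis
    by (rule inj_on_finite[OF inj _ F]) (use into in blast)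
qed

lemma field_auts_arrow: "f \<in> field_auts A K L \<longleftrightarrow> Arrow L f L \<in> \<G>"
proof
  assume "f \<in> field_auts A K L"
  then obtain g where "g \<in> closure_auts" "g ` L = L" "f = restrict g L"
    unfolding field_auts_eq[OF subfield_L K_L] by auto
  then show "Arrow L f L \<in> \<G>" using arrowI[OF _ L_conjugate, of g] by simp
next
  assume "Arrow L f L \<in> \<G>"
  then show "f \<in> field_auts A K L"
    unfolding field_auts_eq[OF subfield_L K_L] by (auto elim!: arrowE)
qed

lemma separable_imp_finite_auts:
  assumes "separable_over R R0"
  shows "finite (field_auts A K L)"
  by (rule inj_on_finite[OF _ _ separable_imp_finite_isotropy[OF assms L_conjugate], of "\<lambda>f. Arrow L f L"])
    (auto simp: inj_on_def field_auts_arrow)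

end

section \<open>Galois coordinates\<close>

text \<open>Functions \<open>h \<mapsto> \<Sum>\<^sub>n y\<^sub>n h(x\<^sub>n)\<close> on a set \<open>H\<close> of automorphisms. Galois coordinates are an
  expression of this form for the indicator function of the identity.\<close>

inductive coordinate_sum :: "('a, 'm) ring_scheme \<Rightarrow> 'a set \<Rightarrow> ('a \<Rightarrow> 'a) set \<Rightarrow> (('a \<Rightarrow> 'a) \<Rightarrow> 'a) \<Rightarrow> bool"
  for A E H where
  base: "\<lbrakk>y \<in> E; x \<in> E; \<And>h. h \<in> H \<Longrightarrow> f h = y \<otimes>\<^bsub>A\<^esub> h x\<rbrakk> \<Longrightarrow> coordinate_sum A E H f"
| add: "\<lbrakk>coordinate_sum A E H f; coordinate_sum A E H g; \<And>h. h \<in> H \<Longrightarrow> k h = f h \<oplus>\<^bsub>A\<^esub> g h\<rbrakk> \<Longrightarrow>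
    coordinate_sum A E H k"

locale intermediate_field = algebraic_closure_of A K for A (structure) and K +
  fixes E
  assumes subfield_E: "subfield E A" and K_E: "K \<subseteq> E"
begin

abbreviation "H \<equiv> field_auts A K E"
abbreviation "coord \<equiv> coordinate_sum A E H"

lemmas E_ring = subringE[OF subfieldE(1)[OF subfield_E]]

lemma E_carrier: "x \<in> E \<Longrightarrow> x \<in> carrier A"
  using E_ring(1) by blast

lemma autE:
  assumes "h \<in> H"
  obtains g where "g \<in> closure_auts" "g ` E = E" "h = restrict g E"
  using assms unfolding field_auts_eq[OF subfield_E K_E] by blast

lemma aut_closed: "\<lbrakk>h \<in> H; x \<in> E\<rbrakk> \<Longrightarrow> h x \<in> E"
  by (erule autE) auto

lemma aut_carrier [simp]: "\<lbrakk>h \<in> H; x \<in> E\<rbrakk> \<Longrightarrow> h x \<in> carrier A"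
  using aut_closed E_carrier by blast

lemma aut_hom:
  assumes "h \<in> H"
  shows "\<lbrakk>x \<in> E; y \<in> E\<rbrakk> \<Longrightarrow> h (x \<otimes> y) = h x \<otimes> h y" "h \<one> = \<one>" "x \<in> K \<Longrightarrow> h x = x"
    "\<lbrakk>x \<in> E; y \<in> E; h x = h y\<rbrakk> \<Longrightarrow> x = y"
proof -
  obtain g where g: "g \<in> closure_auts" "g ` E = E" "h = restrict g E" using assms by (rule autE)
  interpret g: ring_hom_ring A A g by (rule closure_autsD[OF g(1)])
  show "\<lbrakk>x \<in> E; y \<in> E\<rbrakk> \<Longrightarrow> h (x \<otimes> y) = h x \<otimes> h y" "h \<one> = \<one>"
    using E_ring(3,6) E_carrier unfolding g(3) by auto
  show "h x = x" if "x \<in> K" using closure_autsD(3)[OF g(1) that] that K_E unfolding g(3) by auto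
  show "x = y" if "x \<in> E" "y \<in> E" "h x = h y"
    using that closure_autsD(2)[OF g(1)] E_carrier unfolding g(3) bij_betw_def by (auto dest: inj_onD)
qed

lemma id_aut: "restrict id E \<in> H"
  unfolding field_auts_eq[OF subfield_E K_E] using id_closure_auts by auto

lemma aut_comp_bij:
  assumes g: "g \<in> H"
  shows "bij_betw (\<lambda>h. compose E g h) H H"
proof -
  obtain g' where g': "g' \<in> closure_auts" "g' ` E = E" "g = restrict g' E" using g by (rule autE)
  obtain k' where k': "k' \<in> closure_auts" "\<And>x. x \<in> carrier A \<Longrightarrow> k' (g' x) = x \<and> g' (k' x) = x"
    using closure_auts_inv[OF g'(1)] by blast
  define k where "k = restrict k' E"
  have kE: "k' ` E = E"
    using g'(2) k'(2) E_carrier by (metis (no_types, lifting) image_cong image_ident image_image)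
  have k: "k \<in> H" unfolding k_def by (rule restrict_field_aut[OF subfield_E K_E k'(1) kE])
  have comp: "compose E a b \<in> H" if ab: "a \<in> H" "b \<in> H" for a b
  proof -
    obtain a' where a': "a' \<in> closure_auts" "a' ` E = E" "a = restrict a' E" using ab(1) by (rule autE)
    obtain b' where b': "b' \<in> closure_auts" "b' ` E = E" "b = restrict b' E" using ab(2) by (rule autE)
    have "compose E a b = restrict (a' \<circ> b') E"
      unfolding a'(3) b'(3) using b'(2) by (auto simp: compose_def restrict_def fun_eq_iff)
    moreover have "(a' \<circ> b') ` E = E" using a'(2) b'(2) by (metis image_comp)
    ultimately show ?thesis
      using restrict_field_aut[OF subfield_E K_E closure_auts_comp[OF a'(1) b'(1)]] by simp
  qed
  have gk: "g (k x) = x" "k (g x) = x" if "x \<in> E" for x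
    using that k'(2) E_carrier g'(2) kE unfolding g'(3) k_def by auto
  have ext: "h \<in> extensional E" if "h \<in> H" for h using that by (auto elim: autE)
  show ?thesis
  proof (rule bij_betw_byWitness[of _ "\<lambda>h. compose E k h"])
    show "\<forall>h\<in>H. compose E k (compose E g h) = h"
      by (intro ballI, rule extensionalityI[OF compose_extensional ext])
        (simp_all add: compose_eq gk aut_closed)
    show "\<forall>h\<in>H. compose E g (compose E k h) = h"
      by (intro ballI, rule extensionalityI[OF compose_extensional ext])
        (simp_all add: compose_eq gk aut_closed)
  qed (use comp g k in auto)
qed

lemma coord_closed: "\<lbrakk>coord f; h \<in> H\<rbrakk> \<Longrightarrow> f h \<in> E"
  by (induction rule: coordinate_sum.induct) (auto simp: E_ring aut_closed)

lemma coord_carrier: "\<lbrakk>coord f; h \<in> H\<rbrakk> \<Longrightarrow> f h \<in> carrier A"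
  using coord_closed E_carrier by blast

text \<open>Rests on \<open>h u \<otimes> h x = h (u \<otimes> x)\<close>. A one-term right factor
  suffices for the product formula that separates automorphisms.\<close>

lemma coord_mult:
  assumes "coord f" "y \<in> E" "x \<in> E"
  shows "coord (\<lambda>h. f h \<otimes> (y \<otimes> h x))"
  using assms(1)
proof (induction rule: coordinate_sum.induct)
  case (base v u f)
  have "f h \<otimes> (y \<otimes> h x) = (v \<otimes> y) \<otimes> h (u \<otimes> x)" if "h \<in> H" for h
    using base assms(2,3) that by (simp add: aut_hom E_carrier m_ac)
  then show ?case
    using E_ring(6) base assms(2,3) by (intro coordinate_sum.base[of "v \<otimes> y" _ "u \<otimes> x"]) auto
next
  case (add f g k)
  have "k h \<otimes> (y \<otimes> h x) = f h \<otimes> (y \<otimes> h x) \<oplus> g h \<otimes> (y \<otimes> h x)" if "h \<in> H" for h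
    using add assms(2,3) that coord_carrier by (simp add: E_carrier l_distr)
  then show ?case using add by (intro coordinate_sum.add[OF add(4,5)]) auto
qed

text \<open>Multiplies together, for \<open>s\<close> in \<open>S\<close>, the factors
  \<open>(h(w) - s(w)) / (w - s(w))\<close> with \<open>w\<close> moved by \<open>s\<close>. Each
  factor is one at the identity and zero at its own \<open>s\<close>.\<close>

lemma coord_separate:
  assumes "finite S" "S \<subseteq> H - {restrict id E}"
  shows "\<exists>f. coord f \<and> f (restrict id E) = \<one> \<and> (\<forall>h\<in>S. f h = \<zero>)"
  using assms
proof (induction S rule: finite_induct)
  case empty
  have "coord (\<lambda>h. \<one> \<otimes> h \<one>)" by (rule coordinate_sum.base[of \<one> _ \<one>]) (auto simp: E_ring)
  then show ?case using E_ring(3) by (auto intro!: exI[of _ "\<lambda>h. \<one> \<otimes> h \<one>"])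
next
  case (insert s S)
  then obtain f where f: "coord f" "f (restrict id E) = \<one>" "\<forall>h\<in>S. f h = \<zero>"
    by (meson insert_subset)
  have s: "s \<in> H" "s \<noteq> restrict id E" using insert.prems by auto
  have "s \<in> extensional E" using s(1) by (auto elim: autE)
  then obtain w where w: "w \<in> E" "s w \<noteq> w"
    using s(2) by (metis extensionalityI restrict_extensional restrict_apply' id_apply)
  have sw: "s w \<in> E" using aut_closed s(1) w(1) .
  define d where "d = w \<ominus> s w"
  have d: "d \<in> E" "d \<noteq> \<zero>"
    using w sw E_ring(5,7) E_carrier r_right_minus_eq[of w "s w"] unfolding d_def a_minus_def by auto
  define c where "c = inv d"
  have c: "c \<in> E" "c \<otimes> d = \<one>"
    using subfield_m_inv[OF subfield_E, of d] d unfolding c_def by auto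
  define b where "b = \<ominus> (c \<otimes> s w)"
  have b: "b \<in> E" unfolding b_def using c(1) sw E_ring(5,6) by simp
  \<comment> \<open>The new factor is split as \<open>c h(w) + b h(1)\<close>; writing the constant
    as \<open>b h(1)\<close> puts it into the form required of a coordinate sum.\<close>
  define k where "k = (\<lambda>h. f h \<otimes> (c \<otimes> h w) \<oplus> f h \<otimes> (b \<otimes> h \<one>))"
  have "coord k"
    unfolding k_def
    by (rule coordinate_sum.add[OF coord_mult[OF f(1) c(1) w(1)] coord_mult[OF f(1) b E_ring(3)]]) simp
  have cc: "c \<in> carrier A" "b \<in> carrier A" "w \<in> carrier A" "s w \<in> carrier A"
    using E_carrier c b w sw by auto
  have "k (restrict id E) = c \<otimes> w \<oplus> b"
    using cc w(1) E_ring(3) unfolding k_def f(2) by simp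
  also have "\<dots> = c \<otimes> d" unfolding b_def d_def using cc by (simp add: a_minus_def r_distr r_minus)
  finally have "k (restrict id E) = \<one>" using c(2) by simp
  moreover have "k h = \<zero>" if "h \<in> insert s S" for h
  proof (cases "h = s")
    case True
    have fs: "f s \<in> carrier A" using coord_carrier[OF f(1) s(1)] .
    have "k s = f s \<otimes> (c \<otimes> s w \<oplus> b)"
      using cc fs by (simp add: k_def aut_hom(2)[OF s(1)] r_distr)
    also have "\<dots> = \<zero>" unfolding b_def using cc fs by (simp add: r_neg)
    finally show ?thesis using True by simp
  next
    case False
    then have "f h = \<zero>" "h \<in> H" using that f(3) insert.prems by auto
    then show ?thesis using cc w(1) aut_hom(2)[of h] by (simp add: k_def)
  qed
  ultimately show ?case using \<open>coord k\<close> by blast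
qed

section \<open>The trace to the fixed field\<close>

definition trace :: "'a \<Rightarrow> 'a" where
  "trace x = (\<Oplus>h\<in>H. h x)"

context
  assumes finite: "finite H"
begin

lemma trace_mem: "x \<in> E \<Longrightarrow> trace x \<in> E"
proof -
  assume x: "x \<in> E"
  have "(\<Oplus>h\<in>B. h x) \<in> E" if "finite B" "B \<subseteq> H" for B
    using that
  proof (induction B rule: finite_induct)
    case (insert h B)
    then have "(\<lambda>h. h x) \<in> B \<rightarrow> carrier A" "h x \<in> E" using x aut_closed by auto
    with insert show ?case by (simp add: E_ring E_carrier)
  qed (simp add: E_ring)
  then show "trace x \<in> E" unfolding trace_def using finite by blast
qed

lemma trace_fixed:
  assumes g: "g \<in> H" and x: "x \<in> E"
  shows "g (trace x) = trace x"
proof -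
  obtain g' where g': "g' \<in> closure_auts" "g' ` E = E" "g = restrict g' E" using g by (rule autE)
  interpret g': ring_hom_ring A A g' by (rule closure_autsD[OF g'(1)])
  have "g (trace x) = g' (\<Oplus>h\<in>H. h x)" using trace_mem[OF x] unfolding g'(3) trace_def by simp
  also have "\<dots> = (\<Oplus>h\<in>H. g' (h x))"
    using g'.hom_finsum[of "\<lambda>h. h x" H] x by (simp add: comp_def)
  also have "\<dots> = (\<Oplus>h\<in>H. (compose E g h) x)"
    by (rule finsum_cong') (use x aut_closed g'(2) E_carrier in \<open>auto simp: compose_eq g'(3)\<close>)
  also have "\<dots> = (\<Oplus>h\<in>(\<lambda>h. compose E g h) ` H. h x)"
  proof (rule add.finprod_reindex[symmetric])
    show "inj_on (\<lambda>h. compose E g h) H" using aut_comp_bij[OF g] unfolding bij_betw_def by blast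
    show "(\<lambda>h. h x) \<in> (\<lambda>h. compose E g h) ` H \<rightarrow> carrier A"
      using aut_comp_bij[OF g] x unfolding bij_betw_def by auto
  qed
  also have "(\<lambda>h. compose E g h) ` H = H" using aut_comp_bij[OF g] unfolding bij_betw_def by blast
  finally show ?thesis unfolding trace_def .
qed

lemma coord_delta:
  obtains f where "coord f" "f (restrict id E) = \<one>" "\<And>h. \<lbrakk>h \<in> H; h \<noteq> restrict id E\<rbrakk> \<Longrightarrow> f h = \<zero>"
  using coord_separate[of "H - {restrict id E}"] finite by auto

text \<open>A dual basis formula in disguise: if \<open>f h\<close> is the sum of the
  \<open>y_n h(x_n)\<close>, the left-hand side is the sum of the
  \<open>trace(z x_n) y_n\<close>.\<close>

lemma coord_delta_sum:
  assumes "f (restrict id E) = \<one>" "\<And>h. \<lbrakk>h \<in> H; h \<noteq> restrict id E\<rbrakk> \<Longrightarrow> f h = \<zero>" and z: "z \<in> E"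
  shows "(\<Oplus>h\<in>H. h z \<otimes> f h) = z"
  using finsum_single[OF abelian_monoid_axioms finite id_aut, of "\<lambda>h. h z \<otimes> f h"] assms E_carrier by simp

text \<open>Dividing by the number of automorphisms fails if the characteristic divides it. Instead,
  if all traces vanished, every coordinate sum would have total zero over \<open>H\<close>, whereas
  the indicator of the identity has total one. A nonzero trace is fixed by \<open>H\<close>, so it
  can be scaled to one inside the argument.\<close>

lemma trace_one_exists: "\<exists>b\<in>E. trace b = \<one>"
proof -
  obtain f where f: "coord f" "f (restrict id E) = \<one>" "\<And>h. \<lbrakk>h \<in> H; h \<noteq> restrict id E\<rbrakk> \<Longrightarrow> f h = \<zero>"
    by (rule coord_delta) blast
  have sum_zero: "(\<Oplus>h\<in>H. f h) = \<zero>" if "coord f" "\<And>x. x \<in> E \<Longrightarrow> trace x = \<zero>" for f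
    using that(1)
  proof (induction rule: coordinate_sum.induct)
    case (base y x f)
    have "(\<Oplus>h\<in>H. f h) = (\<Oplus>h\<in>H. y \<otimes> h x)"
      by (rule finsum_cong') (use base E_carrier in auto)
    also have "\<dots> = y \<otimes> trace x"
      unfolding trace_def by (rule finsum_rdistr[symmetric]) (use base finite E_carrier in auto)
    finally show ?case using that(2)[OF base(2)] E_carrier base(1) by simp
  next
    case (add f g k)
    have "(\<Oplus>h\<in>H. k h) = (\<Oplus>h\<in>H. f h \<oplus> g h)"
      by (rule finsum_cong') (use add coord_carrier in auto)
    also have "\<dots> = (\<Oplus>h\<in>H. f h) \<oplus> (\<Oplus>h\<in>H. g h)"
      by (rule finsum_addf) (use add coord_carrier in auto)
    finally show ?case using add by simp
  qed
  have "(\<Oplus>h\<in>H. h \<one> \<otimes> f h) = \<one>" by (rule coord_delta_sum) (use f E_ring in auto)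
  moreover have "(\<Oplus>h\<in>H. h \<one> \<otimes> f h) = (\<Oplus>h\<in>H. f h)"
    by (rule finsum_cong') (simp_all add: coord_carrier[OF f(1)] aut_hom(2))
  ultimately have "(\<Oplus>h\<in>H. f h) \<noteq> \<zero>" by simp
  then obtain x where x: "x \<in> E" "trace x \<noteq> \<zero>" using sum_zero[OF f(1)] by blast
  define t where "t = trace x"
  have t: "t \<in> E" "t \<noteq> \<zero>" using trace_mem x unfolding t_def by auto
  have it: "inv t \<in> E" "inv t \<otimes> t = \<one>" using subfield_m_inv[OF subfield_E, of t] t by auto
  have fixed: "h (inv t) = inv t" if h: "h \<in> H" for h
  proof -
    have "h (inv t) \<otimes> t = \<one>"
      using aut_hom(1)[OF h it(1) t(1)] aut_hom(2)[OF h] trace_fixed[OF h x(1)] it(2) unfolding t_def by simp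
    then show ?thesis
      using it t E_carrier aut_carrier[OF h it(1)] m_comm[of t] comm_inv_char[of t "h (inv t)"] by simp
  qed
  have "trace (inv t \<otimes> x) = (\<Oplus>h\<in>H. inv t \<otimes> h x)"
    unfolding trace_def
    by (rule finsum_cong') (simp_all add: x(1) it(1) fixed aut_hom(1) E_carrier)
  also have "\<dots> = inv t \<otimes> trace x"
    unfolding trace_def by (rule finsum_rdistr[symmetric]) (use finite x(1) it(1) E_carrier in auto)
  also have "\<dots> = \<one>" using it(2) unfolding t_def .
  finally show ?thesis using E_ring(6)[OF it(1) x(1)] by blast
qed

section \<open>Finite automorphism groups and finite degree\<close>

text \<open>Expanding \<open>z\<close> by the dual basis formula, the finitely many
  \<open>y_n\<close> in an expression for the indicator of the identity span \<open>E\<close>; the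
  coefficients are traces, hence fixed by \<open>H\<close> and in \<open>K\<close>.\<close>

lemma finite_dimension_of_fixed_field:
  assumes fixed: "\<And>x. \<lbrakk>x \<in> E; \<And>h. h \<in> H \<Longrightarrow> h x = x\<rbrakk> \<Longrightarrow> x \<in> K"
  shows "finite_dimension K E"
proof -
  have span: "\<exists>ys. set ys \<subseteq> E \<and> (\<forall>z\<in>E. (\<Oplus>h\<in>H. h z \<otimes> f h) \<in> Span K ys)" if "coord f" for f
    using that
  proof (induction rule: coordinate_sum.induct)
    case (base y x f)
    have "(\<Oplus>h\<in>H. h z \<otimes> f h) \<in> Span K [y]" if z: "z \<in> E" for z
    proof -
      have zx: "z \<otimes> x \<in> E" using E_ring(6) z base by blast
      have "(\<Oplus>h\<in>H. h z \<otimes> f h) = (\<Oplus>h\<in>H. h (z \<otimes> x) \<otimes> y)"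
        by (rule finsum_cong') (use base z zx E_carrier aut_hom(1) in \<open>auto simp: m_ac\<close>)
      also have "\<dots> = trace (z \<otimes> x) \<otimes> y"
        unfolding trace_def by (rule finsum_ldistr[symmetric]) (use base finite zx E_carrier in auto)
      finally have eq: "(\<Oplus>h\<in>H. h z \<otimes> f h) = trace (z \<otimes> x) \<otimes> y" .
      have "trace (z \<otimes> x) \<in> K" using fixed trace_mem[OF zx] trace_fixed[OF _ zx] by blast
      then show ?thesis
        unfolding eq using Span_smult_closed[OF subfield_K, of "[y]" "trace (z \<otimes> x)" y]
          Span_base_incl[OF subfield_K, of "[y]"] base(1) E_carrier by (auto simp del: Span.simps)
    qed
    then show ?case using base(1) by (intro exI[of _ "[y]"]) (auto simp del: Span.simps)
  next
    case (add f g k)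
    then obtain us vs where uv: "set us \<subseteq> E" "set vs \<subseteq> E"
      "\<And>z. z \<in> E \<Longrightarrow> (\<Oplus>h\<in>H. h z \<otimes> f h) \<in> Span K us"
      "\<And>z. z \<in> E \<Longrightarrow> (\<Oplus>h\<in>H. h z \<otimes> g h) \<in> Span K vs" by blast
    have c: "set us \<subseteq> carrier A" "set vs \<subseteq> carrier A" using uv(1,2) E_ring(1) by auto
    have "(\<Oplus>h\<in>H. h z \<otimes> k h) \<in> Span K (us @ vs)" if z: "z \<in> E" for z
    proof -
      have "(\<Oplus>h\<in>H. h z \<otimes> k h) = (\<Oplus>h\<in>H. h z \<otimes> f h \<oplus> h z \<otimes> g h)"
        by (rule finsum_cong') (use add z coord_carrier in \<open>auto simp: r_distr\<close>)
      also have "\<dots> = (\<Oplus>h\<in>H. h z \<otimes> f h) \<oplus> (\<Oplus>h\<in>H. h z \<otimes> g h)"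
        by (rule finsum_addf) (use add z coord_carrier in auto)
      also have "\<dots> \<in> Span K (us @ vs)"
      proof (rule Span_subgroup_props(3)[OF subfield_K])
        show "(\<Oplus>h\<in>H. h z \<otimes> f h) \<in> Span K (us @ vs)" "(\<Oplus>h\<in>H. h z \<otimes> g h) \<in> Span K (us @ vs)"
          using uv(3,4)[OF z] mono_Span_append(1)[OF subfield_K c] mono_Span_append(2)[OF subfield_K c(2,1)]
          by (blast intro: subsetD)+
      qed (use c in simp)
      finally show ?thesis .
    qed
    then show ?case using uv(1,2) by (intro exI[of _ "us @ vs"]) (auto simp del: Span.simps)
  qed
  obtain f where f: "coord f" "f (restrict id E) = \<one>" "\<And>h. \<lbrakk>h \<in> H; h \<noteq> restrict id E\<rbrakk> \<Longrightarrow> f h = \<zero>"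
    by (rule coord_delta) blast
  obtain ys where ys: "set ys \<subseteq> E" "\<And>z. z \<in> E \<Longrightarrow> (\<Oplus>h\<in>H. h z \<otimes> f h) \<in> Span K ys"
    using span[OF f(1)] by blast
  have "E \<subseteq> Span K ys"
  proof
    fix z assume z: "z \<in> E"
    have "(\<Oplus>h\<in>H. h z \<otimes> f h) = z" by (rule coord_delta_sum) (use f z in auto)
    then show "z \<in> Span K ys" using ys(2)[OF z] by (simp del: Span.simps)
  qed
  moreover have "subalgebra K E A"
  proof (intro subalgebra.intro subalgebra_axioms.intro)
    show "subgroup E (add_monoid A)" using subring.axioms(1)[OF subfieldE(1)[OF subfield_E]] 
      by (simp add: additive_subgroup.a_subgroup)
  qed (use K_E E_ring(6) in blast)
  ultimately show ?thesis
    using subalbegra_incl_imp_finite_dimension[OF subfield_K Span_finite_dimension[OF subfield_K]]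
      ys(1) E_ring(1) by blast
qed

end

text \<open>An automorphism over \<open>K\<close> is determined by its values on a finite spanning
  list, and each value is a root of the minimal polynomial of the entry. So only finitely many lists
  of values are possible.\<close>

lemma finite_auts_of_finite_dimension:
  assumes "finite_dimension K E"
  shows "finite H"
proof -
  obtain us where us: "set us \<subseteq> carrier A" "Span K us = E"
    using exists_base[OF subfield_K finite_dimensionE[OF subfield_K assms]] by blast
  have usE: "set us \<subseteq> E" using Span_base_incl[OF subfield_K us(1)] us(2) by simp
  define Z where "Z = (\<Union>u\<in>set us. {x \<in> carrier A. eval (Irr K u) x = \<zero>})"
  have "finite Z" unfolding Z_def using finite_roots Irr_K(1,2) us(1) by blast
  then have fin: "finite {vs. set vs \<subseteq> Z \<and> length vs = length us}" by (rule finite_lists_length_eq)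
  have comb: "g (combine Ks vs) = combine Ks (map g vs)"
    if "g \<in> closure_auts" "set Ks \<subseteq> K" "set vs \<subseteq> carrier A" for g Ks vs
  proof -
    interpret g: ring_hom_ring A A g by (rule closure_autsD[OF that(1)])
    have KA: "x \<in> carrier A" if "x \<in> K" for x using subfieldE(3)[OF subfield_K] that by blast
    show ?thesis
      using that(2,3)
    proof (induction Ks vs rule: combine.induct)
      case (1 k Ks u Us)
      then have "combine Ks Us \<in> carrier A" "k \<in> carrier A" "u \<in> carrier A" "g k = k"
        using combine_in_carrier[of Ks Us] KA closure_autsD(3)[OF that(1)] by (auto simp: subset_iff)
      then show ?case using 1 by simp
    qed auto
  qed
  have "inj_on (\<lambda>h. map h us) H"
  proof (rule inj_onI)
    fix h h' assume h: "h \<in> H" "h' \<in> H" "map h us = map h' us"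
    obtain g where g: "g \<in> closure_auts" "g ` E = E" "h = restrict g E" using h(1) by (rule autE)
    obtain g' where g': "g' \<in> closure_auts" "g' ` E = E" "h' = restrict g' E" using h(2) by (rule autE)
    have "map g us = map g' us"
      using h(3) usE unfolding g(3) g'(3) by (auto simp: subset_iff)
    moreover have "\<exists>Ks. set Ks \<subseteq> K \<and> x = combine Ks us" if "x \<in> E" for x
      using Span_eq_combine_set[OF subfield_K us(1)] us(2) that by auto
    ultimately have "g x = g' x" if "x \<in> E" for x
      using comb[OF g(1) _ us(1)] comb[OF g'(1) _ us(1)] that by metis
    then show "h = h'" unfolding g(3) g'(3) by (auto simp: restrict_def fun_eq_iff)
  qed
  moreover have "(\<lambda>h. map h us) ` H \<subseteq> {vs. set vs \<subseteq> Z \<and> length vs = length us}"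
  proof (rule image_subsetI)
    fix h assume "h \<in> H"
    then obtain g where g: "g \<in> closure_auts" "g ` E = E" "h = restrict g E" by (rule autE)
    interpret g: ring_hom_ring A A g by (rule closure_autsD[OF g(1)])
    have "h u \<in> Z" if u: "u \<in> set us" for u
    proof -
      have uc: "u \<in> carrier A" "u \<in> E" using u us(1) usE by auto
      have "eval (Irr K u) (g u) = \<zero>"
        using eval_hom_fixed[OF g.homh closure_autsD(3)[OF g(1)] Irr_K(1)[OF uc(1)] uc(1)]
          Irr_K(3)[OF uc(1)] by simp
      then show ?thesis unfolding Z_def g(3) using u uc by auto
    qed
    then show "map h us \<in> {vs. set vs \<subseteq> Z \<and> length vs = length us}" by auto
  qed
  ultimately show ?thesis using fin by (rule inj_on_finite)
qed

text \<open>An element outside \<open>K\<close> has a second conjugate by separability. Some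
  automorphism of \<open>A\<close> carries the element there, and by normality it restricts to an
  automorphism of \<open>E\<close>.\<close>

lemma galois_fixed_field:
  assumes "galois_extension A K E" and x: "x \<in> E" "\<And>h. h \<in> H \<Longrightarrow> h x = x"
  shows "x \<in> K"
proof (rule ccontr)
  assume nx: "x \<notin> K"
  have normal: "normal_extension A K E"
    and sep: "\<And>y. y \<in> carrier A \<Longrightarrow> alg_mult (Irr K x) y \<le> 1"
    using assms(1) x(1) unfolding galois_extension_def separable_extension_def by auto
  obtain y where y: "y \<in> carrier A" "y \<noteq> x" "eval (Irr K x) y = \<zero>"
    using separable_other_root[OF E_carrier[OF x(1)] nx sep] by blast
  obtain g where g: "g \<in> closure_auts" "g x = y"
    using conjugate_roots[OF E_carrier[OF x(1)] y(1,3)] by blast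
  have "restrict g E \<in> H"
    by (rule restrict_field_aut[OF subfield_E K_E g(1) normal_extension_image_eq[OF normal g(1)]])
  then show False using x(2)[of "restrict g E"] x(1) y(2) g(2) by simp
qed

lemma galois_finite_iff:
  assumes "galois_extension A K E"
  shows "finite H \<longleftrightarrow> finite_dimension K E"
  using finite_dimension_of_fixed_field galois_fixed_field[OF assms] finite_auts_of_finite_dimension
  by blast

end

section \<open>The separability element\<close>

context object_crossed_product
begin

interpretation RR: nonunital_ring_over R R0 by (rule R_nonunital_ring)

lemma left_mon_outside:
  assumes "r \<in> \<G>" "x \<in> tgt r" "b \<in> carrier R" "tgt k \<noteq> tgt r"
  shows "(umon x r \<otimes>\<^bsub>R\<^esub> b) k = \<zero>"
proof (cases "k \<in> \<G>")
  case True
  have F: "finite {r}" "{k. umon x r k \<noteq> \<zero>} \<subseteq> {r}" "{r} \<subseteq> \<G>"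
    using assms(1) by (auto simp: crossed_monom_def)
  have e: "{s \<in> {r}. tgt s = tgt k} = {}" using assms(4) by auto
  show ?thesis
    unfolding mult_coeff[OF mon_mem[OF assms(1,2)] assms(3) F True] e by simp
qed (rule mult_coeff_outside)

text \<open>Applied to the right factors of \<open>c_i\<close>, this makes \<open>c_i a\<close>
  vanish in the tensor square at every object \<open>i\<close> that is not a target in the support
  of \<open>a\<close>.\<close>

lemma left_mon_annihilates:
  assumes "r \<in> \<G>" "x \<in> tgt r" "b \<in> carrier R" "src r \<notin> tgt ` {s. b s \<noteq> \<zero>}"
  shows "umon x r \<otimes>\<^bsub>R\<^esub> b = (\<lambda>_. \<zero>)"
proof
  fix k
  show "(umon x r \<otimes>\<^bsub>R\<^esub> b) k = \<zero>"
  proof (cases "k \<in> \<G> \<and> tgt k = tgt r")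
    case True
    let ?s = "arrow_comp (inv_arrow r) k"
    have s: "?s \<in> \<G>" "src r = tgt ?s" "arrow_comp r ?s = k" using True assms(1) arrow_cancel(2) by auto
    have "b ?s = \<zero>" using assms(4) unfolding s(2) by blast
    moreover have "x \<in> carrier A" using conjugate_carrier[OF tgt_conjugate] assms(1,2) by blast
    ultimately show ?thesis
      using left_mon_coeff[OF assms(1-3) s(1,2)] act_hom(4)[OF assms(1)] beta_mem(3)[OF assms(1) s(1,2)]
      unfolding s(3) by simp
  next
    case False
    then show ?thesis using left_mon_outside[OF assms(1-3)] mult_coeff_outside by blast
  qed
qed

text \<open>The objects needed for \<open>a\<close> thus suffice for every product with
  \<open>a\<close> on the left, which keeps the index set of the section under control.\<close>

lemma mult_targets:
  assumes "a \<in> carrier R" "b \<in> carrier R"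
  shows "tgt ` {k. (a \<otimes>\<^bsub>R\<^esub> b) k \<noteq> \<zero>} \<subseteq> tgt ` {s. a s \<noteq> \<zero>}"
proof (rule image_subsetI)
  fix k assume "k \<in> {k. (a \<otimes>\<^bsub>R\<^esub> b) k \<noteq> \<zero>}"
  then have nz: "(a \<otimes>\<^bsub>R\<^esub> b) k \<noteq> \<zero>" by simp
  then have k: "k \<in> \<G>" using mult_coeff_outside by blast
  show "tgt k \<in> tgt ` {s. a s \<noteq> \<zero>}"
  proof (rule ccontr)
    assume "tgt k \<notin> tgt ` {s. a s \<noteq> \<zero>}"
    then have e: "{s \<in> {s. a s \<noteq> \<zero>}. tgt s = tgt k} = {}" by auto
    have "(a \<otimes>\<^bsub>R\<^esub> b) k = \<zero>"
      unfolding mult_coeff[OF assms support_finite[OF assms(1)] subset_refl support_arrows[OF assms(1)] k] e by simp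
    with nz show False by simp
  qed
qed

lemma R_finsum_coeff:
  assumes "finite F" "\<And>i. i \<in> F \<Longrightarrow> f i \<in> carrier R"
  shows "finsum R f F k = (\<Oplus>i\<in>F. f i k)"
  using assms
proof (induction F rule: finite_induct)
  case (insert i F)
  then have "f \<in> F \<rightarrow> carrier R" "f i \<in> carrier R" by auto
  with insert show ?case by (simp add: Pi_iff)
qed simp

lemma mon_finsum:
  assumes "finite F" "\<And>i. i \<in> F \<Longrightarrow> f i \<in> carrier A" "\<And>i. i \<in> F \<Longrightarrow> umon (f i) s \<in> carrier R"
  shows "(\<Oplus>\<^bsub>R\<^esub>i\<in>F. umon (f i) s) = umon (\<Oplus>i\<in>F. f i) s"
proof
  fix k
  have "(\<Oplus>\<^bsub>R\<^esub>i\<in>F. umon (f i) s) k = (\<Oplus>i\<in>F. umon (f i) s k)"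
    using R_finsum_coeff[of F "\<lambda>i. umon (f i) s" k] assms by simp
  also have "\<dots> = umon (\<Oplus>i\<in>F. f i) s k" by (simp add: crossed_monom_def)
  finally show "(\<Oplus>\<^bsub>R\<^esub>i\<in>F. umon (f i) s) k = umon (\<Oplus>i\<in>F. f i) s k" .
qed

section \<open>Arrows out of \<open>L\<close> and an element of trace one\<close>

text \<open>For a conjugate \<open>i\<close> this is a torsor under the automorphism group of
  \<open>L\<close>. Finiteness and the trace condition are transported from \<open>i = L\<close>
  along a fixed arrow.\<close>

definition arrows_from_L :: "'a set \<Rightarrow> 'a arrow set" where
  "arrows_from_L i = {s \<in> \<G>. src s = L \<and> tgt s = i}"

lemma arrows_from_L_comp:
  assumes t: "t \<in> \<G>"
  shows "bij_betw (arrow_comp t) (arrows_from_L (src t)) (arrows_from_L (tgt t))"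
proof (rule bij_betw_byWitness[of _ "arrow_comp (inv_arrow t)"])
  show "\<forall>s\<in>arrows_from_L (src t). arrow_comp (inv_arrow t) (arrow_comp t s) = s"
    "\<forall>s\<in>arrows_from_L (tgt t). arrow_comp t (arrow_comp (inv_arrow t) s) = s"
    using t arrow_cancel(1,2) by (auto simp: arrows_from_L_def)
  show "arrow_comp t ` arrows_from_L (src t) \<subseteq> arrows_from_L (tgt t)"
    "arrow_comp (inv_arrow t) ` arrows_from_L (tgt t) \<subseteq> arrows_from_L (src t)"
    using t by (intro image_subsetI; simp add: arrows_from_L_def)+
qed

lemma arrows_from_L_L: "arrows_from_L L = (\<lambda>h. Arrow L h L) ` field_auts A K L"
proof (intro subset_antisym subsetI)
  fix s assume "s \<in> arrows_from_L L"
  then have "s = Arrow L (act s) L" "s \<in> \<G>" unfolding arrows_from_L_def by (cases s; simp)+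
  then show "s \<in> (\<lambda>h. Arrow L h L) ` field_auts A K L" using field_auts_arrow by (metis image_eqI)
qed (auto simp: arrows_from_L_def field_auts_arrow[symmetric])

lemma ex_arrow_from_L: "i \<in> \<I> \<Longrightarrow> \<exists>g\<in>closure_auts. g ` L = i \<and> Arrow i (restrict g L) L \<in> \<G>"
  using arrowI[OF _ L_conjugate] unfolding conjugates_eq[OF subfield_L K_L] by blast

context
  assumes finite_auts: "finite (field_auts A K L)"
begin

lemma arrows_from_L_finite: "i \<in> \<I> \<Longrightarrow> finite (arrows_from_L i)"
proof -
  assume "i \<in> \<I>"
  then obtain g where "Arrow i (restrict g L) L \<in> \<G>" using ex_arrow_from_L by blast
  from arrows_from_L_comp[OF this] show ?thesis
    using bij_betw_finite finite_auts arrows_from_L_L by auto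
qed

text \<open>If \<open>g\<close> in \<open>closure_auts\<close> maps \<open>L\<close> onto
  \<open>i\<close>, the arrows from \<open>L\<close> to \<open>i\<close> are the composites of
  \<open>g\<close> with automorphisms of \<open>L\<close>. So the sum is \<open>g\<close> applied to
  the trace of \<open>b\<close>, and \<open>g\<close> fixes one.\<close>

lemma trace_one_arrows: "\<exists>b\<in>L. \<forall>i\<in>\<I>. (\<Oplus>s\<in>arrows_from_L i. act s b) = \<one>"
proof -
  interpret IF: intermediate_field A K L
    by (intro intermediate_field.intro algebraic_closure_of_axioms intermediate_field_axioms.intro
        subfield_L K_L)
  obtain b where b: "b \<in> L" "IF.trace b = \<one>" using IF.trace_one_exists[OF finite_auts] by blast
  have "(\<Oplus>s\<in>arrows_from_L i. act s b) = \<one>" if i: "i \<in> \<I>" for i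
  proof -
    obtain g where g: "g \<in> closure_auts" "g ` L = i" "Arrow i (restrict g L) L \<in> \<G>"
      using ex_arrow_from_L[OF i] by blast
    interpret g: ring_hom_ring A A g by (rule closure_autsD[OF g(1)])
    let ?t = "Arrow i (restrict g L) L"
    have bij: "bij_betw (\<lambda>h. arrow_comp ?t (Arrow L h L)) (field_auts A K L) (arrows_from_L i)"
    proof -
      have "bij_betw (\<lambda>h. Arrow L h L) (field_auts A K L) (arrows_from_L L)"
        unfolding bij_betw_def arrows_from_L_L by (auto simp: inj_on_def)
      from bij_betw_trans[OF this, of "arrow_comp ?t" "arrows_from_L i"] arrows_from_L_comp[OF g(3)]
      show ?thesis by (simp add: comp_def)
    qed
    have "(\<Oplus>s\<in>arrows_from_L i. act s b) =
        (\<Oplus>s\<in>(\<lambda>h. arrow_comp ?t (Arrow L h L)) ` field_auts A K L. act s b)"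
      using bij unfolding bij_betw_def by simp
    also have "\<dots> = (\<Oplus>h\<in>field_auts A K L. act (arrow_comp ?t (Arrow L h L)) b)"
    proof (rule add.finprod_reindex)
      show "inj_on (\<lambda>h. arrow_comp ?t (Arrow L h L)) (field_auts A K L)"
        using bij unfolding bij_betw_def by blast
      show "(\<lambda>s. act s b) \<in> (\<lambda>h. arrow_comp ?t (Arrow L h L)) ` field_auts A K L \<rightarrow> carrier A"
        using bij b act_carrier unfolding bij_betw_def by (auto simp: arrows_from_L_def)
    qed
    also have "\<dots> = (\<Oplus>h\<in>field_auts A K L. g (h b))"
      by (rule finsum_cong') (use b IF.aut_closed in auto)
    also have "\<dots> = g (IF.trace b)"
      unfolding IF.trace_def using g.hom_finsum[of "\<lambda>h. h b" "field_auts A K L"] b by (simp add: comp_def)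
    finally show ?thesis using b(2) by simp
  qed
  with b(1) show ?thesis by blast
qed

definition weight :: 'a where
  "weight = (SOME b. b \<in> L \<and> (\<forall>i\<in>\<I>. (\<Oplus>s\<in>arrows_from_L i. act s b) = \<one>))"

lemma weight: "weight \<in> L" "i \<in> \<I> \<Longrightarrow> (\<Oplus>s\<in>arrows_from_L i. act s weight) = \<one>"
proof -
  have "\<exists>b. b \<in> L \<and> (\<forall>i\<in>\<I>. (\<Oplus>s\<in>arrows_from_L i. act s b) = \<one>)" using trace_one_arrows by blast
  from someI_ex[OF this, folded weight_def]
  show "weight \<in> L" "i \<in> \<I> \<Longrightarrow> (\<Oplus>s\<in>arrows_from_L i. act s weight) = \<one>" by auto
qed

end

section \<open>Inverse monomials and Casimir elements\<close>

text \<open>A right inverse of \<open>u_s\<close> relative to the local identity at its target. With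
  \<open>t = inv_arrow s\<close>, the product of \<open>u_s\<close> and \<open>y u_t\<close> has
  coefficient \<open>act s y \<otimes> \<beta> s t\<close>, which is one for
  \<open>y = act t (inv (\<beta> s t))\<close>.\<close>

definition inv_mon :: "'a arrow \<Rightarrow> 'a arrow \<Rightarrow> 'a" where
  "inv_mon s = umon (act (inv_arrow s) (inv (\<beta> s (inv_arrow s)))) (inv_arrow s)"

lemma inv_mon_coeff_mem:
  assumes "s \<in> \<G>"
  shows "act (inv_arrow s) (inv (\<beta> s (inv_arrow s))) \<in> tgt (inv_arrow s)"
  using act_closed[of "inv_arrow s" "inv (\<beta> s (inv_arrow s))"] conjugate_props(6)[of "tgt s" "\<beta> s (inv_arrow s)"]
    beta_mem[of s "inv_arrow s"] assms by simp

lemma inv_mon_mem [simp, intro]: "s \<in> \<G> \<Longrightarrow> inv_mon s \<in> carrier R"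
  unfolding inv_mon_def by (intro mon_mem inv_mon_coeff_mem) simp_all

lemma one_mem_tgt: "s \<in> \<G> \<Longrightarrow> \<one> \<in> tgt s"
  using conjugate_props(2) by blast

lemma tgt_carrier: "\<lbrakk>s \<in> \<G>; x \<in> tgt s\<rbrakk> \<Longrightarrow> x \<in> carrier A"
  using conjugate_carrier[OF tgt_conjugate] by blast

lemma mon_inv_mon:
  assumes s: "s \<in> \<G>" and x: "x \<in> tgt s"
  shows "umon x s \<otimes>\<^bsub>R\<^esub> inv_mon s = umon x (id_arrow (tgt s))"
proof -
  let ?b = "\<beta> s (inv_arrow s)"
  have b: "?b \<in> tgt s" "?b \<noteq> \<zero>" "?b \<in> carrier A" using beta_mem[of s "inv_arrow s"] s by auto
  have ib: "inv ?b \<in> tgt s" "inv ?b \<in> carrier A" "inv ?b \<otimes> ?b = \<one>"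
    using conjugate_props(6)[OF tgt_conjugate[OF s] b(1,2)] tgt_carrier[OF s] b
      subfield_m_inv(3)[OF conjugate_subfield[OF tgt_conjugate[OF s]], of ?b] by auto
  have "act s (act (inv_arrow s) (inv ?b)) = inv ?b"
    using act_arrow_comp[of "inv ?b" "inv_arrow s" s] ib(1) s by simp
  then have "umon x s \<otimes>\<^bsub>R\<^esub> inv_mon s = umon (x \<otimes> inv ?b \<otimes> ?b) (id_arrow (tgt s))"
    unfolding inv_mon_def using mon_mult(1)[OF s inv_arrow(1)[OF s] x inv_mon_coeff_mem[OF s]] s by simp
  also have "x \<otimes> inv ?b \<otimes> ?b = x" using ib b tgt_carrier[OF s x] by (simp add: m_assoc)
  finally show ?thesis .
qed

lemma mon_id_left:
  assumes "s \<in> \<G>" "x \<in> tgt s" "y \<in> tgt s"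
  shows "umon x (id_arrow (tgt s)) \<otimes>\<^bsub>R\<^esub> umon y s = umon (x \<otimes> y) s"
  using mon_mult(1)[of "id_arrow (tgt s)" s x y] assms tgt_carrier conjugate_props(4) by simp

lemma mon_id_right:
  assumes "s \<in> \<G>" "x \<in> tgt s"
  shows "umon x s \<otimes>\<^bsub>R\<^esub> umon \<one> (id_arrow (src s)) = umon x s"
  using mon_mult(1)[of s "id_arrow (src s)" x \<one>] assms tgt_carrier conjugate_props(2) by (simp add: act_hom)

lemma mon_id_R0: "\<lbrakk>i \<in> \<I>; x \<in> i\<rbrakk> \<Longrightarrow> umon x (id_arrow i) \<in> R0"
  unfolding crossed_product_0_def using mon_mem[of "id_arrow i" x] by (auto simp: crossed_monom_def)

context
  assumes finite_auts: "finite (field_auts A K L)"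
begin

text \<open>A representative in the free group of the element \<open>c_i\<close>; its commutation
  rule therefore holds only modulo the kernel.\<close>

definition casimir :: "'a set \<Rightarrow> (('a arrow \<Rightarrow> 'a) \<times> ('a arrow \<Rightarrow> 'a) \<Rightarrow>\<^sub>0 int)" where
  "casimir i = (\<Sum>s\<in>arrows_from_L i. frag_of (umon (act s weight) s, inv_mon s))"

lemma weight_arrow:
  assumes "s \<in> arrows_from_L i"
  shows "s \<in> \<G>" "src s = L" "tgt s = i" "act s weight \<in> tgt s"
  using assms act_closed[of s weight] weight(1)[OF finite_auts] unfolding arrows_from_L_def by auto

lemma casimir_keys: "RR.supported (casimir i)"
proof -
  have "casimir i \<in> carrier (free_pairs R)"
    unfolding casimir_def
  proof (rule sum_closed_free_Abelian_group)
    fix s assume "s \<in> arrows_from_L i"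
    note s = weight_arrow[OF this]
    show "frag_of (umon (act s weight) s, inv_mon s) \<in> carrier (free_pairs R)"
      using mon_mem[OF s(1,4)] inv_mon_mem[OF s(1)] by simp
  qed
  then show ?thesis by simp
qed

text \<open>Each summand multiplies to \<open>act s weight\<close> at the identity arrow of
  \<open>i\<close>, and these coefficients add up to one by the choice of
  \<open>weight\<close>.\<close>

lemma casimir_mult: "i \<in> \<I> \<Longrightarrow> frag_mult R (casimir i) = umon \<one> (id_arrow i)"
proof -
  assume i: "i \<in> \<I>"
  note fin = arrows_from_L_finite[OF finite_auts i]
  have "frag_mult R (casimir i) = (\<Oplus>\<^bsub>R\<^esub>s\<in>arrows_from_L i. frag_mult R (frag_of (umon (act s weight) s, inv_mon s)))"
    unfolding casimir_def by (rule RR.frag_mult_sum[OF fin]) (use weight_arrow in auto)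
  also have "\<dots> = (\<Oplus>\<^bsub>R\<^esub>s\<in>arrows_from_L i. umon (act s weight) (id_arrow i))"
  proof (rule RR.finsum_cong')
    fix s assume "s \<in> arrows_from_L i"
    note s = weight_arrow[OF this]
    show "frag_mult R (frag_of (umon (act s weight) s, inv_mon s)) = umon (act s weight) (id_arrow i)"
      using mon_inv_mon[OF s(1,4)] s by simp
  qed (use weight_arrow i in auto)
  also have "\<dots> = umon (\<Oplus>s\<in>arrows_from_L i. act s weight) (id_arrow i)"
    by (rule mon_finsum[OF fin]) (use weight_arrow i conjugate_carrier[OF i] in auto)
  also have "\<dots> = umon \<one> (id_arrow i)" using weight(2)[OF finite_auts i] by simp
  finally show ?thesis .
qed

text \<open>After the reindexing \<open>p = t q\<close> the summands match one by one. The element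
  \<open>e = u_p\<^sup>-\<^sup>1 (y u_t) u_q\<close> has the identity of \<open>L\<close> as its
  degree, so it lies in \<open>R0\<close> and may cross the tensor sign: on the left,
  \<open>p(b) u_p e\<close> is \<open>y u_t q(b) u_q\<close>; on the right,
  \<open>e u_q\<^sup>-\<^sup>1\<close> is \<open>u_p\<^sup>-\<^sup>1 y u_t\<close>.\<close>

lemma casimir_central:
  assumes t: "t \<in> \<G>" and y: "y \<in> tgt t"
  shows "RR.lmap (umon y t) (casimir (src t)) - RR.rmap (umon y t) (casimir (tgt t)) \<in> tensor_kernel R R0"
proof -
  let ?B = "arrows_from_L (src t)"
  note fin = arrows_from_L_finite[OF finite_auts]
  note yR = mon_mem[OF t y]
  have l: "RR.lmap (umon y t) (casimir (src t)) =
      (\<Sum>q\<in>?B. frag_of (umon y t \<otimes>\<^bsub>R\<^esub> umon (act q weight) q, inv_mon q))"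
    unfolding casimir_def frag_extend_sum[OF fin[OF src_conjugate[OF t]]] by (simp add: comp_def)
  have "RR.rmap (umon y t) (casimir (tgt t)) =
      (\<Sum>p\<in>arrows_from_L (tgt t). frag_of (umon (act p weight) p, inv_mon p \<otimes>\<^bsub>R\<^esub> umon y t))"
    unfolding casimir_def frag_extend_sum[OF fin[OF tgt_conjugate[OF t]]] by (simp add: comp_def)
  also have "\<dots> = (\<Sum>q\<in>?B. frag_of (umon (act (arrow_comp t q) weight) (arrow_comp t q),
      inv_mon (arrow_comp t q) \<otimes>\<^bsub>R\<^esub> umon y t))"
    by (rule sum.reindex_bij_betw[symmetric, OF arrows_from_L_comp[OF t]])
  finally have r: "RR.rmap (umon y t) (casimir (tgt t)) = \<dots>" .
  show ?thesis
    unfolding l r sum_subtractf[symmetric]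
  proof (rule RR.tensor_kernel_sum)
    fix q assume q': "q \<in> ?B"
    note q = weight_arrow[OF q']
    let ?p = "arrow_comp t q"
    have tq: "src t = tgt q" using q by simp
    have p: "?p \<in> \<G>" "tgt ?p = tgt t" "src ?p = L" using t q by auto
    have pw: "act ?p weight \<in> tgt ?p" using act_closed[OF p(1)] p(3) weight(1)[OF finite_auts] by simp
    define a where "a = act ?p weight"
    have a: "a \<in> tgt t" using pw unfolding a_def p(2) .
    note o = one_mem_tgt[OF q(1)]
    note R = mon_mem[OF p(1) pw] inv_mon_mem[OF p(1)] yR mon_mem[OF q(1) o] inv_mon_mem[OF q(1)]
    define e where "e = (inv_mon ?p \<otimes>\<^bsub>R\<^esub> umon y t) \<otimes>\<^bsub>R\<^esub> umon \<one> q"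
    have b: "\<beta> t q \<in> tgt t" "\<beta> t q \<in> carrier A" using beta_mem[OF t q(1) tq] by auto
    have yq: "umon y t \<otimes>\<^bsub>R\<^esub> umon \<one> q = umon (y \<otimes> \<beta> t q) ?p"
      using mon_mult(1)[OF t q(1) y o tq] tgt_carrier[OF t y] by (simp add: act_hom[OF t])
    have yb: "y \<otimes> \<beta> t q \<in> tgt ?p" using conjugate_props(4)[OF tgt_conjugate[OF t] y b(1)] p(2) by simp
    have e: "e \<in> R0"
    proof -
      have "e = inv_mon ?p \<otimes>\<^bsub>R\<^esub> umon (y \<otimes> \<beta> t q) ?p"
        unfolding e_def yq[symmetric] by (rule R_assoc[OF R(2-4)])
      also have "\<dots> = umon (act (inv_arrow ?p) (inv (\<beta> ?p (inv_arrow ?p))) \<otimes>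
          act (inv_arrow ?p) (y \<otimes> \<beta> t q) \<otimes> \<beta> (inv_arrow ?p) ?p) (id_arrow (src ?p))"
        unfolding inv_mon_def
        using mon_mult(1)[OF inv_arrow(1)[OF p(1)] p(1) inv_mon_coeff_mem[OF p(1)] yb] inv_arrow[OF p(1)] by simp
      also have "\<dots> \<in> R0"
      proof (rule mon_id_R0)
        have "act (inv_arrow ?p) (inv (\<beta> ?p (inv_arrow ?p))) \<in> src ?p"
          using inv_mon_coeff_mem[OF p(1)] inv_arrow[OF p(1)] by simp
        moreover have "act (inv_arrow ?p) (y \<otimes> \<beta> t q) \<in> src ?p"
          using act_closed[OF inv_arrow(1)[OF p(1)]] yb inv_arrow[OF p(1)] by simp
        moreover have "\<beta> (inv_arrow ?p) ?p \<in> src ?p"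
          using beta_mem(1)[OF inv_arrow(1)[OF p(1)] p(1)] inv_arrow[OF p(1)] by simp
        ultimately show "act (inv_arrow ?p) (inv (\<beta> ?p (inv_arrow ?p))) \<otimes>
          act (inv_arrow ?p) (y \<otimes> \<beta> t q) \<otimes> \<beta> (inv_arrow ?p) ?p \<in> src ?p"
          using conjugate_props(4)[OF src_conjugate[OF p(1)]] by blast
      qed (rule src_conjugate[OF p(1)])
      finally show ?thesis .
    qed
    have "e \<otimes>\<^bsub>R\<^esub> inv_mon q = (inv_mon ?p \<otimes>\<^bsub>R\<^esub> umon y t) \<otimes>\<^bsub>R\<^esub> (umon \<one> q \<otimes>\<^bsub>R\<^esub> inv_mon q)"
      unfolding e_def by (rule R_assoc[OF R_mult_closed[OF R(2,3)] R(4,5)])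
    also have "\<dots> = inv_mon ?p \<otimes>\<^bsub>R\<^esub> (umon y t \<otimes>\<^bsub>R\<^esub> umon \<one> (id_arrow (src t)))"
      unfolding mon_inv_mon[OF q(1) o] tq[symmetric]
      by (rule R_assoc[OF R(2,3)]) (use t conjugate_props(2) in auto)
    also have "\<dots> = inv_mon ?p \<otimes>\<^bsub>R\<^esub> umon y t" unfolding mon_id_right[OF t y] ..
    finally have e1: "e \<otimes>\<^bsub>R\<^esub> inv_mon q = inv_mon ?p \<otimes>\<^bsub>R\<^esub> umon y t" .
    have "umon a ?p \<otimes>\<^bsub>R\<^esub> e = umon a ?p \<otimes>\<^bsub>R\<^esub> (inv_mon ?p \<otimes>\<^bsub>R\<^esub> umon (y \<otimes> \<beta> t q) ?p)"
      unfolding e_def yq[symmetric] by (subst R_assoc[OF R(2-4)]) (rule refl)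
    also have "\<dots> = (umon a ?p \<otimes>\<^bsub>R\<^esub> inv_mon ?p) \<otimes>\<^bsub>R\<^esub> umon (y \<otimes> \<beta> t q) ?p"
      using R_assoc[OF R(1,2) mon_mem[OF p(1) yb]] unfolding a_def by simp
    also have "\<dots> = umon (a \<otimes> (y \<otimes> \<beta> t q)) ?p"
      using mon_inv_mon[OF p(1) pw] mon_id_left[OF p(1) pw yb] unfolding a_def by simp
    \<comment> \<open>Commutativity of the field moves \<open>a = t(q(b))\<close> behind
      \<open>y\<close>, where it is the twist of \<open>q(b)\<close> produced by
      \<open>u_t\<close>.\<close>
    also have "a \<otimes> (y \<otimes> \<beta> t q) = y \<otimes> a \<otimes> \<beta> t q"
      using tgt_carrier[OF t] a y b by (simp add: m_ac)
    also have "umon (y \<otimes> a \<otimes> \<beta> t q) ?p = umon y t \<otimes>\<^bsub>R\<^esub> umon (act q weight) q"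
      using mon_mult(1)[OF t q(1) y q(4) tq] weight(1)[OF finite_auts] q(2) unfolding a_def by simp
    finally have e2: "umon a ?p \<otimes>\<^bsub>R\<^esub> e = umon y t \<otimes>\<^bsub>R\<^esub> umon (act q weight) q" .
    show "frag_of (umon y t \<otimes>\<^bsub>R\<^esub> umon (act q weight) q, inv_mon q) -
        frag_of (umon (act ?p weight) ?p, inv_mon ?p \<otimes>\<^bsub>R\<^esub> umon y t) \<in> tensor_kernel R R0"
      using RR.tensor_balanced[OF R(1) e R(5)] unfolding e1 e2[unfolded a_def] .
  qed
qed

section \<open>The bimodule section\<close>

definition targets :: "('a arrow \<Rightarrow> 'a) \<Rightarrow> 'a set set" where
  "targets a = tgt ` {s. a s \<noteq> \<zero>}"

lemma targets:
  assumes "a \<in> carrier R"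
  shows "finite (targets a)" "targets a \<subseteq> \<I>"
  using assms support_arrows[OF assms] unfolding targets_def by auto

text \<open>Stands for the sum of \<open>c_i a\<close> over all conjugates \<open>i\<close>, which
  may be infinite in number; only the objects in \<open>targets a\<close> can contribute modulo the
  kernel.\<close>

definition section_map :: "('a arrow \<Rightarrow> 'a) \<Rightarrow> (('a arrow \<Rightarrow> 'a) \<times> ('a arrow \<Rightarrow> 'a) \<Rightarrow>\<^sub>0 int)" where
  "section_map a = (\<Sum>i\<in>targets a. RR.rmap a (casimir i))"

lemma rmap_casimir_zero:
  assumes a: "a \<in> carrier R" and i: "i \<in> \<I>" "i \<notin> targets a"
  shows "RR.rmap a (casimir i) \<in> tensor_kernel R R0"
proof -
  have "RR.rmap a (casimir i) = (\<Sum>s\<in>arrows_from_L i. frag_of (umon (act s weight) s, inv_mon s \<otimes>\<^bsub>R\<^esub> a))"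
    unfolding casimir_def frag_extend_sum[OF arrows_from_L_finite[OF finite_auts i(1)]] by (simp add: comp_def)
  also have "\<dots> \<in> tensor_kernel R R0"
  proof (rule RR.tensor_kernel_sum)
    fix s assume "s \<in> arrows_from_L i"
    note s = weight_arrow[OF this]
    have "inv_mon s \<otimes>\<^bsub>R\<^esub> a = \<zero>\<^bsub>R\<^esub>"
      unfolding inv_mon_def R_sel
      by (rule left_mon_annihilates[OF _ inv_mon_coeff_mem a]) (use s i in \<open>auto simp: targets_def\<close>)
    then show "frag_of (umon (act s weight) s, inv_mon s \<otimes>\<^bsub>R\<^esub> a) \<in> tensor_kernel R R0"
      using RR.tensor_zero_right[OF mon_mem[OF s(1,4)]] by simp
  qed
  finally show ?thesis .
qed

text \<open>The index set in \<open>section_map\<close> varies with its argument. Passing to a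
  common larger set \<open>J\<close> changes the value only by kernel elements, so different
  arguments become comparable.\<close>

lemma section_map_extend:
  assumes a: "a \<in> carrier R" and J: "finite J" "targets a \<subseteq> J" "J \<subseteq> \<I>"
  shows "section_map a - (\<Sum>i\<in>J. RR.rmap a (casimir i)) \<in> tensor_kernel R R0"
proof -
  have "(\<Sum>i\<in>J. RR.rmap a (casimir i)) = (\<Sum>i\<in>J - targets a. RR.rmap a (casimir i)) + section_map a"
    unfolding section_map_def by (rule sum.subset_diff[OF J(2,1)])
  moreover have "(\<Sum>i\<in>J - targets a. RR.rmap a (casimir i)) \<in> tensor_kernel R R0"
    by (rule RR.tensor_kernel_sum) (use rmap_casimir_zero[OF a] J(3) in auto)
  ultimately show ?thesis using RR.tensor_kernel_uminus by simp
qed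

lemma section_map_keys:
  assumes "a \<in> carrier R"
  shows "RR.supported (section_map a)"
  using sum_closed_free_Abelian_group[of "targets a" "\<lambda>i. RR.rmap a (casimir i)"]
    RR.rmap_keys[OF assms casimir_keys] unfolding section_map_def by simp

lemma section_map_add:
  assumes a: "a \<in> carrier R" and b: "b \<in> carrier R"
  shows "section_map (\<lambda>s. a s \<oplus> b s) - (section_map a + section_map b) \<in> tensor_kernel R R0"
proof -
  define J where "J = targets a \<union> targets b"
  have J: "finite J" "J \<subseteq> \<I>" "targets a \<subseteq> J" "targets b \<subseteq> J"
    using targets a b unfolding J_def by auto
  have "{s. a s \<oplus> b s \<noteq> \<zero>} \<subseteq> {s. a s \<noteq> \<zero>} \<union> {s. b s \<noteq> \<zero>}" by auto
  then have Jab: "targets (\<lambda>s. a s \<oplus> b s) \<subseteq> J" unfolding J_def targets_def by blast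
  let ?S = "\<lambda>c. \<Sum>i\<in>J. RR.rmap c (casimir i)"
  let ?c = "\<lambda>s. a s \<oplus> b s"
  have "(\<Sum>i\<in>J. RR.rmap ?c (casimir i) - (RR.rmap a (casimir i) + RR.rmap b (casimir i))) \<in> tensor_kernel R R0"
    by (rule RR.tensor_kernel_sum) (use RR.rmap_add[OF a b casimir_keys] in simp)
  then have 1: "?S ?c - (?S a + ?S b) \<in> tensor_kernel R R0"
    by (simp add: sum_subtractf sum.distrib)
  have 2: "section_map ?c - ?S ?c \<in> tensor_kernel R R0"
    by (rule section_map_extend[OF R_add_closed[OF a b] J(1) Jab J(2)])
  have 3: "?S a - section_map a \<in> tensor_kernel R R0" "?S b - section_map b \<in> tensor_kernel R R0"
    using RR.tensor_kernel_sym section_map_extend[OF a J(1,3,2)] section_map_extend[OF b J(1,4,2)] by auto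
  have 4: "(?S a + ?S b) - (section_map a + section_map b) \<in> tensor_kernel R R0"
    using RR.tensor_kernel_add[OF 3] by (simp add: algebra_simps)
  show ?thesis by (rule RR.tensor_kernel_trans[OF 2 RR.tensor_kernel_trans[OF 1 4]])
qed

text \<open>Term by term \<open>(c_i a) s = c_i (a s)\<close>, summed over the index set of
  \<open>a\<close>, which contains that of \<open>a s\<close>.\<close>

lemma section_map_right:
  assumes s: "s \<in> carrier R" and a: "a \<in> carrier R"
  shows "section_map (a \<otimes>\<^bsub>R\<^esub> s) - RR.rmap s (section_map a) \<in> tensor_kernel R R0"
proof -
  have "RR.rmap s (section_map a) = (\<Sum>i\<in>targets a. RR.rmap (a \<otimes>\<^bsub>R\<^esub> s) (casimir i))"
    unfolding section_map_def frag_extend_sum[OF targets(1)[OF a]]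
    using RR.rmap_rmap[OF s a casimir_keys] by (simp add: comp_def)
  then show ?thesis
    using section_map_extend[OF R_mult_closed[OF a s] targets(1)[OF a] _ targets(2)[OF a]]
      mult_targets[OF a s] unfolding targets_def by simp
qed

lemma section_map_zero: "section_map (\<lambda>_. \<zero>) = 0"
  by (simp add: section_map_def targets_def)

text \<open>For composable arrows this is the commutation rule between the Casimir elements at the
  two ends of \<open>t\<close>. Otherwise the product vanishes, and \<open>y u_t\<close> kills every
  left factor of the element attached to \<open>tgt r\<close>.\<close>

lemma section_map_left_mon:
  assumes t: "t \<in> \<G>" "y \<in> tgt t" and r: "r \<in> \<G>" "x \<in> tgt r"
  shows "section_map (umon y t \<otimes>\<^bsub>R\<^esub> umon x r) - RR.lmap (umon y t) (section_map (umon x r)) \<in> tensor_kernel R R0"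
proof -
  note yR = mon_mem[OF t] and xR = mon_mem[OF r]
  let ?c = "casimir (tgt r)"
  have x: "section_map (umon x r) - RR.rmap (umon x r) ?c \<in> tensor_kernel R R0"
  proof -
    \<comment> \<open>Only an inclusion: for \<open>x = \<zero>\<close> the monomial has no targets
      at all.\<close>
    have "targets (umon x r) \<subseteq> {tgt r}" by (auto simp: targets_def crossed_monom_def)
    from section_map_extend[OF xR _ this] show ?thesis using r(1) by simp
  qed
  have lx: "RR.lmap (umon y t) (RR.rmap (umon x r) ?c) - RR.lmap (umon y t) (section_map (umon x r)) \<in> tensor_kernel R R0"
    using RR.lmap_kernel[OF yR RR.tensor_kernel_sym[OF x]] by (simp add: frag_extend_diff)
  show ?thesis
  proof (cases "src t = tgt r")
    case True
    have c: "RR.rmap (umon y t) (casimir (tgt t)) - RR.lmap (umon y t) ?c \<in> tensor_kernel R R0"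
      using RR.tensor_kernel_sym[OF casimir_central[OF t]] unfolding True .
    have "RR.rmap (umon x r) (RR.rmap (umon y t) (casimir (tgt t))) - RR.rmap (umon x r) (RR.lmap (umon y t) ?c) \<in> tensor_kernel R R0"
      using RR.rmap_kernel[OF xR c] by (simp add: frag_extend_diff)
    then have 1: "RR.rmap (umon y t \<otimes>\<^bsub>R\<^esub> umon x r) (casimir (tgt t)) - RR.lmap (umon y t) (RR.rmap (umon x r) ?c) \<in> tensor_kernel R R0"
      unfolding RR.rmap_rmap[OF xR yR casimir_keys] RR.lmap_rmap[OF yR xR casimir_keys] .
    have sub: "targets (umon y t \<otimes>\<^bsub>R\<^esub> umon x r) \<subseteq> {tgt t}"
      using mult_targets[OF yR xR] by (auto simp: targets_def crossed_monom_def split: if_splits)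
    have "section_map (umon y t \<otimes>\<^bsub>R\<^esub> umon x r) - RR.rmap (umon y t \<otimes>\<^bsub>R\<^esub> umon x r) (casimir (tgt t)) \<in> tensor_kernel R R0"
      using section_map_extend[OF R_mult_closed[OF yR xR] _ sub] t(1) by simp
    from RR.tensor_kernel_trans[OF RR.tensor_kernel_trans[OF this 1] lx] show ?thesis .
  next
    case False
    have "RR.lmap (umon y t) ?c = (\<Sum>s\<in>arrows_from_L (tgt r). frag_of (umon y t \<otimes>\<^bsub>R\<^esub> umon (act s weight) s, inv_mon s))"
      unfolding casimir_def frag_extend_sum[OF arrows_from_L_finite[OF finite_auts tgt_conjugate[OF r(1)]]]
      by (simp add: comp_def)
    also have "\<dots> \<in> tensor_kernel R R0"
    proof (rule RR.tensor_kernel_sum)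
      fix s assume "s \<in> arrows_from_L (tgt r)"
      note s = weight_arrow[OF this]
      have "umon y t \<otimes>\<^bsub>R\<^esub> umon (act s weight) s = \<zero>\<^bsub>R\<^esub>"
        using mon_mult(2)[OF t(1) s(1) t(2) s(4)] False s(3) by simp
      then show "frag_of (umon y t \<otimes>\<^bsub>R\<^esub> umon (act s weight) s, inv_mon s) \<in> tensor_kernel R R0"
        using RR.tensor_zero_left[OF inv_mon_mem[OF s(1)]] by simp
    qed
    finally have "RR.lmap (umon y t) (RR.rmap (umon x r) ?c) \<in> tensor_kernel R R0"
      unfolding RR.lmap_rmap[OF yR xR casimir_keys] using RR.rmap_kernel[OF xR] by blast
    then have "RR.lmap (umon y t) (section_map (umon x r)) \<in> tensor_kernel R R0"
      using RR.tensor_kernel_diff[OF _ lx] by fastforce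
    then show ?thesis
      unfolding mon_mult(2)[OF t(1) r(1) t(2) r(2) False] section_map_zero using RR.tensor_kernel_uminus by simp
  qed
qed

text \<open>Both sides are additive in either argument modulo the kernel, which reduces the claim to
  monomials; the right argument is treated before the left one.\<close>

lemma section_map_left:
  assumes s: "s \<in> carrier R" and a: "a \<in> carrier R"
  shows "section_map (s \<otimes>\<^bsub>R\<^esub> a) - RR.lmap s (section_map a) \<in> tensor_kernel R R0"
proof -
  have 1: "section_map (umon y t \<otimes>\<^bsub>R\<^esub> a) - RR.lmap (umon y t) (section_map a) \<in> tensor_kernel R R0"
    if t: "t \<in> \<G>" "y \<in> tgt t" for y t
    using a
  proof (induction a rule: R_induct)
    case zero
    then show ?case using mon_mem[OF t] by (simp add: R_zero_mult section_map_zero)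
  next
    case (mon r x)
    then show ?case using section_map_left_mon t by blast
  next
    case (add a b)
    let ?u = "umon y t"
    note u = mon_mem[OF t]
    note m = R_mult_closed[OF u add(1)] R_mult_closed[OF u add(2)]
    have "section_map (?u \<otimes>\<^bsub>R\<^esub> (\<lambda>s. a s \<oplus> b s)) - (section_map (?u \<otimes>\<^bsub>R\<^esub> a) + section_map (?u \<otimes>\<^bsub>R\<^esub> b)) \<in> tensor_kernel R R0"
      unfolding R_distr(2)[OF add(1,2) u] by (rule section_map_add[OF m])
    moreover have "RR.lmap ?u (section_map (\<lambda>s. a s \<oplus> b s)) - (RR.lmap ?u (section_map a) + RR.lmap ?u (section_map b)) \<in> tensor_kernel R R0"
      using RR.lmap_kernel[OF u section_map_add[OF add(1,2)]] by (simp add: frag_extend_diff frag_extend_add)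
    ultimately show ?case using add(3,4) by (rule RR.tensor_kernel_combine)
  qed
  note k = section_map_keys[OF a]
  show ?thesis
    using s
  proof (induction s rule: R_induct)
    case zero
    \<comment> \<open>Additivity in the ring element, taken at zero plus zero, leaves the negative
      of this term.\<close>
    have "RR.lmap (\<lambda>_. \<zero>) (section_map a) \<in> tensor_kernel R R0"
      using RR.tensor_kernel_uminus[OF RR.lmap_add[OF RR.zero_closed RR.zero_closed k]] by simp
    then show ?case using a RR.tensor_kernel_uminus by (simp add: R_zero_mult section_map_zero)
  next
    case (mon r x)
    then show ?case using 1 by blast
  next
    case (add s r)
    note m = R_mult_closed[OF add(1) a] R_mult_closed[OF add(2) a]
    have "section_map ((\<lambda>k. s k \<oplus> r k) \<otimes>\<^bsub>R\<^esub> a) - (section_map (s \<otimes>\<^bsub>R\<^esub> a) + section_map (r \<otimes>\<^bsub>R\<^esub> a)) \<in> tensor_kernel R R0"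
      unfolding R_distr(1)[OF add(1,2) a] by (rule section_map_add[OF m])
    moreover have "RR.lmap (\<lambda>k. s k \<oplus> r k) (section_map a) - (RR.lmap s (section_map a) + RR.lmap r (section_map a)) \<in> tensor_kernel R R0"
      using RR.lmap_add[OF add(1,2) k] by simp
    ultimately show ?case using add(3,4) by (rule RR.tensor_kernel_combine)
  qed
qed

text \<open>Multiplication by the local identity at \<open>i\<close> keeps exactly the coefficients
  of \<open>a\<close> at arrows with target \<open>i\<close>, so summing over the targets restores
  \<open>a\<close>.\<close>

lemma section_map_mult:
  assumes a: "a \<in> carrier R"
  shows "frag_mult R (section_map a) = a"
proof
  fix k
  have id: "umon \<one> (id_arrow i) \<in> carrier R" if "i \<in> \<I>" for i
    using mon_mem[of "id_arrow i" \<one>] that conjugate_props(2) by simp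
  have coeff: "(umon \<one> (id_arrow i) \<otimes>\<^bsub>R\<^esub> a) k = (if tgt k = i then a k else \<zero>)" if i: "i \<in> \<I>" "k \<in> \<G>" for i
    using left_mon_coeff[of "id_arrow i" \<one> a k] left_mon_outside[of "id_arrow i" \<one> a k] i a
      conjugate_props(2) coeff_mem[OF a i(2)] by auto
  have "frag_mult R (section_map a) = (\<Oplus>\<^bsub>R\<^esub>i\<in>targets a. frag_mult R (RR.rmap a (casimir i)))"
    unfolding section_map_def by (rule RR.frag_mult_sum[OF targets(1)[OF a] RR.rmap_keys[OF a casimir_keys]])
  also have "\<dots> = (\<Oplus>\<^bsub>R\<^esub>i\<in>targets a. umon \<one> (id_arrow i) \<otimes>\<^bsub>R\<^esub> a)"
    by (rule RR.finsum_cong')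
      (use targets(2)[OF a] id a in \<open>auto simp: RR.frag_mult_rmap[OF a casimir_keys] casimir_mult R_mult_closed subset_iff\<close>)
  finally have eq: "frag_mult R (section_map a) k = (\<Oplus>i\<in>targets a. (umon \<one> (id_arrow i) \<otimes>\<^bsub>R\<^esub> a) k)"
    using R_finsum_coeff[OF targets(1)[OF a], of "\<lambda>i. umon \<one> (id_arrow i) \<otimes>\<^bsub>R\<^esub> a"] targets(2)[OF a] id a R_mult_closed
    by auto
  show "frag_mult R (section_map a) k = a k"
  proof (cases "a k = \<zero>")
    case True
    have "(umon \<one> (id_arrow i) \<otimes>\<^bsub>R\<^esub> a) k = \<zero>" if "i \<in> targets a" for i
      using coeff[of i] that True targets(2)[OF a] by (cases "k \<in> \<G>") (auto simp: mult_coeff_outside)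
    then have "(\<Oplus>i\<in>targets a. (umon \<one> (id_arrow i) \<otimes>\<^bsub>R\<^esub> a) k) = (\<Oplus>i\<in>targets a. \<zero>)"
      by (intro finsum_cong') simp_all
    then show ?thesis unfolding eq True by simp
  next
    case False
    then have k: "k \<in> \<G>" "tgt k \<in> targets a" using support_arrows[OF a] unfolding targets_def by auto
    have "(\<Oplus>i\<in>targets a. (umon \<one> (id_arrow i) \<otimes>\<^bsub>R\<^esub> a) k) = (umon \<one> (id_arrow (tgt k)) \<otimes>\<^bsub>R\<^esub> a) k"
    proof (rule finsum_single[OF abelian_monoid_axioms targets(1)[OF a] k(2)])
      show "(umon \<one> (id_arrow (tgt k)) \<otimes>\<^bsub>R\<^esub> a) k \<in> carrier A"
        using coeff[of "tgt k"] k(1) a by simp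
      show "(umon \<one> (id_arrow j) \<otimes>\<^bsub>R\<^esub> a) k = \<zero>" if j: "j \<in> targets a" "j \<noteq> tgt k" for j
        using coeff[of j] k(1) j targets(2)[OF a] by (metis subsetD)
    qed
    then show ?thesis unfolding eq using coeff[of "tgt k"] k by simp
  qed
qed

lemma finite_auts_imp_separable: "separable_over R R0"
  by (rule RR.separable_overI[of section_map])
    (simp_all add: section_map_keys section_map_add section_map_left section_map_right section_map_mult)

end

lemma separable_iff_finite_auts: "separable_over R R0 \<longleftrightarrow> finite (field_auts A K L)"
  using separable_imp_finite_auts finite_auts_imp_separable by blast

text \<open>A normal \<open>L\<close> is its own only conjugate, so elements of \<open>R0\<close>
  are supported on one identity arrow. The idempotent there is then also the \<open>one\<close>
  field of the record, as a unital homomorphism requires.\<close>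

lemma normal_mon_iso:
  assumes normal: "normal_extension A K L"
  shows "(\<lambda>x. umon x (id_arrow L)) \<in> ring_iso (A\<lparr>carrier := L\<rparr>) (R\<lparr>carrier := R0\<rparr>)"
proof -
  have I: "\<I> = {L}"
    using L_conjugate normal_extension_image_eq[OF normal] unfolding conjugates_eq[OF subfield_L K_L] by auto
  have id: "id_arrow L \<in> \<G>" using L_conjugate by simp
  have c: "x \<in> carrier A" if "x \<in> L" for x using conjugate_carrier L_conjugate that by blast
  have "(\<lambda>x. umon x (id_arrow L)) \<in> ring_hom (A\<lparr>carrier := L\<rparr>) (R\<lparr>carrier := R0\<rparr>)"
  proof (rule ring_hom_memI)
    fix x y assume xy: "x \<in> carrier (A\<lparr>carrier := L\<rparr>)" "y \<in> carrier (A\<lparr>carrier := L\<rparr>)"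
    then show "umon (x \<otimes>\<^bsub>A\<lparr>carrier := L\<rparr>\<^esub> y) (id_arrow L) = umon x (id_arrow L) \<otimes>\<^bsub>R\<lparr>carrier := R0\<rparr>\<^esub> umon y (id_arrow L)"
      using mon_id_left[OF id] by simp
    show "umon (x \<oplus>\<^bsub>A\<lparr>carrier := L\<rparr>\<^esub> y) (id_arrow L) = umon x (id_arrow L) \<oplus>\<^bsub>R\<lparr>carrier := R0\<rparr>\<^esub> umon y (id_arrow L)"
      using mon_add xy c by simp
  next
    show "umon x (id_arrow L) \<in> carrier (R\<lparr>carrier := R0\<rparr>)" if "x \<in> carrier (A\<lparr>carrier := L\<rparr>)" for x
      using mon_id_R0[OF L_conjugate] that by simp
  qed (auto simp: I crossed_monom_def)
  moreover have "bij_betw (\<lambda>x. umon x (id_arrow L)) L R0"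
  proof (rule bij_betw_byWitness[of _ "\<lambda>a. a (id_arrow L)"])
    show "\<forall>a\<in>R0. umon (a (id_arrow L)) (id_arrow L) = a"
    proof (intro ballI ext)
      fix a s assume "a \<in> R0"
      then show "umon (a (id_arrow L)) (id_arrow L) s = a s"
        using R0_D(2)[of a s] unfolding I crossed_monom_def by (cases "a s = \<zero>") auto
    qed
    show "(\<lambda>a. a (id_arrow L)) ` R0 \<subseteq> L" using coeff_mem[OF R0_D(1) id] by auto
    show "(\<lambda>x. umon x (id_arrow L)) ` L \<subseteq> R0" by (rule image_subsetI[OF mon_id_R0[OF L_conjugate]])
  qed (simp add: crossed_monom_def)
  ultimately show ?thesis unfolding ring_iso_def by simp
qed

end

theorem theorem3:
  fixes A :: "('a, 'm) ring_scheme" and K L :: "'a set"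
    and \<beta> :: "'a arrow \<Rightarrow> 'a arrow \<Rightarrow> 'a"
  assumes "algebraic_closure A K"
    and "separable_extension A K L"
    and "crossed_cocycle A K L \<beta>"
  shows "(separable_over (crossed_product A K L \<beta>) (crossed_product_0 A K L \<beta>)
            \<longleftrightarrow> finite (field_auts A K L)) \<and>
    (galois_extension A K L \<longrightarrow>
       (\<lambda>x. crossed_monom A x (id_arrow L))
         \<in> ring_iso (A\<lparr>carrier := L\<rparr>)
             (crossed_product A K L \<beta>\<lparr>carrier := crossed_product_0 A K L \<beta>\<rparr>) \<and>
       (separable_over (crossed_product A K L \<beta>) (crossed_product_0 A K L \<beta>)
          \<longleftrightarrow> ring.finite_dimension A K L))"
proof -
  have L: "subfield L A" "K \<subseteq> L" using assms(2) unfolding separable_extension_def by auto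
  interpret algebraic_closure_of A K by (rule algebraic_closure_of.intro[OF assms(1)])
  interpret object_crossed_product A K L \<beta>
    by (intro object_crossed_product.intro algebraic_closure_of_axioms
        object_crossed_product_axioms.intro L assms(3))
  interpret intermediate_field A K L
    by (intro intermediate_field.intro algebraic_closure_of_axioms intermediate_field_axioms.intro L)
  show ?thesis
    using separable_iff_finite_auts galois_finite_iff normal_mon_iso
    unfolding galois_extension_def by blast
qed

end
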